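(* Let $E$ be a countable Borel equivalence relation on a standard Borel space $X$, and let $G$ be a Borel median graphing of $E$ with finite hyperplanes. Then there is a Borel subtreeing $T\subseteq G$ of $E$, i.e., an acyclic Borel graph $T\subseteq G$ whose connectedness relation is $E$. If moreover $G$ has bounded degree and the hyperplanes of $G$ have bounded diameters, then $T$ may be constructed so that the inclusion $T\to G$ is a quasi-isometry, i.e., for each $E$-class $C$ the identity map $(C,d_{T})\to(C,d_{G})$ between path metrics is a quasi-isometry.
   Context: A countable Borel equivalence relation (CBER) is a Borel equivalence relation with countable classes. A graph is a symmetric irreflexive relation. A Borel graphing of $E$ is a Borel graph $G\subseteq X^2$ whose connectedness relation is exactly $E$; it is a median graphing if every component is a median graph. For a connected graph with path metric $d$, the interval $[x,y]$ is $\{z: d(x,z)+d(z,y)=d(x,y)\}$. A median graph is a connected graph such that for all vertices $x,y,z$ the set $[x,y]\cap[y,z]\cap[z,x]$ is a singleton. A set $A$ of vertices is convex if $[x,y]\subseteq A$ for all $x,y\in A$. A half-space is a convex set $H$ with convex complement. A hyperplane is the set of (oriented) edges $(x,y)$ with $x\notin H\ni y$, for a half-space $H$ different from $\emptyset$ and the whole vertex set. "Finite hyperplanes" means every hyperplane of every component is a finite set of edges. "Bounded diameters" of hyperplanes means there is $R<\infty$ such that for every hyperplane the set of endpoints of its edges has diameter at most $R$ in the path metric; "bounded degree" means there is $D<\infty$ such that every vertex has at most $D$ neighbors. A map $f:X\to Y$ of metric spaces is a quasi-isometry if there are $g:Y\to X$ and a constant $K<\infty$ with $d(f(x),f(x'))\le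 K d(x,x')+K$, $d(g(y),g(y'))\le K d(y,y')+K$, $d(x,g(f(x)))\le K$, $d(y,f(g(y)))\le K$ for all $x,x'\in X$, $y,y'\in Y$. *)

theory Defs
  imports "HOL-Analysis.Analysis"
begin

definition standard_borel :: "'a measure \<Rightarrow> bool" where
  "standard_borel M \<longleftrightarrow>
     (\<exists>T. topspace T = space M \<and> completely_metrizable_space T \<and> second_countable T \<and>
          sets M = sigma_sets (space M) {U. openin T U})"

definition cber :: "'a measure \<Rightarrow> ('a \<times> 'a) set \<Rightarrow> bool" where
  "cber M E \<longleftrightarrow>
     equiv (space M) E \<and> E \<in> sets (M \<Otimes>\<^sub>M M) \<and> (\<forall>x\<in>space M. countable (E `` {x}))"

definition graph_on :: "'a set \<Rightarrow> ('a \<times> 'a) set \<Rightarrow> bool" where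
  "graph_on V G \<longleftrightarrow> G \<subseteq> V \<times> V \<and> sym G \<and> irrefl G"

text \<open>The intersection only discards the pairs \<open>(x, x)\<close> with \<open>x \<notin> V\<close>, which
  \<^term>\<open>rtrancl\<close> contains for every \<open>x\<close> of the ambient type.\<close>

definition connectedness :: "'a set \<Rightarrow> ('a \<times> 'a) set \<Rightarrow> ('a \<times> 'a) set" where
  "connectedness V G = G\<^sup>* \<inter> V \<times> V"

definition connected_graph :: "'a set \<Rightarrow> ('a \<times> 'a) set \<Rightarrow> bool" where
  "connected_graph V G \<longleftrightarrow> graph_on V G \<and> connectedness V G = V \<times> V"

text \<open>The connected components are the pairs \<open>(C, Restr G C)\<close> with \<open>C\<close> in the following set.\<close>

definition components_on :: "'a set \<Rightarrow> ('a \<times> 'a) set \<Rightarrow> 'a set set" where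
  "components_on V G = V // connectedness V G"

definition acyclic_graph :: "('a \<times> 'a) set \<Rightarrow> bool" where
  "acyclic_graph G \<longleftrightarrow>
     \<not> (\<exists>xs. length xs \<ge> 3 \<and> distinct xs \<and> successively (\<lambda>x y. (x, y) \<in> G) xs \<and>
             (last xs, hd xs) \<in> G)"

text \<open>Path metric; meaningful only for \<open>x\<close>, \<open>y\<close> in the same component (the value is unspecified
  otherwise), hence always used below within one component.\<close>

definition gdist :: "('a \<times> 'a) set \<Rightarrow> 'a \<Rightarrow> 'a \<Rightarrow> real" where
  "gdist G x y = real (LEAST n. (x, y) \<in> G ^^ n)"

lemma Metric_space_gdist:
  assumes "connected_graph V G"
  shows "Metric_space V (gdist G)"
proof
  have G: "sym G" "V \<times> V \<subseteq> G\<^sup>*"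
    using assms by (auto simp: connected_graph_def graph_on_def connectedness_def)
  have least: "(x, y) \<in> G ^^ (LEAST n. (x, y) \<in> G ^^ n)" if "x \<in> V" "y \<in> V" for x y
    using G(2) that by (metis LeastI SigmaI rtrancl_power subsetD)
  fix x y z
  show "0 \<le> gdist G x y" by (simp add: gdist_def)
  have "(a, b) \<in> G ^^ n \<Longrightarrow> (b, a) \<in> G ^^ n" for a b n
  proof (induction n arbitrary: b)
    case (Suc n)
    then obtain c where "(a, c) \<in> G ^^ n" "(c, b) \<in> G" by auto
    then show ?case using Suc.IH G(1) by (meson relpow_Suc_I2 symD)
  qed simp
  then show "gdist G x y = gdist G y x"
    unfolding gdist_def by metis
  show "(gdist G x y = 0) = (x = y)" if "x \<in> V" "y \<in> V"
    using least[OF that] by (auto simp: gdist_def intro: Least_eq_0)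
  show "gdist G x z \<le> gdist G x y + gdist G y z" if "x \<in> V" "y \<in> V" "z \<in> V"
  proof -
    have "(x, z) \<in> G ^^ ((LEAST n. (x, y) \<in> G ^^ n) + (LEAST n. (y, z) \<in> G ^^ n))"
      using least that by (auto simp: relpow_add)
    then show ?thesis
      unfolding gdist_def by (metis Least_le of_nat_add of_nat_mono)
  qed
qed

definition geod_interval :: "'a set \<Rightarrow> ('a \<times> 'a) set \<Rightarrow> 'a \<Rightarrow> 'a \<Rightarrow> 'a set" where
  "geod_interval V G x y = {z\<in>V. gdist G x z + gdist G z y = gdist G x y}"

definition median_graph :: "'a set \<Rightarrow> ('a \<times> 'a) set \<Rightarrow> bool" where
  "median_graph V G \<longleftrightarrow>
     connected_graph V G \<and>
     (\<forall>x\<in>V. \<forall>y\<in>V. \<forall>z\<in>V.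
        is_singleton (geod_interval V G x y \<inter> geod_interval V G y z \<inter> geod_interval V G z x))"

definition convex_in :: "'a set \<Rightarrow> ('a \<times> 'a) set \<Rightarrow> 'a set \<Rightarrow> bool" where
  "convex_in V G A \<longleftrightarrow> A \<subseteq> V \<and> (\<forall>x\<in>A. \<forall>y\<in>A. geod_interval V G x y \<subseteq> A)"

definition half_space :: "'a set \<Rightarrow> ('a \<times> 'a) set \<Rightarrow> 'a set \<Rightarrow> bool" where
  "half_space V G H \<longleftrightarrow> convex_in V G H \<and> convex_in V G (V - H)"

definition hyperplanes :: "'a set \<Rightarrow> ('a \<times> 'a) set \<Rightarrow> ('a \<times> 'a) set set" where
  "hyperplanes V G =
     {{(x, y). (x, y) \<in> G \<and> x \<notin> H \<and> y \<in> H} | H. half_space V G H \<and> H \<noteq> {} \<and> H \<noteq> V}"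

definition borel_graph :: "'a measure \<Rightarrow> ('a \<times> 'a) set \<Rightarrow> bool" where
  "borel_graph M G \<longleftrightarrow> graph_on (space M) G \<and> G \<in> sets (M \<Otimes>\<^sub>M M)"

definition borel_graphing :: "'a measure \<Rightarrow> ('a \<times> 'a) set \<Rightarrow> ('a \<times> 'a) set \<Rightarrow> bool" where
  "borel_graphing M E G \<longleftrightarrow> borel_graph M G \<and> connectedness (space M) G = E"

definition borel_median_graphing :: "'a measure \<Rightarrow> ('a \<times> 'a) set \<Rightarrow> ('a \<times> 'a) set \<Rightarrow> bool" where
  "borel_median_graphing M E G \<longleftrightarrow>
     borel_graphing M E G \<and> (\<forall>C\<in>components_on (space M) G. median_graph C (Restr G C))"

definition borel_treeing :: "'a measure \<Rightarrow> ('a \<times> 'a) set \<Rightarrow> ('a \<times> 'a) set \<Rightarrow> bool" where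
  "borel_treeing M E T \<longleftrightarrow> borel_graphing M E T \<and> acyclic_graph T"

definition finite_hyperplanes :: "'a set \<Rightarrow> ('a \<times> 'a) set \<Rightarrow> bool" where
  "finite_hyperplanes V G \<longleftrightarrow>
     (\<forall>C\<in>components_on V G. \<forall>h\<in>hyperplanes C (Restr G C). finite h)"

definition bounded_diameter_hyperplanes :: "'a set \<Rightarrow> ('a \<times> 'a) set \<Rightarrow> bool" where
  "bounded_diameter_hyperplanes V G \<longleftrightarrow>
     (\<exists>R::real. \<forall>C\<in>components_on V G. \<forall>h\<in>hyperplanes C (Restr G C).
        \<forall>x\<in>Field h. \<forall>y\<in>Field h. gdist (Restr G C) x y \<le> R)"

definition bounded_degree :: "'a set \<Rightarrow> ('a \<times> 'a) set \<Rightarrow> bool" where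
  "bounded_degree V G \<longleftrightarrow> (\<exists>D::nat. \<forall>x\<in>V. finite (G `` {x}) \<and> card (G `` {x}) \<le> D)"

definition quasi_isometry ::
  "'a set \<Rightarrow> ('a \<Rightarrow> 'a \<Rightarrow> real) \<Rightarrow> 'b set \<Rightarrow> ('b \<Rightarrow> 'b \<Rightarrow> real) \<Rightarrow> ('a \<Rightarrow> 'b) \<Rightarrow> bool" where
  "quasi_isometry X dX Y dY f \<longleftrightarrow>
     f \<in> X \<rightarrow> Y \<and>
     (\<exists>g\<in>Y \<rightarrow> X. \<exists>K::real.
        (\<forall>x\<in>X. \<forall>x'\<in>X. dY (f x) (f x') \<le> K * dX x x' + K) \<and>
        (\<forall>y\<in>Y. \<forall>y'\<in>Y. dX (g y) (g y') \<le> K * dY y y' + K) \<and>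
        (\<forall>x\<in>X. dX x (g (f x)) \<le> K) \<and>
        (\<forall>y\<in>Y. dY y (f (g y)) \<le> K))"

end

theory Submission
  imports Defs "HOL-Library.Sublist"
begin

text \<open>Two hyperplanes cross when all four intersections of their half-spaces are nonempty. Each
  hyperplane crosses only finitely many others, so the hyperplanes have a Borel colouring by natural
  numbers in which hyperplanes of the same colour do not cross. Call two vertices \<open>n\<close>-equivalent when
  all hyperplanes between them have colour below \<open>n\<close>. For every hyperplane \<open>h\<close> of colour \<open>n\<close>, the tree
  receives one edge of \<open>h\<close> out of each class of edges of \<open>h\<close> whose endpoints on the same side are
  \<open>n\<close>-equivalent; the classes are finite, so the choice is Borel. By induction on the colour, every
  discarded edge is joined to its representative by geodesics in smaller colours, which gives
  connectedness, and a quasi-isometry when colours and diameters are bounded. On a cycle, two closest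
  edges in a common hyperplane of the maximal colour \<open>n\<close> enclose only smaller colours, because
  hyperplanes of colour \<open>n\<close> do not cross; hence they represent the same class and coincide, which a
  cycle does not allow.

  All Borelness rests on the Lusin--Novikov theorem, applied to \<open>E\<close>: it turns quantification over a
  class into a countable union.\<close>

subsection \<open>Analytic sets and separation\<close>

text \<open>A square shows what has to be balanced: keeping one edge per hyperplane disconnects it,
  keeping all edges leaves a cycle. The order of the colours resolves this. Colour 0 keeps all its
  edges, since only equal vertices are 0-equivalent, and a hyperplane of larger colour is thinned
  only as far as smaller colours can make up for the loss. The induction for connectedness descends
  through natural numbers, so infinitely many colours do no harm there; lengths, however, are
  multiplied at each colour, which is why the metric statement asks for a bound on the colours.

  Points are accessible only through a countable separating family of Borel tests. A partial Borel
  function is therefore handled as the sequence of preimages of the tests, and Lusin--Novikov is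
  first proved for such sequences. Completeness makes the space analytic and turns the sequences
  into measurable functions.\<close>

definition agree :: "nat \<Rightarrow> (nat \<Rightarrow> nat) \<Rightarrow> (nat \<Rightarrow> nat) \<Rightarrow> bool" where
  "agree n c c' \<longleftrightarrow> (\<forall>i<n. c' i = c i)"

lemma agree_mono: "agree n c c' \<Longrightarrow> m \<le> n \<Longrightarrow> agree m c c'"
  by (simp add: agree_def)

lemma agree_Suc: "agree (Suc n) c c' \<longleftrightarrow> c' 0 = c 0 \<and> agree n (c \<circ> Suc) (c' \<circ> Suc)"
  by (auto simp: agree_def less_Suc_eq_0_disj)

text \<open>Closedness in the Baire space, whose basic neighbourhoods of \<open>c\<close> are the
  sets \<open>{c'. agree n c c'}\<close>.\<close>

definition seq_closed :: "(nat \<Rightarrow> nat) set \<Rightarrow> bool" where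
  "seq_closed C \<longleftrightarrow> (\<forall>c. (\<forall>n. \<exists>c'\<in>C. agree n c c') \<longrightarrow> c \<in> C)"

text \<open>Continuity of \<open>p\<close> on \<open>C\<close> into the discrete two-point
  space.\<close>

definition locally_decided :: "(nat \<Rightarrow> nat) set \<Rightarrow> ((nat \<Rightarrow> nat) \<Rightarrow> bool) \<Rightarrow> bool" where
  "locally_decided C p \<longleftrightarrow> (\<forall>c\<in>C. \<exists>n. \<forall>c'\<in>C. agree n c c' \<longrightarrow> p c' = p c)"

text \<open>\<open>\<phi>\<close> is continuous on the closed set \<open>C\<close> when the members of \<open>VV\<close> are declared
  clopen. Thus the presented sets are the analytic ones, with the topology of the ambient space replaced by
  a family of tests.\<close>

definition presentation :: "'b set set \<Rightarrow> (nat \<Rightarrow> nat) set \<Rightarrow> ((nat \<Rightarrow> nat) \<Rightarrow> 'b) \<Rightarrow> bool" where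
  "presentation VV C \<phi> \<longleftrightarrow> seq_closed C \<and> (\<forall>V\<in>VV. locally_decided C (\<lambda>c. \<phi> c \<in> V))"

definition presented :: "'b set set \<Rightarrow> 'b set \<Rightarrow> bool" where
  "presented VV S \<longleftrightarrow> (\<exists>C \<phi>. presentation VV C \<phi> \<and> \<phi> ` C = S)"

lemma presentedI:
  "seq_closed C \<Longrightarrow> (\<And>V. V \<in> VV \<Longrightarrow> locally_decided C (\<lambda>c. \<phi> c \<in> V)) \<Longrightarrow> \<phi> ` C = S \<Longrightarrow> presented VV S"
  unfolding presented_def presentation_def by blast

text \<open>Takes over the role of the Hausdorff property in the intersection and separation
  arguments.\<close>

definition separating :: "'b set \<Rightarrow> 'b set set \<Rightarrow> bool" where
  "separating \<Omega> VV \<longleftrightarrow> (\<forall>x\<in>\<Omega>. \<forall>y\<in>\<Omega>. (\<forall>V\<in>VV. x \<in> V \<longleftrightarrow> y \<in> V) \<longrightarrow> x = y)"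

lemma seq_closed_Inter: "(\<And>C. C \<in> K \<Longrightarrow> seq_closed C) \<Longrightarrow> seq_closed (\<Inter>K)"
  unfolding seq_closed_def by (metis InterE InterI)

lemma seq_closed_Int: "seq_closed A \<Longrightarrow> seq_closed B \<Longrightarrow> seq_closed (A \<inter> B)"
  using seq_closed_Inter[of "{A, B}"] by auto

lemma agree_comp:
  fixes h :: "nat \<Rightarrow> nat" and n :: nat
  shows "\<exists>N::nat. \<forall>c c' :: nat \<Rightarrow> nat. agree N c c' \<longrightarrow> agree n (c \<circ> h) (c' \<circ> h)"
proof -
  have "h i < Suc (Max (h ` {..n}))" if "i < n" for i
    using that by (intro le_imp_less_Suc Max_ge) auto
  then show ?thesis unfolding agree_def comp_def by blast
qed

lemma seq_closed_comp:
  assumes "seq_closed C" shows "seq_closed {c. c \<circ> h \<in> C}"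
  unfolding seq_closed_def
proof (intro allI impI CollectI)
  fix c assume *: "\<forall>n. \<exists>c'\<in>{c. c \<circ> h \<in> C}. agree n c c'"
  have "\<exists>c'\<in>C. agree n (c \<circ> h) c'" for n
  proof -
    obtain N where N: "\<forall>c c' :: nat \<Rightarrow> nat. agree N c c' \<longrightarrow> agree n (c \<circ> h) (c' \<circ> h)"
      using agree_comp[where n=n and h=h] by blast
    show ?thesis using *[rule_format, of N] N by auto
  qed
  with assms show "c \<circ> h \<in> C" unfolding seq_closed_def by blast
qed

lemma locally_decided_comp:
  assumes "locally_decided C p" shows "locally_decided {c. c \<circ> h \<in> C} (\<lambda>c. p (c \<circ> h))"
  unfolding locally_decided_def
proof
  fix c assume "c \<in> {c. c \<circ> h \<in> C}"
  then obtain n where n: "\<forall>c'\<in>C. agree n (c \<circ> h) c' \<longrightarrow> p c' = p (c \<circ> h)"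
    using assms unfolding locally_decided_def by blast
  obtain N where N: "\<forall>c c' :: nat \<Rightarrow> nat. agree N c c' \<longrightarrow> agree n (c \<circ> h) (c' \<circ> h)"
    using agree_comp[where n=n and h=h] by blast
  show "\<exists>n. \<forall>c'\<in>{c. c \<circ> h \<in> C}. agree n c c' \<longrightarrow> p (c' \<circ> h) = p (c \<circ> h)"
    using n N by auto
qed

lemma locally_decided_mono: "locally_decided C p \<Longrightarrow> D \<subseteq> C \<Longrightarrow> locally_decided D p"
  unfolding locally_decided_def by blast

lemma locally_decided_Not: "locally_decided C p \<Longrightarrow> locally_decided C (\<lambda>c. \<not> p c)"
  unfolding locally_decided_def by simp

lemma locally_decided_iff:
  assumes "locally_decided C p" "locally_decided C q"
  shows "locally_decided C (\<lambda>c. p c \<longleftrightarrow> q c)"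
  unfolding locally_decided_def
proof
  fix c assume "c \<in> C"
  then obtain m n where "\<forall>c'\<in>C. agree m c c' \<longrightarrow> p c' = p c" "\<forall>c'\<in>C. agree n c c' \<longrightarrow> q c' = q c"
    using assms unfolding locally_decided_def by metis
  then have "\<forall>c'\<in>C. agree (max m n) c c' \<longrightarrow> (p c' \<longleftrightarrow> q c') = (p c \<longleftrightarrow> q c)"
    using agree_mono[of "max m n" c _ m] agree_mono[of "max m n" c _ n] by simp
  then show "\<exists>n. \<forall>c'\<in>C. agree n c c' \<longrightarrow> (p c' \<longleftrightarrow> q c') = (p c \<longleftrightarrow> q c)" by blast
qed

lemma seq_closed_decided:
  assumes "seq_closed C" "locally_decided C p" shows "seq_closed {c\<in>C. p c}"
  unfolding seq_closed_def
proof (intro allI impI)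
  fix c assume *: "\<forall>n. \<exists>c'\<in>{c\<in>C. p c}. agree n c c'"
  then have "c \<in> C" using assms(1) unfolding seq_closed_def by blast
  then obtain n where "\<forall>c'\<in>C. agree n c c' \<longrightarrow> p c' = p c"
    using assms(2) unfolding locally_decided_def by blast
  with *[rule_format, of n] \<open>c \<in> C\<close> show "c \<in> {c\<in>C. p c}" by auto
qed

section \<open>Closure properties of analytic sets\<close>

lemma presentation_decided:
  "presentation VV C \<phi> \<Longrightarrow> locally_decided C p \<Longrightarrow> presentation VV {c\<in>C. p c} \<phi>"
  unfolding presentation_def by (auto intro: seq_closed_decided locally_decided_mono)

lemma presented_decided:
  "presentation VV C \<phi> \<Longrightarrow> locally_decided C p \<Longrightarrow> presented VV (\<phi> ` {c\<in>C. p c})"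
  unfolding presented_def using presentation_decided by blast

lemma presented_Int_test:
  assumes "presented VV S" "V \<in> VV" shows "presented VV (S \<inter> V)" "presented VV (S - V)"
proof -
  obtain C \<phi> where C: "presentation VV C \<phi>" "\<phi> ` C = S" using assms(1) by (auto simp: presented_def)
  have *: "locally_decided C (\<lambda>c. \<phi> c \<in> V)" using C(1) assms(2) by (auto simp: presentation_def)
  have "\<phi> ` {c\<in>C. \<phi> c \<in> V} = S \<inter> V" "\<phi> ` {c\<in>C. \<phi> c \<notin> V} = S - V" using C(2) by auto
  then show "presented VV (S \<inter> V)" "presented VV (S - V)"
    using presented_decided[OF C(1) *] presented_decided[OF C(1) locally_decided_Not[OF *]] by simp_all
qed

lemma presented_empty: "presented VV {}"
  unfolding presented_def presentation_def
  by (rule exI[of _ "{}"]) (auto simp: seq_closed_def locally_decided_def)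

text \<open>Topological sum: the first digit of a code selects the piece and the rest is a code
  inside it. One digit already fixes the piece, so closedness and local decisions are
  inherited.\<close>

lemma presented_UN:
  assumes "\<And>n::nat. presented VV (S n)" shows "presented VV (\<Union>n. S n)"
proof -
  obtain C \<phi> where C: "\<And>n. presentation VV (C n) (\<phi> n)" "\<And>n. \<phi> n ` C n = S n"
    using assms unfolding presented_def by metis
  let ?C = "{c. c \<circ> Suc \<in> C (c 0)}" and ?\<phi> = "\<lambda>c. \<phi> (c 0) (c \<circ> Suc)"
  have "seq_closed ?C"
    unfolding seq_closed_def
  proof (intro allI impI CollectI)
    fix c assume *: "\<forall>n. \<exists>c'\<in>?C. agree n c c'"
    have "\<exists>c'\<in>C (c 0). agree n (c \<circ> Suc) c'" for n
    proof -
      obtain c' where "c' \<in> ?C" "agree (Suc n) c c'" using *[rule_format, of "Suc n"] by blast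
      then show ?thesis by (auto simp: agree_Suc)
    qed
    with C(1) show "c \<circ> Suc \<in> C (c 0)" unfolding presentation_def seq_closed_def by blast
  qed
  moreover have "locally_decided ?C (\<lambda>c. ?\<phi> c \<in> V)" if V: "V \<in> VV" for V
    unfolding locally_decided_def
  proof
    fix c assume "c \<in> ?C"
    then have "c \<circ> Suc \<in> C (c 0)" by simp
    moreover have "locally_decided (C (c 0)) (\<lambda>x. \<phi> (c 0) x \<in> V)" using C(1) V by (auto simp: presentation_def)
    ultimately obtain n where "\<forall>c'\<in>C (c 0). agree n (c \<circ> Suc) c' \<longrightarrow> (\<phi> (c 0) c' \<in> V) = (?\<phi> c \<in> V)"
      unfolding locally_decided_def by blast
    then have "\<forall>c'\<in>?C. agree (Suc n) c c' \<longrightarrow> (?\<phi> c' \<in> V) = (?\<phi> c \<in> V)"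
      by (auto simp: agree_Suc)
    then show "\<exists>n. \<forall>c'\<in>?C. agree n c c' \<longrightarrow> (?\<phi> c' \<in> V) = (?\<phi> c \<in> V)" by blast
  qed
  moreover have "?\<phi> ` ?C = (\<Union>n. S n)"
  proof
    show "?\<phi> ` ?C \<subseteq> (\<Union>n. S n)" using C(2) by blast
    show "(\<Union>n. S n) \<subseteq> ?\<phi> ` ?C"
    proof
      fix x assume "x \<in> (\<Union>n. S n)"
      then obtain n c where "c \<in> C n" "x = \<phi> n c" using C(2) by blast
      then have "x = ?\<phi> (case_nat n c)" "case_nat n c \<in> ?C" by (auto simp: comp_def)
      then show "x \<in> ?\<phi> ` ?C" by blast
    qed
  qed
  ultimately show ?thesis by (rule presentedI)
qed

text \<open>One sequence stores a code for every \<open>S n\<close>, and all these codes must name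
  the same point. For each test this agreement is a relatively clopen condition, so imposing all of
  them leaves a closed set, and separating tests turn agreement into equality.\<close>

lemma presented_INT:
  assumes "\<And>n::nat. presented VV (S n)" and sep: "separating \<Omega> VV" and sub: "\<And>n. S n \<subseteq> \<Omega>"
  shows "presented VV (\<Inter>n. S n)"
proof -
  obtain C \<phi> where C: "\<And>n. presentation VV (C n) (\<phi> n)" "\<And>n. \<phi> n ` C n = S n"
    using assms(1) unfolding presented_def by metis
  define h where "h n = (\<lambda>k. prod_encode (n, k))" for n :: nat
  define D where "D = (\<Inter>n. {c. c \<circ> h n \<in> C n})"
  define agr where "agr n V = (\<lambda>c. \<phi> n (c \<circ> h n) \<in> V \<longleftrightarrow> \<phi> 0 (c \<circ> h 0) \<in> V)" for n V
  have D: "seq_closed D"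
    unfolding D_def using C(1) by (auto intro!: seq_closed_Inter seq_closed_comp simp: presentation_def)
  have ld: "locally_decided D (\<lambda>c. \<phi> n (c \<circ> h n) \<in> V)" if "V \<in> VV" for n V
    by (rule locally_decided_mono[OF locally_decided_comp[of "C n"]])
       (use C(1) that in \<open>auto simp: presentation_def D_def\<close>)
  define D' where "D' = \<Inter>(insert D {{c\<in>D. agr n V c} | n V. V \<in> VV})"
  have "seq_closed D'"
    unfolding D'_def agr_def
    by (rule seq_closed_Inter) (use D in \<open>auto intro!: seq_closed_decided locally_decided_iff ld\<close>)
  then have "presentation VV D' (\<lambda>c. \<phi> 0 (c \<circ> h 0))"
    unfolding presentation_def using ld by (auto intro: locally_decided_mono simp: D'_def)
  moreover have "(\<lambda>c. \<phi> 0 (c \<circ> h 0)) ` D' = (\<Inter>n. S n)"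
  proof
    show "(\<lambda>c. \<phi> 0 (c \<circ> h 0)) ` D' \<subseteq> (\<Inter>n. S n)"
    proof clarify
      fix c n assume c: "c \<in> D'"
      then have "c \<in> D" by (auto simp: D'_def)
      then have S: "\<phi> m (c \<circ> h m) \<in> S m" for m using C(2) by (auto simp: D_def)
      have "\<phi> n (c \<circ> h n) \<in> V \<longleftrightarrow> \<phi> 0 (c \<circ> h 0) \<in> V" if "V \<in> VV" for V
        using c that unfolding D'_def agr_def by blast
      then have "\<phi> n (c \<circ> h n) = \<phi> 0 (c \<circ> h 0)"
        using sep sub S unfolding separating_def by blast
      then show "\<phi> 0 (c \<circ> h 0) \<in> S n" using S by metis
    qed
    show "(\<Inter>n. S n) \<subseteq> (\<lambda>c. \<phi> 0 (c \<circ> h 0)) ` D'"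
    proof
      fix x assume "x \<in> (\<Inter>n. S n)"
      then have ex: "\<exists>c. c \<in> C n \<and> \<phi> n c = x" for n
        using C(2)[of n] by (metis INT_E UNIV_I imageE)
      define b where "b n = (SOME c. c \<in> C n \<and> \<phi> n c = x)" for n
      have b: "b n \<in> C n" "\<phi> n (b n) = x" for n
        using someI_ex[OF ex[of n]] by (simp_all add: b_def)
      define c where "c = (\<lambda>i. case prod_decode i of (n, k) \<Rightarrow> b n k)"
      have "c \<circ> h n = b n" for n by (auto simp: c_def h_def)
      then have "c \<in> D" "x = \<phi> 0 (c \<circ> h 0)" "\<And>n V. agr n V c" using b by (simp_all add: D_def agr_def)
      then have "c \<in> D'" "x = \<phi> 0 (c \<circ> h 0)" by (auto simp: D'_def)
      then show "x \<in> (\<lambda>c. \<phi> 0 (c \<circ> h 0)) ` D'" by blast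
    qed
  qed
  ultimately show ?thesis unfolding presented_def by blast
qed

lemma presented_INT_countable:
  assumes "countable I" "I \<noteq> {}" "\<And>i. i \<in> I \<Longrightarrow> presented VV (S i)" "separating \<Omega> VV" "\<And>i. i \<in> I \<Longrightarrow> S i \<subseteq> \<Omega>"
  shows "presented VV (\<Inter>i\<in>I. S i)"
proof -
  have "(\<Inter>i\<in>I. S i) = (\<Inter>n. S (from_nat_into I n))"
    using assms(1,2) by (metis image_image range_from_nat_into)
  then show ?thesis
    using presented_INT[of VV "\<lambda>n. S (from_nat_into I n)" \<Omega>] assms from_nat_into by metis
qed

lemma presented_Int:
  assumes "presented VV A" "presented VV B" "separating \<Omega> VV" "A \<subseteq> \<Omega>" "B \<subseteq> \<Omega>"
  shows "presented VV (A \<inter> B)"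
  using presented_INT_countable[of "{A, B}" VV "\<lambda>x. x" \<Omega>] assms by auto

text \<open>Complements of analytic sets need not be analytic, so the induction carries
  \<open>S\<close> and its complement together; the complement case then only exchanges the
  two.\<close>

lemma presented_sigma_sets:
  assumes "presented VV \<Omega>" "separating \<Omega> VV" "\<And>V. V \<in> VV \<Longrightarrow> V \<subseteq> \<Omega>" "S \<in> sigma_sets \<Omega> VV"
  shows "presented VV S"
proof -
  have "presented VV S \<and> presented VV (\<Omega> - S)"
    using assms(4)
  proof induction
    case (Basic a)
    then show ?case using presented_Int_test[OF assms(1) Basic] assms(3) by (auto simp: Int_absorb1)
  next
    case Empty then show ?case using assms(1) presented_empty by simp
  next
    case (Compl a)
    then have "a \<subseteq> \<Omega>" using sigma_sets_into_sp[of VV \<Omega>] assms(3) by blast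
    then show ?case using Compl by (simp add: double_diff)
  next
    case (Union a)
    have "\<Omega> - (\<Union>i. a i) = (\<Inter>i. \<Omega> - a i)" by auto
    then show ?case
      using presented_UN[of VV a] presented_INT[OF _ assms(2), of "\<lambda>i. \<Omega> - a i"] Union by auto
  qed
  then show ?thesis ..
qed

lemma presented_fst:
  assumes "presented ((\<lambda>V. V \<times> \<Omega>) ` VV \<union> (\<lambda>V. \<Omega> \<times> V) ` VV) S" "S \<subseteq> \<Omega> \<times> \<Omega>"
  shows "presented VV (fst ` S)"
proof -
  obtain C \<phi> where C: "presentation ((\<lambda>V. V \<times> \<Omega>) ` VV \<union> (\<lambda>V. \<Omega> \<times> V) ` VV) C \<phi>" "\<phi> ` C = S"
    using assms(1) by (auto simp: presented_def)
  have "locally_decided C (\<lambda>c. fst (\<phi> c) \<in> V)" if "V \<in> VV" for V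
  proof -
    have "locally_decided C (\<lambda>c. \<phi> c \<in> V \<times> \<Omega>)" using C(1) that by (auto simp: presentation_def)
    moreover have "\<phi> c \<in> V \<times> \<Omega> \<longleftrightarrow> fst (\<phi> c) \<in> V" if "c \<in> C" for c
      using that C(2) assms(2) by (auto simp: mem_Times_iff)
    ultimately show ?thesis by (simp add: locally_decided_def)
  qed
  then have "presentation VV C (fst \<circ> \<phi>)" using C(1) by (auto simp: presentation_def)
  moreover have "(fst \<circ> \<phi>) ` C = fst ` S" using C(2) by auto
  ultimately show ?thesis unfolding presented_def by blast
qed

text \<open>Even digits code the first coordinate, odd digits the second.\<close>

lemma presented_Times:
  assumes "presented VV \<Omega>"
  shows "presented ((\<lambda>V. V \<times> \<Omega>) ` VV \<union> (\<lambda>V. \<Omega> \<times> V) ` VV) (\<Omega> \<times> \<Omega>)"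
proof -
  obtain C \<phi> where C: "presentation VV C \<phi>" "\<phi> ` C = \<Omega>" using assms by (auto simp: presented_def)
  let ?a = "\<lambda>n::nat. 2 * n" and ?b = "\<lambda>n::nat. 2 * n + 1"
  define D where "D = {c. c \<circ> ?a \<in> C} \<inter> {c. c \<circ> ?b \<in> C}"
  define \<psi> where "\<psi> c = (\<phi> (c \<circ> ?a), \<phi> (c \<circ> ?b))" for c
  have ld: "locally_decided D (\<lambda>c. \<phi> (c \<circ> ?a) \<in> V)" "locally_decided D (\<lambda>c. \<phi> (c \<circ> ?b) \<in> V)"
    if V: "V \<in> VV" for V
  proof -
    have *: "locally_decided C (\<lambda>c. \<phi> c \<in> V)" using C(1) V by (auto simp: presentation_def)
    show "locally_decided D (\<lambda>c. \<phi> (c \<circ> ?a) \<in> V)" "locally_decided D (\<lambda>c. \<phi> (c \<circ> ?b) \<in> V)"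
      by (rule locally_decided_mono[OF locally_decided_comp[OF *]], simp add: D_def)+
  qed
  have "seq_closed D"
    unfolding D_def using C(1) by (auto intro!: seq_closed_Int seq_closed_comp simp: presentation_def)
  moreover have "locally_decided D (\<lambda>c. \<psi> c \<in> W)" if W: "W \<in> (\<lambda>V. V \<times> \<Omega>) ` VV \<union> (\<lambda>V. \<Omega> \<times> V) ` VV" for W
  proof -
    obtain V where V: "V \<in> VV" "W = V \<times> \<Omega> \<or> W = \<Omega> \<times> V" using W by blast
    have "\<phi> (c \<circ> ?a) \<in> \<Omega>" "\<phi> (c \<circ> ?b) \<in> \<Omega>" if "c \<in> D" for c using that C(2) by (auto simp: D_def)
    then have "\<psi> c \<in> W \<longleftrightarrow> (if W = V \<times> \<Omega> then \<phi> (c \<circ> ?a) \<in> V else \<phi> (c \<circ> ?b) \<in> V)" if "c \<in> D" for c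
      using that V(2) by (auto simp: \<psi>_def)
    then show ?thesis using ld[OF V(1)] by (cases "W = V \<times> \<Omega>") (simp_all add: locally_decided_def)
  qed
  moreover have img: "\<psi> ` D = \<Omega> \<times> \<Omega>"
  proof
    show "\<psi> ` D \<subseteq> \<Omega> \<times> \<Omega>" using C(2) by (auto simp: D_def \<psi>_def)
    show "\<Omega> \<times> \<Omega> \<subseteq> \<psi> ` D"
    proof
      fix p assume "p \<in> \<Omega> \<times> \<Omega>"
      then have "p \<in> \<phi> ` C \<times> \<phi> ` C" using C(2) by simp
      then obtain a b where ab: "a \<in> C" "b \<in> C" "p = (\<phi> a, \<phi> b)" by auto
      define c where "c = (\<lambda>n. if even n then a (n div 2) else b (n div 2))"
      have "c \<circ> ?a = a" "c \<circ> ?b = b" by (auto simp: c_def)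
      then have "c \<in> D" "p = \<psi> c" using ab by (auto simp: D_def \<psi>_def)
      then show "p \<in> \<psi> ` D" by blast
    qed
  qed
  ultimately show ?thesis by (rule presentedI)
qed

lemma separating_Times:
  assumes "separating \<Omega> VV"
  shows "separating (\<Omega> \<times> \<Omega>) ((\<lambda>V. V \<times> \<Omega>) ` VV \<union> (\<lambda>V. \<Omega> \<times> V) ` VV)"
  unfolding separating_def
proof (intro ballI impI)
  fix p q assume p: "p \<in> \<Omega> \<times> \<Omega>" "q \<in> \<Omega> \<times> \<Omega>"
    and *: "\<forall>V\<in>(\<lambda>V. V \<times> \<Omega>) ` VV \<union> (\<lambda>V. \<Omega> \<times> V) ` VV. (p \<in> V) = (q \<in> V)"
  have "fst p \<in> V \<longleftrightarrow> fst q \<in> V" "snd p \<in> V \<longleftrightarrow> snd q \<in> V" if "V \<in> VV" for V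
    using *[rule_format, of "V \<times> \<Omega>"] *[rule_format, of "\<Omega> \<times> V"] that p by (auto simp: mem_Times_iff)
  then show "p = q" using assms p unfolding separating_def by (auto simp: mem_Times_iff prod_eq_iff)
qed

lemma sets_pair_sigma_sets:
  assumes "sets M = sigma_sets (space M) VV"
  shows "sets (M \<Otimes>\<^sub>M M) \<subseteq> sigma_sets (space M \<times> space M) ((\<lambda>V. V \<times> space M) ` VV \<union> (\<lambda>V. space M \<times> V) ` VV)"
    (is "_ \<subseteq> sigma_sets ?P ?W")
proof -
  have VV: "V \<subseteq> space M" if "V \<in> VV" for V
    using assms that sets.sets_into_space by (metis sigma_sets.Basic)
  then have "?W \<subseteq> Pow ?P" by auto
  then interpret W: sigma_algebra ?P "sigma_sets ?P ?W" by (rule sigma_algebra_sigma_sets)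
  have "A \<times> space M \<in> sigma_sets ?P ?W \<and> space M \<times> A \<in> sigma_sets ?P ?W"
    if "A \<in> sigma_sets (space M) VV" for A
    using that
  proof induction
    case (Basic a) then show ?case by (auto intro!: sigma_sets.Basic)
  next
    case Empty then show ?case by auto
  next
    case (Compl a)
    have "(space M - a) \<times> space M = ?P - a \<times> space M" "space M \<times> (space M - a) = ?P - space M \<times> a" by auto
    then show ?case using Compl by (auto intro: sigma_sets.Compl)
  next
    case (Union a)
    have "(\<Union>i. a i) \<times> space M = (\<Union>i. a i \<times> space M)" "space M \<times> (\<Union>i. a i) = (\<Union>i. space M \<times> a i)" by auto
    then show ?case using Union by (auto intro: sigma_sets.Union)
  qed
  note R = this
  have "A \<times> B \<in> sigma_sets ?P ?W" if "A \<in> sets M" "B \<in> sets M" for A B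
  proof -
    have "A \<times> B = (A \<times> space M) \<inter> (space M \<times> B)" using that sets.sets_into_space by blast
    then show ?thesis using R that assms by (metis W.Int)
  qed
  then show ?thesis
    unfolding sets_pair_measure by (intro W.sigma_sets_subset) auto
qed

section \<open>Separation of disjoint analytic sets by Borel sets\<close>

lemma infinite_branch:
  assumes "P []" "\<And>a. P a \<Longrightarrow> \<exists>k. P (a @ [k])"
  shows "\<exists>c. \<forall>n. P (map c [0..<n])"
proof -
  obtain f where f: "\<And>n. P (f n)" "\<And>n. \<exists>k. f (Suc n) = f n @ [k]" "f 0 = []"
    using dependent_nat_choice[of "\<lambda>n a. P a \<and> (n = 0 \<longrightarrow> a = [])" "\<lambda>n a b. \<exists>k. b = a @ [k]"] assms
    by (metis old.nat.distinct(1))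
  then obtain k where k: "\<And>n. f (Suc n) = f n @ [k n]" by metis
  have "f n = map k [0..<n]" for n by (induction n) (auto simp: f(3) k)
  then show ?thesis using f(1) by metis
qed

text \<open>If all pairs of one-step extensions can be separated, so can the pair of nodes. A
  failure therefore propagates along an infinite branch. Its two limit codes name different points,
  and a test telling these apart is constant on long enough initial segments, where it does
  separate.\<close>

lemma lusin_separation:
  assumes A: "presented VV A" and B: "presented VV B" and disj: "A \<inter> B = {}"
    and sub: "A \<subseteq> \<Omega>" "B \<subseteq> \<Omega>" and sep: "separating \<Omega> VV" and VV: "\<And>V. V \<in> VV \<Longrightarrow> V \<subseteq> \<Omega>"
  shows "\<exists>S\<in>sigma_sets \<Omega> VV. A \<subseteq> S \<and> S \<inter> B = {}"
proof (rule ccontr)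
  interpret sigma_algebra \<Omega> "sigma_sets \<Omega> VV" by (rule sigma_algebra_sigma_sets) (use VV in auto)
  assume nsep: "\<not> ?thesis"
  obtain C \<phi> where C: "presentation VV C \<phi>" "\<phi> ` C = A" using A by (auto simp: presented_def)
  obtain D \<psi> where D: "presentation VV D \<psi>" "\<psi> ` D = B" using B by (auto simp: presented_def)
  define cyl where "cyl a = {c. map c [0..<length a] = a}" for a :: "nat list"
  define good where "good a b \<longleftrightarrow> (\<exists>S\<in>sigma_sets \<Omega> VV. \<phi> ` (C \<inter> cyl a) \<subseteq> S \<and> S \<inter> \<psi> ` (D \<inter> cyl b) = {})" for a b
  have split: "C \<inter> cyl a = (\<Union>k. C \<inter> cyl (a @ [k]))" for C a by (auto simp: cyl_def)
  have step: "good a b" if *: "\<And>k l. good (a @ [k]) (b @ [l])" for a b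
  proof -
    obtain S where S: "\<And>k l. S k l \<in> sigma_sets \<Omega> VV" "\<And>k l. \<phi> ` (C \<inter> cyl (a @ [k])) \<subseteq> S k l"
      "\<And>k l. S k l \<inter> \<psi> ` (D \<inter> cyl (b @ [l])) = {}"
      using * unfolding good_def by metis
    have "(\<Union>k. \<Inter>l. S k l) \<in> sigma_sets \<Omega> VV" using S(1) by (intro countable_UN countable_INT) auto
    moreover have "\<phi> ` (C \<inter> cyl a) \<subseteq> (\<Union>k. \<Inter>l. S k l)" using S(2) unfolding split[of C a] by blast
    moreover have "(\<Union>k. \<Inter>l. S k l) \<inter> \<psi> ` (D \<inter> cyl b) = {}" using S(3) unfolding split[of D b] by blast
    ultimately show ?thesis unfolding good_def by blast
  qed
  have "\<exists>c. \<forall>n. \<not> good (map fst (map c [0..<n])) (map snd (map c [0..<n]))"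
  proof (rule infinite_branch)
    show "\<not> good (map fst []) (map snd [])" using nsep C(2) D(2) by (simp add: good_def cyl_def)
    fix a :: "(nat \<times> nat) list" assume "\<not> good (map fst a) (map snd a)"
    then obtain k l where "\<not> good (map fst a @ [k]) (map snd a @ [l])" using step by blast
    then have "\<not> good (map fst (a @ [(k, l)])) (map snd (a @ [(k, l)]))" by simp
    then show "\<exists>k. \<not> good (map fst (a @ [k])) (map snd (a @ [k]))" by blast
  qed
  then obtain e where e: "\<And>n. \<not> good (map (fst \<circ> e) [0..<n]) (map (snd \<circ> e) [0..<n])" by auto
  define c d where "c = fst \<circ> e" and "d = snd \<circ> e"
  have cyl: "x \<in> cyl (map y [0..<n]) \<longleftrightarrow> agree n y x" for x y n by (auto simp: cyl_def agree_def)
  have ng: "\<not> good (map c [0..<n]) (map d [0..<n])" for n using e by (simp add: c_def d_def)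
  \<comment> \<open>An empty piece on either side would be separated trivially, by \<open>{}\<close>
    or by \<Omega>; so both branches stay in the closed sets.\<close>
  have "\<exists>c'\<in>C. agree n c c'" for n
    using ng[of n] cyl unfolding good_def by (metis IntE Int_empty_left empty_subsetI equals0I image_empty sigma_sets.Empty)
  then have cC: "c \<in> C" using C(1) unfolding presentation_def seq_closed_def by blast
  have "\<exists>c'\<in>D. agree n d c'" for n
  proof (rule ccontr)
    assume "\<not> ?thesis"
    then have "D \<inter> cyl (map d [0..<n]) = {}" using cyl by auto
    moreover have "\<phi> ` (C \<inter> cyl (map c [0..<n])) \<subseteq> \<Omega>" using C(2) sub(1) by blast
    ultimately have "good (map c [0..<n]) (map d [0..<n])" unfolding good_def using top by auto
    then show False using ng by blast
  qed
  then have dD: "d \<in> D" using D(1) unfolding presentation_def seq_closed_def by blast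
  have "\<phi> c \<in> A" "\<psi> d \<in> B" using cC dD C(2) D(2) by auto
  then have "\<phi> c \<noteq> \<psi> d" using disj by auto
  then obtain V where V: "V \<in> VV" "(\<phi> c \<in> V) \<noteq> (\<psi> d \<in> V)"
    using sep sub \<open>\<phi> c \<in> A\<close> \<open>\<psi> d \<in> B\<close> unfolding separating_def by blast
  obtain m where m: "\<forall>c'\<in>C. agree m c c' \<longrightarrow> (\<phi> c' \<in> V) = (\<phi> c \<in> V)"
    using C(1) V(1) cC unfolding presentation_def locally_decided_def by metis
  obtain n where n: "\<forall>c'\<in>D. agree n d c' \<longrightarrow> (\<psi> c' \<in> V) = (\<psi> d \<in> V)"
    using D(1) V(1) dD unfolding presentation_def locally_decided_def by metis
  let ?n = "max m n"
  let ?S = "if \<phi> c \<in> V then V else \<Omega> - V"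
  have "?S \<in> sigma_sets \<Omega> VV" using V(1) by (auto intro: sigma_sets.intros)
  moreover have "\<phi> ` (C \<inter> cyl (map c [0..<?n])) \<subseteq> ?S"
    using m C(2) sub(1) agree_mono[of ?n c _ m] by (auto simp: cyl)
  moreover have "?S \<inter> \<psi> ` (D \<inter> cyl (map d [0..<?n])) = {}"
    using n V(2) agree_mono[of ?n d _ n] by (auto simp: cyl)
  ultimately have "good (map c [0..<?n]) (map d [0..<?n])" unfolding good_def by blast
  then show False using ng by blast
qed

subsection \<open>The Lusin--Novikov theorem\<close>

lemma strict_prefix_limit:
  fixes f :: "nat \<Rightarrow> 'a list"
  assumes "\<And>n. strict_prefix (f n) (f (Suc n))"
  shows "\<exists>c. \<forall>n. n \<le> length (f n) \<and> map c [0..<length (f n)] = f n"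
proof -
  have mono: "prefix (f m) (f n)" if "m \<le> n" for m n
    using that by (induction rule: dec_induct) (auto intro: assms prefix_order.trans strict_prefixE' prefix_order.less_imp_le)
  have len: "n \<le> length (f n)" for n
  proof (induction n)
    case (Suc n)
    then show ?case using prefix_length_less[OF assms[of n]] by simp
  qed simp
  \<comment> \<open>Entry \<open>i\<close> is read from \<open>f (Suc i)\<close>, which has at least
    \<open>Suc i\<close> entries.\<close>
  define c where "c i = f (Suc i) ! i" for i
  have nth: "x ! i = y ! i" if "prefix x y" "i < length x" for x y :: "'a list" and i
  proof -
    from that(1) obtain zs where "y = x @ zs" by (rule prefixE)
    with that(2) show ?thesis by (simp add: nth_append)
  qed
  have "c i = f n ! i" if i: "i < length (f n)" for i n
  proof (cases "n \<le> Suc i")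
    case True
    from nth[OF mono[OF True] i] show ?thesis by (simp add: c_def)
  next
    case False
    then have "prefix (f (Suc i)) (f n)" by (intro mono) simp
    moreover have "i < length (f (Suc i))" using len[of "Suc i"] by simp
    ultimately show ?thesis unfolding c_def by (rule nth)
  qed
  then have "map c [0..<length (f n)] = f n" for n by (intro nth_equalityI) auto
  with len show ?thesis by blast
qed

definition cyl :: "nat list \<Rightarrow> (nat \<Rightarrow> nat) set" where
  "cyl a = {c. map c [0..<length a] = a}"

lemma presentation_local:
  "presentation VV C \<phi> \<Longrightarrow> V \<in> VV \<Longrightarrow> c \<in> C \<Longrightarrow> \<exists>n. \<forall>c'\<in>C. agree n c c' \<longrightarrow> (\<phi> c' \<in> V) = (\<phi> c \<in> V)"
  unfolding presentation_def locally_decided_def by simp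

lemma cyl_iff: "c \<in> cyl a \<longleftrightarrow> (\<forall>i<length a. c i = a ! i)"
  unfolding cyl_def mem_Collect_eq list_eq_iff_nth_eq by simp

lemma cyl_agree: "c \<in> cyl a \<Longrightarrow> c' \<in> cyl a \<longleftrightarrow> agree (length a) c c'"
  unfolding cyl_iff agree_def by metis

lemma locally_decided_cyl: "locally_decided C (\<lambda>c. c \<in> cyl a)"
  unfolding locally_decided_def
proof
  fix c
  have "c' \<in> cyl a \<longleftrightarrow> c \<in> cyl a" if "agree (length a) c c'" for c'
    using that by (simp add: cyl_iff agree_def)
  then show "\<exists>n. \<forall>c'\<in>C. agree n c c' \<longrightarrow> (c' \<in> cyl a) = (c \<in> cyl a)" by blast
qed

section \<open>Spaces whose points are determined by countably many Borel tests\<close>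

locale coded_space =
  fixes M :: "'a measure" and V :: "nat \<Rightarrow> 'a set"
  assumes sets_M: "sets M = sigma_sets (space M) (range V)"
    and sep: "separating (space M) (range V)"
    and pres: "presented (range V) (space M)"
begin

definition tests :: "('a \<times> 'a) set set" where
  "tests = (\<lambda>V. V \<times> space M) ` range V \<union> (\<lambda>V. space M \<times> V) ` range V"

text \<open>Coding \<open>y\<close> by \<open>{j. y \<in> V j}\<close>, this is the graph of the partial function sending
  \<open>x\<close> to the point with code \<open>{j. x \<in> F j}\<close>.\<close>

definition code_graph :: "(nat \<Rightarrow> 'a set) \<Rightarrow> ('a \<times> 'a) set" where
  "code_graph F = {(x, y). x \<in> space M \<and> y \<in> space M \<and> (\<forall>j. x \<in> F j \<longleftrightarrow> y \<in> V j)}"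

lemma V_sets[measurable]: "V j \<in> sets M"
  using sets_M by auto

lemma V_sub: "V j \<subseteq> space M"
  using V_sets sets.sets_into_space by blast

lemma code_graph_sets:
  assumes [measurable]: "\<And>j. F j \<in> sets M"
  shows "code_graph F \<in> sets (M \<Otimes>\<^sub>M M)"
proof -
  have "code_graph F = {p \<in> space (M \<Otimes>\<^sub>M M). \<forall>j. fst p \<in> F j \<longleftrightarrow> snd p \<in> V j}"
    by (auto simp: code_graph_def space_pair_measure)
  also have "\<dots> \<in> sets (M \<Otimes>\<^sub>M M)" by measurable
  finally show ?thesis .
qed

lemma presented_tests:
  assumes "S \<in> sets (M \<Otimes>\<^sub>M M)" shows "presented tests S"
proof (rule presented_sigma_sets)
  show "presented tests (space M \<times> space M)" unfolding tests_def by (rule presented_Times[OF pres])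
  show "separating (space M \<times> space M) tests" unfolding tests_def by (rule separating_Times[OF sep])
  show "V \<subseteq> space M \<times> space M" if "V \<in> tests" for V using that V_sub by (auto simp: tests_def)
  show "S \<in> sigma_sets (space M \<times> space M) tests"
    using sets_pair_sigma_sets[OF sets_M] assms unfolding tests_def by blast
qed

lemma presented_projection:
  assumes "presented tests S" "S \<subseteq> space M \<times> space M"
  shows "presented (range V) (fst ` S)"
  using presented_fst[of "space M" "range V" S] assms by (simp add: tests_def)

text \<open>If no countable family of such graphs covers \<open>R\<close>, then a Cantor scheme produces
  an uncountable section. A finite set of nodes of the scheme is large if, after removing any countable
  family of graphs, the pieces of \<open>R\<close> at these nodes still have sections over a common point. A node of a
  large set can be split into two nodes with disjoint second projections: otherwise countably many
  graphs make its piece single-valued over the common points, and separation covers that piece by one more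
  graph.\<close>

theorem lusin_novikov_cover:
  assumes R: "R \<in> sets (M \<Otimes>\<^sub>M M)" and ctbl: "\<And>x. x \<in> space M \<Longrightarrow> countable (R `` {x})"
  shows "\<exists>F. (\<forall>n j. F n j \<in> sets M) \<and> R \<subseteq> (\<Union>n::nat. code_graph (F n))"
proof (rule ccontr)
  assume ncov: "\<not> ?thesis"
  have R_sub: "R \<subseteq> space M \<times> space M" using sets.sets_into_space[OF R] by (simp add: space_pair_measure)
  obtain C \<phi> where C: "presentation tests C \<phi>" "\<phi> ` C = R"
    using presented_tests[OF R] by (auto simp: presented_def)
  define P where "P a = \<phi> ` (C \<inter> cyl a)" for a
  have P_R: "P a \<subseteq> R" for a using C(2) by (auto simp: P_def)
  have P_sub: "P a \<subseteq> space M \<times> space M" for a using P_R R_sub by blast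
  have P_mono: "P b \<subseteq> P a" if "prefix a b" for a b
  proof -
    have "cyl b \<subseteq> cyl a" using that by (fastforce simp: cyl_iff prefix_def nth_append)
    then show ?thesis by (auto simp: P_def)
  qed
  have P_pres: "presented tests (P a)" for a
    using presented_decided[OF C(1) locally_decided_cyl, of a] by (simp add: P_def Int_def)
  define small where "small \<F> \<longleftrightarrow> countable \<F> \<and> (\<forall>F\<in>\<F>. \<forall>j. F j \<in> sets M)" for \<F> :: "(nat \<Rightarrow> 'a set) set"
  define large where "large N \<longleftrightarrow> (\<forall>\<F>. small \<F> \<longrightarrow> (\<exists>x. \<forall>a\<in>N. \<exists>y. (x, y) \<in> P a - \<Union>(code_graph ` \<F>)))" for N
  have large_mono: "large N" if "large N'" "N \<subseteq> N'" for N N'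
    unfolding large_def
  proof (intro allI impI)
    fix \<F> assume "small \<F>"
    then obtain x where "\<forall>a\<in>N'. \<exists>y. (x, y) \<in> P a - \<Union>(code_graph ` \<F>)"
      using \<open>large N'\<close> unfolding large_def by blast
    then show "\<exists>x. \<forall>a\<in>N. \<exists>y. (x, y) \<in> P a - \<Union>(code_graph ` \<F>)" using \<open>N \<subseteq> N'\<close> by blast
  qed
  have large_common: "\<exists>x. \<forall>a\<in>N. \<exists>y. (x, y) \<in> P a" if "large N" for N
  proof -
    have "small {}" by (simp add: small_def)
    from that[unfolded large_def, rule_format, OF this] show ?thesis by simp
  qed
  have large_Nil: "large {[]}"
    unfolding large_def
  proof (intro allI impI)
    fix \<F> assume sm: "small \<F>"
    \<comment> \<open>The extra member makes the family nonempty, so that it can be enumerated; the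
      enlarged family still fails to cover \<open>R\<close>.\<close>
    define \<F>' where "\<F>' = insert (\<lambda>_. {}) \<F>"
    have \<F>': "countable \<F>'" "\<F>' \<noteq> {}" "\<forall>F\<in>\<F>'. \<forall>j. F j \<in> sets M" using sm by (auto simp: small_def \<F>'_def)
    define F where "F = from_nat_into \<F>'"
    have "F n j \<in> sets M" for n j using \<F>' from_nat_into[of \<F>' n] by (auto simp: F_def)
    then have "\<not> R \<subseteq> (\<Union>n. code_graph (F n))" using ncov by blast
    moreover have "(\<Union>n. code_graph (F n)) = \<Union>(code_graph ` \<F>')"
      using range_from_nat_into[OF \<F>'(2,1)] by (metis F_def image_image)
    moreover have "\<Union>(code_graph ` \<F>) \<subseteq> \<Union>(code_graph ` \<F>')" unfolding \<F>'_def by blast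
    ultimately have "\<not> R \<subseteq> \<Union>(code_graph ` \<F>)" by (metis subset_trans)
    then obtain x y where "(x, y) \<in> R" "(x, y) \<notin> \<Union>(code_graph ` \<F>)"
      unfolding subset_iff split_paired_All by blast
    moreover have "P [] = R" using C(2) by (auto simp: P_def cyl_def)
    ultimately show "\<exists>x. \<forall>a\<in>{[]}. \<exists>y. (x, y) \<in> P a - \<Union>(code_graph ` \<F>)" by auto
  qed
  define sepd where "sepd a b \<longleftrightarrow> (\<exists>j. \<forall>x y. ((x, y) \<in> P a \<longrightarrow> y \<in> V j) \<and> ((x, y) \<in> P b \<longrightarrow> y \<notin> V j))" for a b
  \<comment> \<open>Tests are locally constant along codes, so a node through \<open>c\<close> can
    be prolonged until the test has one value on its piece. The \<open>Suc\<close> in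
    \<open>m\<close> makes the prolongation strict.\<close>
  have localise: "\<exists>b. strict_prefix a b \<and> c \<in> cyl b \<and> (\<forall>p\<in>P b. p \<in> W \<longleftrightarrow> \<phi> c \<in> W)"
    if ca: "c \<in> C" "c \<in> cyl a" "W \<in> tests" for a c W
  proof -
    obtain n where n: "\<forall>c'\<in>C. agree n c c' \<longrightarrow> (\<phi> c' \<in> W) = (\<phi> c \<in> W)"
      using presentation_local[OF C(1) ca(3,1)] by blast
    define m where "m = max n (Suc (length a))"
    define b where "b = map c [0..<m]"
    have "a = map c [0..<length a]" using ca by (simp add: cyl_def)
    moreover have "take (length a) b = map c [0..<length a]" by (simp add: b_def m_def take_map)
    ultimately have "prefix a b" by (metis take_is_prefix)
    moreover have "length a < length b" by (simp add: b_def m_def)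
    moreover have "c' \<in> cyl b \<Longrightarrow> agree n c c'" for c'
      by (auto simp: cyl_def b_def agree_def m_def)
    ultimately have "strict_prefix a b" "c \<in> cyl b" "\<forall>p\<in>P b. p \<in> W \<longleftrightarrow> \<phi> c \<in> W"
      using n by (auto simp: b_def cyl_def P_def strict_prefix_def)
    then show ?thesis by blast
  qed
  have split: "\<exists>a0 a1. strict_prefix a a0 \<and> strict_prefix a a1 \<and> sepd a0 a1 \<and> large (insert a0 (insert a1 N))"
    if N: "finite N" "large (insert a N)" for a N
  proof (rule ccontr)
    assume "\<not> ?thesis"
    then have "\<exists>\<F>. small \<F> \<and> (strict_prefix a a0 \<and> strict_prefix a a1 \<and> sepd a0 a1 \<longrightarrow>
        \<not> (\<exists>x. \<forall>b\<in>insert a0 (insert a1 N). \<exists>y. (x, y) \<in> P b - \<Union>(code_graph ` \<F>)))" for a0 a1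
      unfolding large_def by (cases "strict_prefix a a0 \<and> strict_prefix a a1 \<and> sepd a0 a1") (auto simp: small_def)
    then obtain K where K: "\<And>a0 a1. small (K a0 a1)"
      "\<And>a0 a1 x. strict_prefix a a0 \<Longrightarrow> strict_prefix a a1 \<Longrightarrow> sepd a0 a1 \<Longrightarrow>
        \<forall>b\<in>insert a0 (insert a1 N). \<exists>y. (x, y) \<in> P b - \<Union>(code_graph ` K a0 a1) \<Longrightarrow> False"
      by metis
    \<comment> \<open>There are only countably many pairs of nodes, so the union of the families
      defeating them is still small.\<close>
    define \<F> where "\<F> = (\<Union>a0 a1. K a0 a1)"
    have small\<F>: "small \<F>" using K(1) by (auto simp: small_def \<F>_def intro!: countable_UN)
    define B where "B = \<Union>(code_graph ` \<F>)"
    have B_sets: "B \<in> sets (M \<Otimes>\<^sub>M M)"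
      using small\<F> unfolding B_def small_def by (intro sets.countable_UN') (auto intro: code_graph_sets)
    have PB: "presented tests (P b - B)" for b
    proof -
      have "presented tests (P b \<inter> (space (M \<Otimes>\<^sub>M M) - B))"
        by (rule presented_Int[of _ _ _ "space M \<times> space M"])
          (use P_pres P_sub B_sets separating_Times[OF sep] in
            \<open>auto simp: tests_def[symmetric] space_pair_measure intro!: presented_tests\<close>)
      moreover have "P b \<inter> (space (M \<Otimes>\<^sub>M M) - B) = P b - B" using P_sub by (auto simp: space_pair_measure)
      ultimately show ?thesis by simp
    qed
    \<comment> \<open>The points over which the piece at \<open>a\<close> and those at
      \<open>N\<close> all survive the removal of \<open>B\<close>. Over them the rest of
      \<open>P a\<close> is single-valued, since two values would yield a legitimate
      splitting.\<close>
    define X0 where "X0 = (\<Inter>b\<in>insert a N. fst ` (P b - B))"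
    have X0_pres: "presented (range V) X0"
      unfolding X0_def
      by (rule presented_INT_countable[OF _ _ _ sep])
        (use N(1) PB P_sub in \<open>auto intro!: countable_finite presented_projection, force+\<close>)
    have X0_sub: "X0 \<subseteq> space M" unfolding X0_def using P_sub by force
    have single: "y = y'" if x: "x \<in> X0" "(x, y) \<in> P a - B" "(x, y') \<in> P a - B" for x y y'
    proof (rule ccontr)
      assume "y \<noteq> y'"
      moreover have "y \<in> space M" "y' \<in> space M" using x P_sub by auto
      ultimately obtain j where j: "(y \<in> V j) \<noteq> (y' \<in> V j)" using sep unfolding separating_def by auto
      have key: False if j: "u \<in> V j" "u' \<notin> V j" "(x, u) \<in> P a - B" "(x, u') \<in> P a - B" for u u'
      proof -
        obtain c c' where c: "c \<in> C" "c \<in> cyl a" "\<phi> c = (x, u)" and c': "c' \<in> C" "c' \<in> cyl a" "\<phi> c' = (x, u')"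
          using j(3,4) by (force simp: P_def)
        have W: "space M \<times> V j \<in> tests" by (auto simp: tests_def)
        obtain a0 where a0: "strict_prefix a a0" "c \<in> cyl a0" "\<forall>p\<in>P a0. p \<in> space M \<times> V j \<longleftrightarrow> \<phi> c \<in> space M \<times> V j"
          using localise[OF c(1,2) W] by blast
        obtain a1 where a1: "strict_prefix a a1" "c' \<in> cyl a1" "\<forall>p\<in>P a1. p \<in> space M \<times> V j \<longleftrightarrow> \<phi> c' \<in> space M \<times> V j"
          using localise[OF c'(1,2) W] by blast
        have xM: "x \<in> space M" using j(3) P_sub by blast
        have mem: "(x, u) \<in> P a0" "(x, u') \<in> P a1"
          unfolding P_def using a0(2) a1(2) c(1,3) c'(1,3) by (metis IntI image_eqI)+
        have "z \<in> V j" if "(w, z) \<in> P a0" for w z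
          using a0(3)[rule_format, OF that] c(3) j(1) xM by auto
        moreover have "z \<notin> V j" if "(w, z) \<in> P a1" for w z
          using a1(3)[rule_format, OF that] c'(3) j(2) xM P_sub[of a1] that by auto
        ultimately have "sepd a0 a1" unfolding sepd_def by blast
        moreover have "\<Union>(code_graph ` K a0 a1) \<subseteq> B" by (auto simp: B_def \<F>_def)
        moreover have "\<forall>b\<in>N. \<exists>y. (x, y) \<in> P b - B" using x(1) by (force simp: X0_def)
        ultimately show False using K(2)[OF a0(1) a1(1), of x] mem j(3,4) by blast
      qed
      show False using key[of y y'] key[of y' y] j x by blast
    qed
    \<comment> \<open>Single-valuedness makes the two analytic sets disjoint. A separating Borel set
      \<open>F j\<close> decides the \<open>j\<close>-th test of the value, so
      \<open>code_graph F\<close> covers this part of \<open>P a\<close>, against largeness.\<close>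
    define A1 where "A1 j = X0 \<inter> fst ` ((P a - B) \<inter> space M \<times> V j)" for j
    define A2 where "A2 j = X0 \<inter> fst ` ((P a - B) - space M \<times> V j)" for j
    have "\<exists>S\<in>sigma_sets (space M) (range V). A1 j \<subseteq> S \<and> S \<inter> A2 j = {}" for j
    proof (rule lusin_separation[OF _ _ _ _ _ sep])
      have "space M \<times> V j \<in> tests" by (auto simp: tests_def)
      note * = presented_Int_test[OF PB[of a] this]
      show "presented (range V) (A1 j)" "presented (range V) (A2 j)"
        unfolding A1_def A2_def
        by (rule presented_Int[OF X0_pres presented_projection[OF *(1)] sep X0_sub]
            presented_Int[OF X0_pres presented_projection[OF *(2)] sep X0_sub], use P_sub in force, use P_sub in force)+
      show "A1 j \<inter> A2 j = {}" using single unfolding A1_def A2_def by fastforce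
      show "A1 j \<subseteq> space M" "A2 j \<subseteq> space M" using X0_sub by (auto simp: A1_def A2_def)
      show "W \<subseteq> space M" if "W \<in> range V" for W using that V_sub by auto
    qed
    then obtain F where F: "\<And>j. F j \<in> sets M" "\<And>j. A1 j \<subseteq> F j" "\<And>j. F j \<inter> A2 j = {}"
      unfolding sets_M by metis
    have "small (insert F \<F>)" using small\<F> F(1) by (simp add: small_def)
    then obtain x where x: "\<forall>b\<in>insert a N. \<exists>y. (x, y) \<in> P b - \<Union>(code_graph ` insert F \<F>)"
      using N(2) unfolding large_def by blast
    have "x \<in> X0"
      unfolding X0_def
    proof
      fix b assume "b \<in> insert a N"
      then obtain y where "(x, y) \<in> P b - \<Union>(code_graph ` insert F \<F>)" using x by blast
      then have "(x, y) \<in> P b - B" by (auto simp: B_def)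
      then show "x \<in> fst ` (P b - B)" by (metis fst_conv image_eqI)
    qed
    obtain y where y: "(x, y) \<in> P a - B" "(x, y) \<notin> code_graph F" using x by (auto simp: B_def)
    then have xy: "x \<in> space M" "y \<in> space M" using P_sub by blast+
    have "x \<in> F j \<longleftrightarrow> y \<in> V j" for j
    proof (cases "y \<in> V j")
      case True
      then have "(x, y) \<in> (P a - B) \<inter> space M \<times> V j" using y(1) xy by simp
      then have "x \<in> A1 j" using \<open>x \<in> X0\<close> unfolding A1_def by (metis IntI fst_conv image_eqI)
      then show ?thesis using True F(2) by blast
    next
      case False
      then have "(x, y) \<in> (P a - B) - space M \<times> V j" using y(1) xy by simp
      then have "x \<in> A2 j" using \<open>x \<in> X0\<close> unfolding A2_def by (metis IntI fst_conv image_eqI)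
      then show ?thesis using False F(3) by blast
    qed
    then show False using y(2) xy by (simp add: code_graph_def)
  qed
  \<comment> \<open>The nodes of \<open>S\<close> are split one at a time; \<open>N\<close> collects
    the other nodes, so that all pieces keep a common base point throughout.\<close>
  have double: "\<exists>a0 a1. (\<forall>s\<in>S. strict_prefix s (a0 s) \<and> strict_prefix s (a1 s) \<and> sepd (a0 s) (a1 s)) \<and>
      large (N \<union> a0 ` S \<union> a1 ` S)" if "finite S" "finite N" "large (N \<union> S)" for S N
    using that
  proof (induction S arbitrary: N rule: finite_induct)
    case empty then show ?case by simp
  next
    case (insert s S)
    obtain u0 u1 where u: "strict_prefix s u0" "strict_prefix s u1" "sepd u0 u1" "large (insert u0 (insert u1 (N \<union> S)))"
      using split[of "N \<union> S" s] insert by auto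
    have "large (insert u0 (insert u1 N) \<union> S)" using u(4) by (simp add: insert_commute)
    then obtain a0 a1 where a: "\<forall>s\<in>S. strict_prefix s (a0 s) \<and> strict_prefix s (a1 s) \<and> sepd (a0 s) (a1 s)"
      "large (insert u0 (insert u1 N) \<union> a0 ` S \<union> a1 ` S)"
      using insert.IH[of "insert u0 (insert u1 N)"] insert.prems by auto
    have "N \<union> (a0(s := u0)) ` insert s S \<union> (a1(s := u1)) ` insert s S \<subseteq> insert u0 (insert u1 N) \<union> a0 ` S \<union> a1 ` S"
      by auto
    then have "large (N \<union> (a0(s := u0)) ` insert s S \<union> (a1(s := u1)) ` insert s S)"
      by (rule large_mono[OF a(2)])
    moreover have "\<forall>t\<in>insert s S. strict_prefix t ((a0(s := u0)) t) \<and> strict_prefix t ((a1(s := u1)) t) \<and>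
        sepd ((a0(s := u0)) t) ((a1(s := u1)) t)"
      using a(1) u by auto
    ultimately show ?case by blast
  qed
  define level where "level n = {s :: bool list. length s = n}" for n
  have fin: "finite (level n)" for n
    using finite_lists_length_eq[of "UNIV :: bool set" n] by (simp add: level_def)
  have "\<exists>T. \<forall>n. large (T n ` level n) \<and>
      (\<forall>s\<in>level n. strict_prefix (T n s) (T (Suc n) (s @ [False])) \<and> strict_prefix (T n s) (T (Suc n) (s @ [True])) \<and>
        sepd (T (Suc n) (s @ [False])) (T (Suc n) (s @ [True])))"
  proof (rule dependent_nat_choice[where P = "\<lambda>n T. large (T ` level n)" and Q = "\<lambda>n T T'.
      \<forall>s\<in>level n. strict_prefix (T s) (T' (s @ [False])) \<and> strict_prefix (T s) (T' (s @ [True])) \<and>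
        sepd (T' (s @ [False])) (T' (s @ [True]))", simplified all_conj_distrib[symmetric]])
    show "\<exists>T. large (T ` level 0)" using large_Nil by (intro exI[of _ "\<lambda>_. []"]) (simp add: level_def)
  next
    fix n and T :: "bool list \<Rightarrow> nat list" assume "large (T ` level n)"
    then obtain a0 a1 where a: "\<forall>s\<in>T ` level n. strict_prefix s (a0 s) \<and> strict_prefix s (a1 s) \<and> sepd (a0 s) (a1 s)"
      "large (a0 ` T ` level n \<union> a1 ` T ` level n)"
      using double[of "T ` level n" "{}"] fin by auto
    define T' where "T' u = (if last u then a1 else a0) (T (butlast u))" for u
    have "T' ` level (Suc n) \<subseteq> a0 ` T ` level n \<union> a1 ` T ` level n"
    proof
      fix z assume "z \<in> T' ` level (Suc n)"
      then obtain u where u: "length u = Suc n" "z = T' u" by (auto simp: level_def)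
      then have "butlast u \<in> level n" by (simp add: level_def)
      then show "z \<in> a0 ` T ` level n \<union> a1 ` T ` level n" using u(2) by (auto simp: T'_def)
    qed
    then have "large (T' ` level (Suc n))" by (rule large_mono[OF a(2)])
    moreover have "\<forall>s\<in>level n. strict_prefix (T s) (T' (s @ [False])) \<and> strict_prefix (T s) (T' (s @ [True])) \<and>
        sepd (T' (s @ [False])) (T' (s @ [True]))" using a(1) by (auto simp: T'_def)
    ultimately show "\<exists>T'. large (T' ` level (Suc n)) \<and> (\<forall>s\<in>level n. strict_prefix (T s) (T' (s @ [False])) \<and>
        strict_prefix (T s) (T' (s @ [True])) \<and> sepd (T' (s @ [False])) (T' (s @ [True])))" by blast
  qed
  then obtain T where T: "\<And>n. large (T n ` level n)"
    "\<And>n s b. s \<in> level n \<Longrightarrow> strict_prefix (T n s) (T (Suc n) (s @ [b]))"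
    "\<And>n s. s \<in> level n \<Longrightarrow> sepd (T (Suc n) (s @ [False])) (T (Suc n) (s @ [True]))"
    by (metis (full_types))
  define t where "t \<alpha> n = T n (map \<alpha> [0..<n])" for \<alpha> n
  have lev: "map \<alpha> [0..<n] \<in> level n" for \<alpha> n by (simp add: level_def)
  have "strict_prefix (t \<alpha> n) (t \<alpha> (Suc n))" for \<alpha> n
    using T(2)[OF lev[of \<alpha> n], of "\<alpha> n"] by (simp add: t_def)
  then have "\<exists>c. \<forall>n. n \<le> length (t \<alpha> n) \<and> map c [0..<length (t \<alpha> n)] = t \<alpha> n" for \<alpha>
    by (rule strict_prefix_limit)
  then obtain c where c: "\<And>\<alpha> n. n \<le> length (t \<alpha> n)" "\<And>\<alpha> n. map (c \<alpha>) [0..<length (t \<alpha> n)] = t \<alpha> n" by metis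
  have agr: "agree n (c \<alpha>) c'" if "c' \<in> cyl (t \<alpha> n)" for c' \<alpha> n
    using that cyl_agree[of "c \<alpha>"] c agree_mono by (metis (mono_tags, lifting) cyl_def mem_Collect_eq)
  have cC: "c \<alpha> \<in> C" for \<alpha>
  proof -
    have "\<exists>c'\<in>C. agree n (c \<alpha>) c'" for n
      using large_common[OF T(1)[of n]] lev[of \<alpha> n] agr[of _ \<alpha> n] unfolding t_def P_def by blast
    then show ?thesis using C(1) unfolding presentation_def seq_closed_def by blast
  qed
  have cP: "\<phi> (c \<alpha>) \<in> P (t \<alpha> n)" for \<alpha> n
    using cC c(2) by (auto simp: P_def cyl_def)
  define x where "x \<alpha> = fst (\<phi> (c \<alpha>))" for \<alpha>
  define y where "y \<alpha> = snd (\<phi> (c \<alpha>))" for \<alpha>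
  have xyP: "(x \<alpha>, y \<alpha>) \<in> P (t \<alpha> n)" for \<alpha> n using cP by (simp add: x_def y_def)
  then have xyR: "(x \<alpha>, y \<alpha>) \<in> R" for \<alpha> using P_R by blast
  then have xyM: "x \<alpha> \<in> space M" "y \<alpha> \<in> space M" for \<alpha> using R_sub by blast+
  have near: "\<exists>n. \<forall>m\<ge>n. \<forall>(u, v)\<in>P (t \<alpha> m). u \<in> V j \<longleftrightarrow> x \<alpha> \<in> V j" for \<alpha> j
  proof -
    have W: "V j \<times> space M \<in> tests" by (auto simp: tests_def)
    obtain n where n: "\<forall>c'\<in>C. agree n (c \<alpha>) c' \<longrightarrow> (\<phi> c' \<in> V j \<times> space M) = (\<phi> (c \<alpha>) \<in> V j \<times> space M)"
      using presentation_local[OF C(1) W cC[of \<alpha>]] by blast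
    have "u \<in> V j \<longleftrightarrow> x \<alpha> \<in> V j" if uv: "m \<ge> n" "(u, v) \<in> P (t \<alpha> m)" for m u v
    proof -
      obtain c' where c': "c' \<in> C" "c' \<in> cyl (t \<alpha> m)" "\<phi> c' = (u, v)" using uv(2) by (force simp: P_def)
      have "agree n (c \<alpha>) c'" using agr[OF c'(2)] uv(1) by (rule agree_mono)
      then have "((u, v) \<in> V j \<times> space M) = ((x \<alpha>, y \<alpha>) \<in> V j \<times> space M)"
        using n[rule_format, OF c'(1)] c'(3) by (simp only: x_def y_def prod.collapse)
      then show ?thesis using xyM P_sub[of "t \<alpha> m"] uv(2) by auto
    qed
    then show ?thesis by blast
  qed
  \<comment> \<open>At every level the pieces of both branches have sections over one common
    \<open>z\<close>. By \<open>near\<close>, a test separating the two limits would have to give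
    two answers at \<open>z\<close>.\<close>
  have same: "x \<alpha> = x \<beta>" for \<alpha> \<beta>
  proof (rule ccontr)
    assume "x \<alpha> \<noteq> x \<beta>"
    then obtain j where j: "(x \<alpha> \<in> V j) \<noteq> (x \<beta> \<in> V j)" using sep xyM unfolding separating_def by blast
    obtain m n where mn: "\<forall>k\<ge>m. \<forall>(u, v)\<in>P (t \<alpha> k). u \<in> V j \<longleftrightarrow> x \<alpha> \<in> V j"
      "\<forall>k\<ge>n. \<forall>(u, v)\<in>P (t \<beta> k). u \<in> V j \<longleftrightarrow> x \<beta> \<in> V j" using near by metis
    obtain z where "\<forall>a\<in>T (max m n) ` level (max m n). \<exists>y. (z, y) \<in> P a" using large_common[OF T(1)] by blast
    then obtain v v' where "(z, v) \<in> P (t \<alpha> (max m n))" "(z, v') \<in> P (t \<beta> (max m n))"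
      using lev unfolding t_def by blast
    with mn have "(x \<alpha> \<in> V j) = (x \<beta> \<in> V j)" by (metis (mono_tags, lifting) case_prodD max.cobounded1 max.cobounded2)
    with j show False by blast
  qed
  \<comment> \<open>Two branches part at a first index, where \<open>sepd\<close> provides a test
    separating their second coordinates.\<close>
  have "inj y"
  proof (rule injI, rule ccontr)
    fix \<alpha> \<beta> :: "nat \<Rightarrow> bool" assume eq: "y \<alpha> = y \<beta>" and "\<alpha> \<noteq> \<beta>"
    then have ex: "\<exists>k. \<alpha> k \<noteq> \<beta> k" by blast
    define k where "k = (LEAST k. \<alpha> k \<noteq> \<beta> k)"
    have k: "\<alpha> k \<noteq> \<beta> k" "\<And>i. i < k \<Longrightarrow> \<alpha> i = \<beta> i"
      unfolding k_def using LeastI_ex[OF ex] not_less_Least by blast+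
    have s: "map \<alpha> [0..<k] = map \<beta> [0..<k]" using k(2) by simp
    have "sepd (t \<alpha> (Suc k)) (t \<beta> (Suc k)) \<or> sepd (t \<beta> (Suc k)) (t \<alpha> (Suc k))"
    proof -
      have "t \<alpha> (Suc k) = T (Suc k) (map \<alpha> [0..<k] @ [\<alpha> k])" "t \<beta> (Suc k) = T (Suc k) (map \<alpha> [0..<k] @ [\<beta> k])"
        by (simp add: t_def) (simp add: t_def s)
      then show ?thesis using T(3)[OF lev[of \<alpha> k]] k(1) by (cases "\<alpha> k") simp_all
    qed
    then show False using xyP[of \<alpha> "Suc k"] xyP[of \<beta> "Suc k"] eq unfolding sepd_def by metis
  qed
  moreover have "range y \<subseteq> R `` {x (\<lambda>_. False)}"
  proof
    fix z assume "z \<in> range y"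
    then obtain \<alpha> where "z = y \<alpha>" by blast
    then show "z \<in> R `` {x (\<lambda>_. False)}" using xyR[of \<alpha>] same[of \<alpha> "\<lambda>_. False"] by simp
  qed
  ultimately have "countable (UNIV :: (nat \<Rightarrow> bool) set)"
    using ctbl[of "x (\<lambda>_. False)"] xyM by (metis countable_image_inj_eq countable_subset)
  \<comment> \<open>Cantor's diagonal argument.\<close>
  then have r: "range (from_nat_into (UNIV :: (nat \<Rightarrow> bool) set)) = UNIV"
    by (intro range_from_nat_into) auto
  then obtain n where "from_nat_into (UNIV :: (nat \<Rightarrow> bool) set) n = (\<lambda>n. \<not> from_nat_into UNIV n n)"
    by (metis (no_types, lifting) UNIV_I imageE)
  then show False by (metis (full_types))
qed

end

subsection \<open>Standard Borel spaces\<close>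

text \<open>A completeness principle for closed balls indexed by an arbitrary set: compatible
  centres and arbitrarily small radii take the place of nesting. Centres with radii tending to 0
  form a Cauchy sequence, and its limit lies in every ball up to any \<open>e > 0\<close>.\<close>

lemma (in Metric_space) complete_nested:
  assumes "mcomplete" and P: "\<And>i. i \<in> S \<Longrightarrow> P i \<in> M" and small: "\<And>\<epsilon>. \<epsilon> > 0 \<Longrightarrow> \<exists>i\<in>S. \<rho> i < \<epsilon>"
    and close: "\<And>i j. i \<in> S \<Longrightarrow> j \<in> S \<Longrightarrow> d (P i) (P j) \<le> \<rho> i + \<rho> j"
  shows "\<exists>y\<in>M. \<forall>i\<in>S. d y (P i) \<le> \<rho> i"
proof -
  have "\<exists>i\<in>S. \<rho> i < 1 / (real n + 1)" for n using small[of "1 / (real n + 1)"] by simp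
  then obtain i where i: "\<And>n. i n \<in> S" "\<And>n. \<rho> (i n) < 1 / (real n + 1)" by metis
  have inv: "1 / (real n + 1) \<le> 1 / (real m + 1)" if "m \<le> n" for m n
    using that by (intro divide_left_mono) auto
  have arch: "\<exists>n. 1 / (real n + 1) < e" if "e > 0" for e :: real
    using that nat_approx_posE[of e] by (metis of_nat_Suc add.commute)
  have "MCauchy (P \<circ> i)"
    unfolding MCauchy_def
  proof (intro conjI allI impI)
    show "range (P \<circ> i) \<subseteq> M" using i(1) P by auto
    fix \<epsilon> :: real assume "\<epsilon> > 0"
    then obtain N where N: "1 / (real N + 1) < \<epsilon> / 2" using arch[of "\<epsilon> / 2"] by auto
    have "d ((P \<circ> i) n) ((P \<circ> i) n') < \<epsilon>" if "N \<le> n" "N \<le> n'" for n n'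
      using close[OF i(1)[of n] i(1)[of n']] i(2)[of n] i(2)[of n'] inv[OF that(1)] inv[OF that(2)] N by simp
    then show "\<exists>N. \<forall>n n'. N \<le> n \<longrightarrow> N \<le> n' \<longrightarrow> d ((P \<circ> i) n) ((P \<circ> i) n') < \<epsilon>" by blast
  qed
  then obtain y where y: "limitin mtopology (P \<circ> i) y sequentially" using assms(1) unfolding mcomplete_def by blast
  then have yM: "y \<in> M" by (metis limitin_mspace)
  have "d y (P j) \<le> \<rho> j" if j: "j \<in> S" for j
  proof (rule field_le_epsilon)
    fix e :: real assume "e > 0"
    obtain N where N: "1 / (real N + 1) < e / 2" using arch[of "e / 2"] \<open>e > 0\<close> by auto
    have "\<forall>\<^sub>F n in sequentially. (P \<circ> i) n \<in> M \<and> d ((P \<circ> i) n) y < e / 2"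
      using y \<open>e > 0\<close> unfolding limitin_metric by (meson half_gt_zero)
    then obtain N' where N': "\<forall>n\<ge>N'. d (P (i n)) y < e / 2" unfolding eventually_sequentially by auto
    define n where "n = max N N'"
    have "d y (P j) \<le> d y (P (i n)) + d (P (i n)) (P j)" using triangle yM P i(1) j by blast
    moreover have "d y (P (i n)) < e / 2" using N' commute by (simp add: n_def)
    ultimately show "d y (P j) \<le> \<rho> j + e"
      using close[OF i(1)[of n] j] i(2)[of n] inv[of N n] N by (simp add: n_def)
  qed
  with yM show ?thesis by blast
qed

section \<open>Codes of points in a complete separable metric space\<close>

locale dense_metric = Metric_space M d for M :: "'a set" and d +
  fixes q :: "nat \<Rightarrow> 'a"
  assumes complete: "mcomplete" and q: "\<And>k. q k \<in> M"
    and dense: "\<And>x \<epsilon>. x \<in> M \<Longrightarrow> \<epsilon> > 0 \<Longrightarrow> \<exists>k. d x (q k) < \<epsilon>"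
begin

definition centre :: "nat \<Rightarrow> 'a" where "centre j = q (fst (prod_decode j))"
definition radius :: "nat \<Rightarrow> real" where "radius j = 1 / (real (snd (prod_decode j)) + 1)"
definition basic :: "nat \<Rightarrow> 'a set" where "basic j = mball (centre j) (radius j)"

lemma centre: "centre j \<in> M" by (simp add: centre_def q)

lemma mem_basic: "y \<in> basic j \<longleftrightarrow> y \<in> M \<and> d y (centre j) < radius j"
  using centre commute by (auto simp: basic_def in_mball)

lemma inverse_small: "e > 0 \<Longrightarrow> \<exists>n. 1 / (real n + 1) < e"
  using nat_approx_posE[of e] by (metis of_nat_Suc add.commute)

lemma basic_small:
  assumes "y \<in> M" "\<epsilon> > 0" shows "\<exists>j. y \<in> basic j \<and> radius j < \<epsilon>"
proof -
  obtain m where m: "1 / (real m + 1) < \<epsilon>" using inverse_small[OF assms(2)] by blast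
  obtain k where "d y (q k) < 1 / (real m + 1)" using dense[OF assms(1), of "1 / (real m + 1)"] by auto
  then have "y \<in> basic (prod_encode (k, m))" "radius (prod_encode (k, m)) < \<epsilon>"
    using m assms(1) by (auto simp: mem_basic centre_def radius_def)
  then show ?thesis by blast
qed

text \<open>The inequality is formal inclusion of balls. When \<open>z\<close> is a centre it
  mentions centres and radii only, which lets \<open>code_point\<close> express membership without
  speaking of a point.\<close>

lemma basic_inside:
  assumes "y \<in> M" "d y z < \<rho>" "z \<in> M" shows "\<exists>i. y \<in> basic i \<and> d (centre i) z + radius i < \<rho>"
proof -
  obtain i where i: "y \<in> basic i" "radius i < (\<rho> - d y z) / 2"
    using basic_small[OF assms(1), of "(\<rho> - d y z) / 2"] assms(2) by auto
  have "d (centre i) z \<le> d (centre i) y + d y z" using triangle centre assms by blast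
  moreover have "d (centre i) y < radius i" using i(1) commute by (simp add: mem_basic)
  ultimately have "d (centre i) z + radius i < \<rho>" using i(2) by (simp add: field_simps)
  with i(1) show ?thesis by blast
qed

lemma basic_cong:
  assumes "x \<in> M" "y \<in> M" "\<And>j. x \<in> basic j \<Longrightarrow> y \<in> basic j" shows "x = y"
proof (rule ccontr)
  assume "x \<noteq> y"
  then have "d x y > 0" using assms mdist_pos_eq by blast
  then obtain j where j: "x \<in> basic j" "radius j < d x y / 2" using basic_small[OF assms(1), of "d x y / 2"] by auto
  then have "y \<in> basic j" using assms(3) by blast
  moreover have "d x y \<le> d x (centre j) + d (centre j) y" using triangle assms(1,2) centre by blast
  moreover have "d (centre j) y = d y (centre j)" by (rule commute)
  ultimately show False using j by (simp add: mem_basic)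
qed

lemma open_UN_basic:
  assumes "openin mtopology U" shows "U = (\<Union>j\<in>{j. basic j \<subseteq> U}. basic j)"
proof
  show "U \<subseteq> (\<Union>j\<in>{j. basic j \<subseteq> U}. basic j)"
  proof
    fix x assume x: "x \<in> U"
    then obtain r where r: "r > 0" "mball x r \<subseteq> U" using assms openin_mtopology by blast
    have xM: "x \<in> M" using x assms openin_mtopology by blast
    obtain i where i: "x \<in> basic i" "d (centre i) x + radius i < r"
      using basic_inside[OF xM _ xM, of r] r(1) xM by auto
    have "basic i \<subseteq> mball x r"
    proof
      fix z assume z: "z \<in> basic i"
      have "d x z \<le> d x (centre i) + d (centre i) z" using triangle xM centre z mem_basic by blast
      then show "z \<in> mball x r" using i(2) z xM commute[of z "centre i"] commute[of x "centre i"] by (auto simp: mem_basic in_mball)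
    qed
    then show "x \<in> (\<Union>j\<in>{j. basic j \<subseteq> U}. basic j)" using i(1) r(2) by blast
  qed
qed auto

text \<open>The right-hand side is a countable Boolean combination of conditions \<open>j \<in> S\<close>, so
  that the codes of points form a Borel set.\<close>

lemma code_point:
  "(\<exists>y\<in>M. \<forall>j. j \<in> S \<longleftrightarrow> y \<in> basic j) \<longleftrightarrow>
    (\<forall>n::nat. \<exists>i. i \<in> S \<and> radius i < 1 / (real n + 1)) \<and>
    (\<forall>i j. i \<in> S \<longrightarrow> j \<in> S \<longrightarrow> d (centre i) (centre j) \<le> radius i + radius j) \<and>
    (\<forall>j. j \<in> S \<longleftrightarrow> (\<exists>i. i \<in> S \<and> d (centre i) (centre j) + radius i < radius j))" (is "?L \<longleftrightarrow> ?R")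
proof
  assume ?L
  then obtain y where y: "y \<in> M" "\<And>j. j \<in> S \<longleftrightarrow> y \<in> basic j" by blast
  have tri: "d (centre i) (centre j) \<le> d y (centre i) + d y (centre j)"
    "d y (centre j) \<le> d y (centre i) + d (centre i) (centre j)" for i j
    using triangle[of "centre i" y "centre j"] triangle[of y "centre i" "centre j"] y(1) centre commute[of y "centre i"] by auto
  have "\<exists>i. i \<in> S \<and> radius i < 1 / (real n + 1)" for n
    using basic_small[OF y(1), of "1 / (real n + 1)"] y(2) by auto
  moreover have "d (centre i) (centre j) \<le> radius i + radius j" if "i \<in> S" "j \<in> S" for i j
    using tri(1)[of i j] that y(2)[of i] y(2)[of j] by (simp add: mem_basic)
  moreover have "j \<in> S \<longleftrightarrow> (\<exists>i. i \<in> S \<and> d (centre i) (centre j) + radius i < radius j)" for j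
  proof
    assume "j \<in> S"
    then have "d y (centre j) < radius j" using y(2) by (simp add: mem_basic)
    then show "\<exists>i. i \<in> S \<and> d (centre i) (centre j) + radius i < radius j"
      using basic_inside[OF y(1) _ centre] y(2) by blast
  next
    assume "\<exists>i. i \<in> S \<and> d (centre i) (centre j) + radius i < radius j"
    then obtain i where "i \<in> S" "d (centre i) (centre j) + radius i < radius j" by blast
    then show "j \<in> S" using tri(2)[of j i] y(1) y(2)[of i] y(2)[of j] by (simp add: mem_basic)
  qed
  ultimately show ?R by blast
next
  assume R: ?R
  have "\<exists>y\<in>M. \<forall>i\<in>S. d y (centre i) \<le> radius i"
  proof (rule complete_nested[OF complete])
    show "\<exists>i\<in>S. radius i < \<epsilon>" if e: "\<epsilon> > 0" for \<epsilon>
    proof -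
      obtain n where "1 / (real n + 1) < \<epsilon>" using inverse_small[OF e] by blast
      moreover obtain i where "i \<in> S" "radius i < 1 / (real n + 1)" using R by blast
      ultimately show ?thesis by (meson less_trans)
    qed
    show "d (centre i) (centre j) \<le> radius i + radius j" if "i \<in> S" "j \<in> S" for i j
      using R that by blast
  qed (rule centre)
  then obtain y where y: "y \<in> M" "\<And>i. i \<in> S \<Longrightarrow> d y (centre i) \<le> radius i" by blast
  have "j \<in> S \<longleftrightarrow> y \<in> basic j" for j
  proof
    assume "j \<in> S"
    then obtain i where i: "i \<in> S" "d (centre i) (centre j) + radius i < radius j" using R by blast
    have "d y (centre j) \<le> d y (centre i) + d (centre i) (centre j)" using triangle y(1) centre by blast
    then show "y \<in> basic j" using i y by (fastforce simp: mem_basic)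
  next
    assume "y \<in> basic j"
    then have lt: "d y (centre j) < radius j" by (simp add: mem_basic)
    then obtain n where n: "1 / (real n + 1) < (radius j - d y (centre j)) / 2"
      using inverse_small[of "(radius j - d y (centre j)) / 2"] by auto
    obtain i where i: "i \<in> S" "radius i < 1 / (real n + 1)" using R by blast
    have "d (centre i) (centre j) \<le> d (centre i) y + d y (centre j)" using triangle y(1) centre by blast
    moreover have "d (centre i) y \<le> radius i" using y(2)[OF i(1)] commute by simp
    ultimately have "d (centre i) (centre j) + radius i < radius j" using less_trans[OF i(2) n] by (simp add: field_simps)
    then show "j \<in> S" using i(1) R by blast
  qed
  with y(1) show ?L by blast
qed

lemma presented_space: "presented (range basic) M"
proof -
  \<comment> \<open>The entries \<open>c (2 * n)\<close> locate \<open>x\<close>; \<open>c (2 * j + 1)\<close> is \<open>0\<close> if \<open>x\<close> is outside the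
    \<open>j\<close>-th ball, and otherwise witnesses membership with a margin, so that every condition is closed in \<open>x\<close>.\<close>
  define cond where "cond c x \<longleftrightarrow> x \<in> M \<and> (\<forall>n. d x (q (c (2 * n))) \<le> 1 / (real n + 1)) \<and>
    (\<forall>j. if c (2 * j + 1) = 0 then radius j \<le> d x (centre j)
         else d x (centre j) \<le> radius j - 1 / (real (c (2 * j + 1) - 1) + 1))" for c :: "nat \<Rightarrow> nat" and x
  define C where "C = {c. \<exists>x. cond c x}"
  define \<phi> where "\<phi> c = (SOME x. cond c x)" for c
  have \<phi>: "cond c (\<phi> c)" if "c \<in> C" for c
    using someI_ex[of "cond c"] that by (simp add: C_def \<phi>_def)
  have basic: "x \<in> basic j \<longleftrightarrow> c (2 * j + 1) \<noteq> 0" if "cond c x" for c x j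
  proof -
    define w where "w = 1 / (real (c (2 * j + 1) - 1) + 1)"
    have "w > 0" by (simp add: w_def)
    moreover have "if c (2 * j + 1) = 0 then radius j \<le> d x (centre j) else d x (centre j) \<le> radius j - w" "x \<in> M"
      using that unfolding cond_def w_def by blast+
    ultimately show ?thesis unfolding mem_basic by (auto split: if_splits)
  qed
  have "seq_closed C"
    unfolding seq_closed_def
  proof (intro allI impI)
    fix c assume *: "\<forall>n. \<exists>c'\<in>C. agree n c c'"
    have "\<exists>x\<in>M. (\<forall>n<N. d x (q (c (2 * n))) \<le> 1 / (real n + 1)) \<and>
      (\<forall>j<N. if c (2 * j + 1) = 0 then radius j \<le> d x (centre j)
         else d x (centre j) \<le> radius j - 1 / (real (c (2 * j + 1) - 1) + 1))" for N
    proof -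
      obtain c' where c': "c' \<in> C" "agree (2 * N) c c'" using * by blast
      have "c' (2 * n) = c (2 * n)" "c' (2 * n + 1) = c (2 * n + 1)" if "n < N" for n
        using c'(2) that by (auto simp: agree_def)
      then show ?thesis using \<phi>[OF c'(1)] unfolding cond_def by (intro bexI[of _ "\<phi> c'"]) metis+
    qed
    then obtain x where x: "\<And>N. x N \<in> M" "\<And>N n. n < N \<Longrightarrow> d (x N) (q (c (2 * n))) \<le> 1 / (real n + 1)"
      "\<And>N j. j < N \<Longrightarrow> if c (2 * j + 1) = 0 then radius j \<le> d (x N) (centre j)
         else d (x N) (centre j) \<le> radius j - 1 / (real (c (2 * j + 1) - 1) + 1)" by metis
    \<comment> \<open>The even entries alone locate the limit. The odd conditions are non-strict
      inequalities and pass to it by \<open>near\<close>.\<close>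
    have "\<exists>y\<in>M. \<forall>i\<in>UNIV. d y (q (c (2 * i))) \<le> 1 / (real i + 1)"
    proof (rule complete_nested[OF complete])
      show "\<exists>i\<in>UNIV. 1 / (real i + 1) < \<epsilon>" if "\<epsilon> > 0" for \<epsilon> using inverse_small[OF that] by simp
      fix i j :: nat
      define N where "N = Suc (max i j)"
      have "d (q (c (2 * i))) (q (c (2 * j))) \<le> d (q (c (2 * i))) (x N) + d (x N) (q (c (2 * j)))"
        using triangle q x(1) by blast
      moreover have "d (q (c (2 * i))) (x N) = d (x N) (q (c (2 * i)))" by (rule commute)
      moreover have "d (x N) (q (c (2 * i))) \<le> 1 / (real i + 1)" "d (x N) (q (c (2 * j))) \<le> 1 / (real j + 1)"
        by (rule x(2), simp add: N_def)+
      ultimately show "d (q (c (2 * i))) (q (c (2 * j))) \<le> 1 / (real i + 1) + 1 / (real j + 1)"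
        by linarith
    qed (use q in auto)
    then obtain y where y: "y \<in> M" "\<And>i. d y (q (c (2 * i))) \<le> 1 / (real i + 1)" by blast
    have near: "\<exists>N. j < N \<and> d y (x N) \<le> e" if "e > 0" for e j
    proof -
      obtain n where n: "1 / (real n + 1) < e / 2" using inverse_small[of "e / 2"] \<open>e > 0\<close> by auto
      define N where "N = Suc (max n j)"
      have "d y (x N) \<le> d y (q (c (2 * n))) + d (q (c (2 * n))) (x N)" using triangle q x(1) y(1) by blast
      moreover have "d (q (c (2 * n))) (x N) = d (x N) (q (c (2 * n)))" by (rule commute)
      moreover have "d (x N) (q (c (2 * n))) \<le> 1 / (real n + 1)" by (rule x(2)) (simp add: N_def)
      ultimately have "d y (x N) \<le> e" using y(2)[of n] n by linarith
      then show ?thesis by (intro exI[of _ N]) (simp add: N_def)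
    qed
    have "cond c y"
      unfolding cond_def
    proof (intro conjI allI y)
      fix j
      have tri: "d y (centre j) \<le> d y (x N) + d (x N) (centre j)" "d (x N) (centre j) \<le> d y (x N) + d y (centre j)" for N
        using triangle[of y "x N" "centre j"] triangle[of "x N" y "centre j"] y(1) x(1) centre commute[of y "x N"] by auto
      have "radius j \<le> d y (centre j)" if 0: "c (2 * j + 1) = 0"
      proof (rule field_le_epsilon)
        fix e :: real assume "e > 0"
        then obtain N where "j < N" "d y (x N) \<le> e" using near by blast
        then show "radius j \<le> d y (centre j) + e" using x(3)[of j N] tri(2)[of N] 0 by simp
      qed
      moreover have "d y (centre j) \<le> radius j - 1 / (real (c (2 * j + 1) - 1) + 1)" if 0: "c (2 * j + 1) \<noteq> 0"
      proof (rule field_le_epsilon)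
        fix e :: real assume "e > 0"
        then obtain N where N: "j < N" "d y (x N) \<le> e" using near by blast
        have "d (x N) (centre j) \<le> radius j - 1 / (real (c (2 * j + 1) - 1) + 1)"
          using x(3)[OF N(1)] 0 by (simp only: if_False)
        then show "d y (centre j) \<le> radius j - 1 / (real (c (2 * j + 1) - 1) + 1) + e"
          using tri(1)[of N] N(2) by linarith
      qed
      ultimately show "if c (2 * j + 1) = 0 then radius j \<le> d y (centre j)
         else d y (centre j) \<le> radius j - 1 / (real (c (2 * j + 1) - 1) + 1)" by argo
    qed
    then show "c \<in> C" by (auto simp: C_def)
  qed
  then show ?thesis
  proof (rule presentedI)
    fix W assume "W \<in> range basic"
    then obtain j where j: "W = basic j" by blast
    show "locally_decided C (\<lambda>c. \<phi> c \<in> W)"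
      unfolding locally_decided_def
    proof
      fix c assume "c \<in> C"
      \<comment> \<open>Entry \<open>2 * j + 1\<close> alone decides the \<open>j\<close>-th ball,
        hence agreement below \<open>2 * j + 2\<close>.\<close>
      then have "(\<phi> c' \<in> W) = (\<phi> c \<in> W)" if "c' \<in> C" "agree (2 * j + 2) c c'" for c'
        using basic[OF \<phi>] that unfolding j by (simp add: agree_def)
      then show "\<exists>n. \<forall>c'\<in>C. agree n c c' \<longrightarrow> (\<phi> c' \<in> W) = (\<phi> c \<in> W)" by blast
    qed
  next
    show "\<phi> ` C = M"
    proof
      show "\<phi> ` C \<subseteq> M" using \<phi> by (auto simp: cond_def)
      show "M \<subseteq> \<phi> ` C"
      proof
        fix x assume x: "x \<in> M"
        have "\<exists>k. d x (q k) < 1 / (real n + 1)" for n using dense[OF x, of "1 / (real n + 1)"] by simp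
        then obtain k where k: "\<And>n. d x (q (k n)) < 1 / (real n + 1)" by metis
        have "\<exists>m. d x (centre j) < radius j \<longrightarrow> d x (centre j) \<le> radius j - 1 / (real m + 1)" for j
          using inverse_small[of "radius j - d x (centre j)"] by (metis diff_gt_0_iff_gt less_diff_eq less_imp_le add.commute)
        then obtain m where m: "\<And>j. d x (centre j) < radius j \<Longrightarrow> d x (centre j) \<le> radius j - 1 / (real (m j) + 1)" by metis
        \<comment> \<open>The witness is shifted by \<open>Suc\<close> because 0 is reserved for
          points outside the ball.\<close>
        define c where "c i = (if even i then k (i div 2)
          else if d x (centre (i div 2)) < radius (i div 2) then Suc (m (i div 2)) else 0)" for i
        have "cond c x" unfolding cond_def using x k m by (auto simp: c_def add.commute intro: less_imp_le)
        then have c: "c \<in> C" by (auto simp: C_def)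
        have "\<phi> c = x"
          by (rule basic_cong) (use \<phi>[OF c] x basic[OF \<open>cond c x\<close>] basic[OF \<phi>[OF c]] in \<open>auto simp: cond_def\<close>)
        with c show "x \<in> \<phi> ` C" by blast
      qed
    qed
  qed
qed

end

text \<open>Not every code belongs to a point. The added axiom extends the partial function of a
  code graph to a measurable total one; it holds when the codes of points form a Borel set, which
  completeness will supply.\<close>

locale borel_coded = coded_space +
  assumes uniformize: "(\<And>j. F j \<in> sets M) \<Longrightarrow> \<exists>f\<in>M \<rightarrow>\<^sub>M M. code_graph F \<subseteq> {(x, f x) | x. x \<in> space M}"

lemma standard_borel_coded:
  assumes "standard_borel M" shows "\<exists>V. borel_coded M V"
proof (cases "space M = {}")
  \<comment> \<open>The empty space has no dense sequence; constantly empty tests code it.\<close>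
  case True
  have sM: "sets M = {{}}" using True by (simp only: space_empty_iff)
  have "sigma_sets {} {{}} = {{}}"
    using sigma_algebra.sigma_sets_eq[of "{} :: 'a set" "{{}}"] sigma_algebra_iff2[of "{}" "{{}}"] by auto
  then have "coded_space M (\<lambda>_. {})"
    by unfold_locales (auto simp: True sM separating_def presented_empty)
  moreover have "coded_space.code_graph M (\<lambda>_. {}) F \<subseteq> {(x, id x) | x. x \<in> space M}" for F
    using True by (auto simp: coded_space.code_graph_def[OF calculation(1)])
  ultimately have "borel_coded M (\<lambda>_. {})"
    by (intro borel_coded.intro borel_coded_axioms.intro bexI[of _ id]) simp_all
  then show ?thesis by blast
next
  case False
  obtain T where T: "topspace T = space M" "completely_metrizable_space T" "second_countable T"
    "sets M = sigma_sets (space M) {U. openin T U}" using assms by (auto simp: standard_borel_def)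
  obtain \<Omega> d where d: "Metric_space \<Omega> d" "Metric_space.mcomplete \<Omega> d" "T = Metric_space.mtopology \<Omega> d"
    using T(2) by (auto simp: completely_metrizable_space_def)
  interpret Metric_space \<Omega> d by (rule d(1))
  have \<Omega>: "\<Omega> = space M" using T(1) d(3) by simp
  obtain Q where Q: "countable Q" "Q \<subseteq> \<Omega>" "mtopology closure_of Q = \<Omega>"
    using second_countable_imp_separable_space[OF T(3)] unfolding separable_space_def d(3) by auto
  have "Q \<noteq> {}" using Q(3) \<Omega> False by auto
  define q where "q = from_nat_into Q"
  have rq: "range q = Q" unfolding q_def by (rule range_from_nat_into[OF \<open>Q \<noteq> {}\<close> Q(1)])
  interpret dense_metric \<Omega> d q
  proof
    show "mcomplete" by (rule d(2))
    show "q k \<in> \<Omega>" for k using rq Q(2) by blast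
    fix x and \<epsilon> :: real assume "x \<in> \<Omega>" "\<epsilon> > 0"
    then have "\<exists>y\<in>Q. y \<in> mball x \<epsilon>" using Q(3) metric_closure_of by blast
    then show "\<exists>k. d x (q k) < \<epsilon>" using rq by (auto simp: in_mball)
  qed
  have basic_sub: "basic j \<subseteq> space M" for j unfolding \<Omega>[symmetric] using mem_basic by blast
  have basic_open: "openin T (basic j)" for j by (simp add: basic_def d(3))
  have sM: "sets M = sigma_sets (space M) (range basic)"
  proof (rule antisym)
    have sub: "range basic \<subseteq> Pow (space M)" using basic_sub by blast
    interpret sigma_algebra "space M" "sigma_sets (space M) (range basic)" by (rule sigma_algebra_sigma_sets[OF sub])
    have "U \<in> sigma_sets (space M) (range basic)" if "openin T U" for U
    proof -
      have "(\<Union>j\<in>{j. basic j \<subseteq> U}. basic j) \<in> sigma_sets (space M) (range basic)"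
        by (intro countable_UN' countableI_type image_subsetI) (auto intro: sigma_sets.Basic)
      then show ?thesis using open_UN_basic[of U] that d(3) by simp
    qed
    then show "sets M \<subseteq> sigma_sets (space M) (range basic)"
      unfolding T(4) by (intro sigma_sets_subset) auto
    show "sigma_sets (space M) (range basic) \<subseteq> sets M"
      unfolding T(4) by (intro sigma_sets_mono') (use basic_open in auto)
  qed
  interpret coded_space M basic
  proof
    show "sets M = sigma_sets (space M) (range basic)" by (rule sM)
    show "separating (space M) (range basic)"
      unfolding separating_def \<Omega>[symmetric]
    proof (intro ballI impI)
      fix x y assume "x \<in> \<Omega>" "y \<in> \<Omega>" "\<forall>V\<in>range basic. (x \<in> V) = (y \<in> V)"
      then show "x = y" by (intro basic_cong) simp_all
    qed
    show "presented (range basic) (space M)" using presented_space \<Omega> by simp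
  qed
  have "borel_coded M basic"
  proof
    fix F :: "nat \<Rightarrow> 'a set" assume F[measurable]: "\<And>j. F j \<in> sets M"
    \<comment> \<open>\<open>D\<close> is the domain of the partial function with code
      \<open>F\<close>; \<open>code_point\<close> shows that it is Borel.\<close>
    define D where "D = {x\<in>space M. \<exists>y\<in>\<Omega>. \<forall>j. j \<in> {j. x \<in> F j} \<longleftrightarrow> y \<in> basic j}"
    have D: "D \<in> sets M" unfolding D_def code_point unfolding mem_Collect_eq by measurable
    \<comment> \<open>Off \<open>D\<close> the value \<open>q 0\<close> is a default that makes
      \<open>f\<close> total and measurable.\<close>
    define f where "f x = (if x \<in> D then SOME y. y \<in> \<Omega> \<and> (\<forall>j. x \<in> F j \<longleftrightarrow> y \<in> basic j) else q 0)" for x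
    have f: "f x \<in> \<Omega>" "x \<in> F j \<longleftrightarrow> f x \<in> basic j" if "x \<in> D" for x j
    proof -
      have ex: "\<exists>y. y \<in> \<Omega> \<and> (\<forall>j. x \<in> F j \<longleftrightarrow> y \<in> basic j)" using that by (auto simp: D_def)
      have "f x = (SOME y. y \<in> \<Omega> \<and> (\<forall>j. x \<in> F j \<longleftrightarrow> y \<in> basic j))" using that by (simp only: f_def if_True)
      then have "f x \<in> \<Omega> \<and> (\<forall>j. x \<in> F j \<longleftrightarrow> f x \<in> basic j)" by (rule ssubst) (rule someI_ex[OF ex])
      then show "f x \<in> \<Omega>" "x \<in> F j \<longleftrightarrow> f x \<in> basic j" by (rule conjunct1, rule spec[OF conjunct2])
    qed
    have f_out: "f x = q 0" if "x \<notin> D" for x using that by (simp add: f_def)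
    have "f \<in> M \<rightarrow>\<^sub>M M"
    proof (rule measurable_sigma_sets[OF sM])
      show "range basic \<subseteq> Pow (space M)" using basic_sub by blast
      show "f \<in> space M \<rightarrow> space M" using f(1) f_out q \<Omega> by (metis Pi_I)
      fix W assume "W \<in> range basic"
      then obtain j where j: "W = basic j" by blast
      have "f -` W \<inter> space M = (D \<inter> F j) \<union> (if q 0 \<in> basic j then space M - D else {})"
      proof (rule set_eqI)
        fix x show "x \<in> f -` W \<inter> space M \<longleftrightarrow> x \<in> (D \<inter> F j) \<union> (if q 0 \<in> basic j then space M - D else {})"
          using f(2)[of x j] f_out[of x] sets.sets_into_space[OF D] unfolding j by (cases "x \<in> D") auto
      qed
      then show "f -` W \<inter> space M \<in> sets M" using D by simp
    qed
    moreover have "code_graph F \<subseteq> {(x, f x) | x. x \<in> space M}"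
    proof clarify
      fix x y assume "(x, y) \<in> code_graph F"
      then have xy: "x \<in> space M" "y \<in> \<Omega>" "\<And>j. x \<in> F j \<longleftrightarrow> y \<in> basic j" unfolding code_graph_def \<Omega>[symmetric] by simp_all
      then have "x \<in> D" by (auto simp: D_def)
      then have "f x = y" using f xy by (intro basic_cong) auto
      then show "\<exists>x'. (x, y) = (x', f x') \<and> x' \<in> space M" using xy(1) by blast
    qed
    ultimately show "\<exists>f\<in>M \<rightarrow>\<^sub>M M. code_graph F \<subseteq> {(x, f x) | x. x \<in> space M}" by blast
  qed
  then show ?thesis by blast
qed

context borel_coded
begin

theorem cber_enumeration:
  assumes "cber M E"
  shows "\<exists>g. (\<forall>n::nat. g n \<in> M \<rightarrow>\<^sub>M M) \<and> (\<forall>x\<in>space M. E `` {x} = range (\<lambda>n. g n x))"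
proof -
  have E: "equiv (space M) E" "E \<in> sets (M \<Otimes>\<^sub>M M)" "\<And>x. x \<in> space M \<Longrightarrow> countable (E `` {x})"
    using assms by (auto simp: cber_def)
  obtain F where F: "\<And>n j. F n j \<in> sets M" "E \<subseteq> (\<Union>n::nat. code_graph (F n))"
    using lusin_novikov_cover[OF E(2,3)] by blast
  have "\<forall>n. \<exists>f. f \<in> M \<rightarrow>\<^sub>M M \<and> code_graph (F n) \<subseteq> {(x, f x) | x. x \<in> space M}"
  proof
    fix n
    from uniformize[of "F n", OF F(1)] show "\<exists>f. f \<in> M \<rightarrow>\<^sub>M M \<and> code_graph (F n) \<subseteq> {(x, f x) | x. x \<in> space M}"
      unfolding Bex_def .
  qed
  from choice[OF this] obtain f where
    "\<forall>n. f n \<in> M \<rightarrow>\<^sub>M M \<and> code_graph (F n) \<subseteq> {(x, f n x) | x. x \<in> space M}" ..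
  then have f: "\<And>n. f n \<in> M \<rightarrow>\<^sub>M M" "\<And>n. code_graph (F n) \<subseteq> {(x, f n x) | x. x \<in> space M}" by simp_all
  note [measurable] = f(1) E(2)
  \<comment> \<open>Falling back to \<open>x\<close> keeps every value in the class of
    \<open>x\<close> and loses no pair of \<open>E\<close>.\<close>
  define g where "g n x = (if (x, f n x) \<in> E then f n x else x)" for n x
  have "g n \<in> M \<rightarrow>\<^sub>M M" for n
    unfolding g_def by measurable
  moreover have "E `` {x} = range (\<lambda>n. g n x)" if x: "x \<in> space M" for x
  proof
    show "E `` {x} \<subseteq> range (\<lambda>n. g n x)"
    proof
      fix y assume "y \<in> E `` {x}"
      then have xy: "(x, y) \<in> E" by simp
      then obtain n where "(x, y) \<in> code_graph (F n)" using F(2) by blast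
      then have "y = f n x" using f(2)[of n] by blast
      then have "y = g n x" using xy by (simp add: g_def)
      then show "y \<in> range (\<lambda>n. g n x)" by blast
    qed
    have "(x, x) \<in> E" using E(1) x by (meson equivE refl_onD)
    then show "range (\<lambda>n. g n x) \<subseteq> E `` {x}" by (auto simp: g_def)
  qed
  ultimately show ?thesis by blast
qed

end

subsection \<open>Half-spaces of median graphs\<close>

text \<open>A discrete intermediate value principle, applied below to half-spaces along
  walks.\<close>

lemma path_crossing:
  assumes "P (p 0) \<noteq> P (p n)" shows "\<exists>i<n. P (p i) \<noteq> P (p (Suc i))"
proof (rule ccontr)
  assume *: "\<not> ?thesis"
  have eq: "i \<le> n \<Longrightarrow> P (p i) = P (p 0)" for i
  proof (induction i)
    case (Suc i)
    then have "i < n" by simp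
    then have "P (p i) = P (p (Suc i))" using * by (metis (mono_tags))
    then show ?case using Suc by simp
  qed simp
  show False using assms eq[of n] by simp
qed

locale median_graphing =
  fixes X :: "'a set" and G E :: "('a \<times> 'a) set"
  assumes graph: "graph_on X G" and E_eq: "E = connectedness X G"
    and median: "\<And>C. C \<in> components_on X G \<Longrightarrow> median_graph C (Restr G C)"
begin

text \<open>Unspecified when \<open>x\<close> and \<open>y\<close> are not \<open>E\<close>-related.\<close>

definition d :: "'a \<Rightarrow> 'a \<Rightarrow> nat" where "d x y = (LEAST n. (x, y) \<in> G ^^ n)"

lemma gdist_d: "gdist G x y = real (d x y)"
  by (simp add: gdist_def d_def)

lemma G_sym: "(x, y) \<in> G \<Longrightarrow> (y, x) \<in> G"
  using graph by (auto simp: graph_on_def dest: symD)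

lemma G_X: "(x, y) \<in> G \<Longrightarrow> x \<in> X \<and> y \<in> X"
  using graph by (auto simp: graph_on_def)

lemma G_irrefl: "(x, x) \<notin> G"
  using graph by (auto simp: graph_on_def irrefl_def)

lemma E_X: "(x, y) \<in> E \<Longrightarrow> x \<in> X \<and> y \<in> X"
  by (auto simp: E_eq connectedness_def)

lemma E_refl: "x \<in> X \<Longrightarrow> (x, x) \<in> E"
  by (auto simp: E_eq connectedness_def)

lemma E_sym: "(x, y) \<in> E \<Longrightarrow> (y, x) \<in> E"
  using sym_rtrancl[of G] graph by (auto simp: E_eq connectedness_def graph_on_def dest: symD)

lemma E_trans: "(x, y) \<in> E \<Longrightarrow> (y, z) \<in> E \<Longrightarrow> (x, z) \<in> E"
  by (auto simp: E_eq connectedness_def)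

lemma G_E: "(x, y) \<in> G \<Longrightarrow> (x, y) \<in> E"
  using G_X by (auto simp: E_eq connectedness_def)

lemma E_class: "(x, y) \<in> E \<Longrightarrow> E `` {y} = E `` {x}"
  using E_sym E_trans by blast

lemma relpow_E: "(x, y) \<in> G ^^ n \<Longrightarrow> x \<in> X \<Longrightarrow> (x, y) \<in> E"
proof (induction n arbitrary: y)
  case 0 then show ?case using E_refl by simp
next
  case (Suc n)
  then obtain c where "(x, c) \<in> G ^^ n" "(c, y) \<in> G" by auto
  then show ?case using Suc E_trans[OF _ G_E] by blast
qed

lemma relpow_d: "(x, y) \<in> E \<Longrightarrow> (x, y) \<in> G ^^ d x y"
  unfolding d_def E_eq connectedness_def using rtrancl_imp_relpow[of "(x, y)" G]
  by (metis (mono_tags, lifting) IntD1 LeastI rtrancl_imp_relpow)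

lemma d_le: "(x, y) \<in> G ^^ n \<Longrightarrow> d x y \<le> n"
  unfolding d_def by (rule Least_le)

lemma relpow_sym: "(x, y) \<in> G ^^ n \<longleftrightarrow> (y, x) \<in> G ^^ n"
proof -
  have "(y, x) \<in> G ^^ n" if "(x, y) \<in> G ^^ n" for x y n
    using that
  proof (induction n arbitrary: y)
    case (Suc n)
    then obtain c where "(x, c) \<in> G ^^ n" "(c, y) \<in> G" by auto
    then show ?case using Suc.IH G_sym relpow_Suc_I2 by metis
  qed simp
  then show ?thesis by blast
qed

lemma d_commute: "d x y = d y x"
  unfolding d_def relpow_sym[of x y] ..

lemma d_self [simp]: "d x x = 0"
  using d_le[of x x 0] by simp

lemma d_eq_0: "(x, y) \<in> E \<Longrightarrow> d x y = 0 \<longleftrightarrow> x = y"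
  using relpow_d[of x y] by (metis d_self pair_in_Id_conv relpow.simps(1))

lemma d_triangle: "(x, y) \<in> E \<Longrightarrow> (y, z) \<in> E \<Longrightarrow> d x z \<le> d x y + d y z"
  by (rule d_le) (auto simp: relpow_add intro: relpow_d)

lemma d_edge: "(x, y) \<in> G \<Longrightarrow> d x y = 1"
  using d_le[of x y 1] d_eq_0[of x y] G_E G_irrefl by (fastforce simp: le_Suc_eq)

lemma d_step: "(x, y) \<in> E \<Longrightarrow> d x y = Suc n \<Longrightarrow> \<exists>u. (x, u) \<in> G \<and> d u y = n"
proof -
  assume xy: "(x, y) \<in> E" "d x y = Suc n"
  then have "(x, y) \<in> G ^^ Suc n" using relpow_d by metis
  then obtain u where u: "(x, u) \<in> G" "(u, y) \<in> G ^^ n" by (meson relpow_Suc_D2)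
  then have "d u y \<le> n" by (intro d_le)
  moreover have "d x y \<le> 1 + d u y"
    using d_triangle[of x u y] d_edge[OF u(1)] G_E[OF u(1)] relpow_E[OF u(2)] G_X[OF u(1)] by simp
  ultimately show ?thesis using u xy by (intro exI[of _ u]) auto
qed

lemma component: "x \<in> X \<Longrightarrow> E `` {x} \<in> components_on X G"
  by (auto simp: components_on_def E_eq quotient_def)

text \<open>A walk that starts in a class stays in it. The subgraph \<open>H\<close> is arbitrary
  because the result serves both \<open>G\<close> and the tree.\<close>

lemma relpow_Restr:
  assumes "H \<subseteq> G" "a \<in> E `` {x}" shows "(a, b) \<in> (Restr H (E `` {x})) ^^ n \<longleftrightarrow> (a, b) \<in> H ^^ n"
proof
  show "(a, b) \<in> (Restr H (E `` {x})) ^^ n \<Longrightarrow> (a, b) \<in> H ^^ n"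
    by (induction n arbitrary: b) auto
  have "(a, b) \<in> H ^^ n \<Longrightarrow> (a, b) \<in> (Restr H (E `` {x})) ^^ n \<and> b \<in> E `` {x}"
  proof (induction n arbitrary: b)
    case 0 then show ?case using assms by auto
  next
    case (Suc n)
    then obtain c where c: "(a, c) \<in> H ^^ n" "(c, b) \<in> H" by auto
    then have "c \<in> E `` {x}" "(a, c) \<in> (Restr H (E `` {x})) ^^ n" using Suc.IH by blast+
    moreover have "b \<in> E `` {x}" using c assms(1) calculation(1) G_E E_trans by blast
    ultimately show ?case using c(2) by auto
  qed
  then show "(a, b) \<in> H ^^ n \<Longrightarrow> (a, b) \<in> (Restr H (E `` {x})) ^^ n" by blast
qed

lemma gdist_Restr:
  assumes "H \<subseteq> G" "a \<in> E `` {x}" shows "gdist (Restr H (E `` {x})) a b = gdist H a b"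
  using relpow_Restr[OF assms] by (simp add: gdist_def)

section \<open>Medians, parity of distances and convex half-spaces\<close>

definition btw :: "'a \<Rightarrow> 'a \<Rightarrow> 'a \<Rightarrow> bool" where "btw x z y \<longleftrightarrow> d x z + d z y = d x y"

lemma interval_iff:
  assumes "a \<in> E `` {x}"
  shows "z \<in> geod_interval (E `` {x}) (Restr G (E `` {x})) a b \<longleftrightarrow> z \<in> E `` {x} \<and> btw a z b"
proof (cases "z \<in> E `` {x}")
  case True
  then show ?thesis
    using gdist_Restr[OF subset_refl assms] gdist_Restr[OF subset_refl True]
    by (simp add: geod_interval_def btw_def gdist_d flip: of_nat_add)
qed (auto simp: geod_interval_def)

lemma median_unique:
  assumes "(x, y) \<in> E" "(x, z) \<in> E"
  shows "\<exists>!m. (x, m) \<in> E \<and> btw x m y \<and> btw y m z \<and> btw z m x"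
proof -
  let ?C = "E `` {x}"
  have xX: "x \<in> X" using E_X assms by blast
  have in_C: "x \<in> ?C" "y \<in> ?C" "z \<in> ?C" using assms E_refl[OF xX] by auto
  have "median_graph ?C (Restr G ?C)" using median[OF component[OF xX]] .
  then have "is_singleton (geod_interval ?C (Restr G ?C) x y \<inter> geod_interval ?C (Restr G ?C) y z \<inter> geod_interval ?C (Restr G ?C) z x)"
    using in_C unfolding median_graph_def by blast
  then obtain m where m: "geod_interval ?C (Restr G ?C) x y \<inter> geod_interval ?C (Restr G ?C) y z \<inter> geod_interval ?C (Restr G ?C) z x = {m}"
    by (rule is_singletonE)
  have "w = m \<longleftrightarrow> (x, w) \<in> E \<and> btw x w y \<and> btw y w z \<and> btw z w x" for w
  proof -
    have "w = m \<longleftrightarrow> w \<in> geod_interval ?C (Restr G ?C) x y \<inter> geod_interval ?C (Restr G ?C) y z \<inter> geod_interval ?C (Restr G ?C) z x"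
      using m by simp
    then show ?thesis unfolding Int_iff interval_iff[OF in_C(1)] interval_iff[OF in_C(2)] interval_iff[OF in_C(3)] by auto
  qed
  then show ?thesis by metis
qed

lemma median_exists:
  assumes "(x, y) \<in> E" "(x, z) \<in> E"
  obtains m where "(x, m) \<in> E" "d x m + d m y = d x y" "d y m + d m z = d y z" "d z m + d m x = d z x"
  using median_unique[OF assms] unfolding btw_def by metis

text \<open>The median of \<open>x\<close>, \<open>y\<close>, \<open>z\<close> lies on the edge and
  so is one of its ends, which puts that end on a geodesic from \<open>z\<close> to the other one.
  In particular median graphs are bipartite.\<close>

lemma edge_cases:
  assumes "(x, y) \<in> G" "(x, z) \<in> E"
  shows "d z x = Suc (d z y) \<or> d z y = Suc (d z x)"
proof -
  obtain m where m: "(x, m) \<in> E" "d x m + d m y = d x y" "d y m + d m z = d y z" "d z m + d m x = d z x"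
    using median_exists[OF G_E[OF assms(1)] assms(2)] .
  have "d x m = 0 \<or> d m y = 0" using m(2) d_edge[OF assms(1)] by linarith
  then have "m = x \<or> m = y"
    using d_eq_0[OF m(1)] d_eq_0[of m y] E_trans[OF E_sym[OF m(1)] G_E[OF assms(1)]] by auto
  then show ?thesis
    using m d_edge[OF assms(1)] d_commute[of x y] d_commute[of y z] d_commute[of x z] by auto
qed

text \<open>For an edge this turns out to be the half-space containing \<open>y\<close> of the
  hyperplane through that edge.\<close>

definition hs :: "'a \<Rightarrow> 'a \<Rightarrow> 'a set" where "hs x y = {z. (x, z) \<in> E \<and> d z y < d z x}"

lemma hs_iff:
  assumes "(x, y) \<in> G" "(x, z) \<in> E"
  shows "z \<in> hs x y \<longleftrightarrow> d z x = Suc (d z y)" "z \<notin> hs x y \<longleftrightarrow> d z y = Suc (d z x)"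
  using edge_cases[OF assms] assms by (auto simp: hs_def)

lemma hs_E: "z \<in> hs x y \<Longrightarrow> (x, z) \<in> E"
  by (simp add: hs_def)

lemma hs_self: "(x, y) \<in> G \<Longrightarrow> x \<notin> hs x y \<and> y \<in> hs x y"
  using d_edge[of x y] d_commute[of x y] G_E[of x y] by (simp add: hs_def)

text \<open>By induction on \<open>d u v\<close> it suffices to treat a neighbour \<open>a\<close> of \<open>u\<close>. If \<open>a\<close> is outside,
  let \<open>c\<close> be the median of \<open>u\<close>, \<open>v\<close>, \<open>y\<close>, which is inside and is also a median of \<open>u\<close>, \<open>v\<close>, \<open>x\<close>. If
  \<open>d u v = 2\<close>, then \<open>a\<close> is another median of \<open>u\<close>, \<open>v\<close>, \<open>x\<close>. Otherwise let \<open>c1\<close> be a neighbour of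
  \<open>u\<close> towards \<open>c\<close>; the median of \<open>a\<close>, \<open>c1\<close>, \<open>v\<close> is inside by induction, at distance 2 from \<open>u\<close>,
  with \<open>a\<close> in between.\<close>

lemma hs_convex:
  assumes xy: "(x, y) \<in> G" and u: "u \<in> hs x y" and v: "v \<in> hs x y" and z: "(x, z) \<in> E" "btw u z v"
  shows "z \<in> hs x y"
  using u v z
proof (induction "d u v" arbitrary: u v z rule: less_induct)
  case less
  note IH = less.hyps and u = less.prems(1) and v = less.prems(2) and zE = less.prems(3) and z = less.prems(4)
  define k where "k = d u v"
  have xu: "(x, u) \<in> E" and xv: "(x, v) \<in> E" using u v by (auto simp: hs_def)
  have Erel: "(a, b) \<in> E" if "(x, a) \<in> E" "(x, b) \<in> E" for a b using that E_sym E_trans by blast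
  have tri: "d a c \<le> d a b + d b c" if "(x, a) \<in> E" "(x, b) \<in> E" "(x, c) \<in> E" for a b c
    using d_triangle Erel that by blast
  have yE: "(x, y) \<in> E" using G_E xy .
  have xE: "(x, x) \<in> E" using E_refl G_X xy by blast
  show ?case
  proof (cases "z = u")
    case False
    then have "d u z \<noteq> 0" using d_eq_0[OF Erel[OF xu zE]] by auto
    then obtain n where n: "d u z = Suc n" using not0_implies_Suc by blast
    obtain a where a: "(u, a) \<in> G" "d a z = n" using d_step[OF Erel[OF xu zE] n] by blast
    have xa: "(x, a) \<in> E" using E_trans[OF xu G_E[OF a(1)]] .
    have dua: "d u a = 1" "d a u = 1" using d_edge[OF a(1)] d_commute by auto
    have dav: "Suc (d a v) = k"
      using tri[OF xa zE xv] tri[OF xu xa xv] z n a dua by (simp add: btw_def k_def)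
    have "a \<in> hs x y"
    proof (rule ccontr)
      assume naH: "a \<notin> hs x y"
      define j where "j = d u y"
      have dux: "d u x = Suc j" using hs_iff(1)[OF xy xu] u j_def by simp
      have day: "d a y = Suc (d a x)" using hs_iff(2)[OF xy xa] naH by simp
      have dax: "d a x = j"
        using day tri[OF xa xu yE] tri[OF xu xa xE] dua dux j_def by simp
      have dvx: "d v x = Suc (d v y)" using hs_iff(1)[OF xy xv] v by simp
      obtain c where c: "(u, c) \<in> E" "d u c + d c v = d u v" "d v c + d c y = d v y" "d y c + d c u = d y u"
        using median_exists[OF Erel[OF xu xv] Erel[OF xu yE]] .
      have xc: "(x, c) \<in> E" using E_trans[OF xu c(1)] .
      have cu: "d c u = d u c" "d y c = d c y" "d y u = j" "d v c = d c v" using d_commute j_def by auto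
      have dcx: "d c x = Suc (d c y)"
        using tri[OF xc yE xE] tri[OF xu xc xE] dux c cu d_edge[OF G_sym[OF xy]] by simp
      have cH: "c \<in> hs x y" using hs_iff(1)[OF xy xc] dcx by simp
      \<comment> \<open>If \<open>c\<close> were \<open>u\<close>, the route from \<open>v\<close>
        to \<open>x\<close> through \<open>a\<close> would be too short; if \<open>c\<close> were
        \<open>v\<close>, so would be the route from \<open>a\<close> to \<open>y\<close> through
        \<open>v\<close>.\<close>
      have c_u: "d c u \<noteq> 0"
      proof
        assume "d c u = 0"
        then have "c = u" using d_eq_0[OF Erel[OF xc xu]] by simp
        then show False using c dvx dux tri[OF xv xa xE] dav dax cu d_commute[of v a] j_def k_def d_commute[of v u] by simp
      qed
      have c_v: "d c v \<noteq> 0"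
      proof
        assume "d c v = 0"
        then have "c = v" using d_eq_0[OF Erel[OF xc xv]] by simp
        then show False using c day dax tri[OF xa xv yE] dav cu k_def d_commute[of y v] d_commute[of v u] by simp
      qed
      obtain m where m: "d u c = Suc m" using c_u cu not0_implies_Suc by metis
      obtain c1 where c1: "(u, c1) \<in> G" "d c1 c = m" using d_step[OF Erel[OF xu xc] m] by blast
      have xc1: "(x, c1) \<in> E" using E_trans[OF xu G_E[OF c1(1)]] .
      have duc1: "d u c1 = 1" "d c1 u = 1" using d_edge[OF c1(1)] d_commute by auto
      have c1H: "c1 \<in> hs x y"
        by (rule IH[OF _ u cH xc1]) (use c c_v c1 m duc1 in \<open>auto simp: btw_def\<close>)
      have dc1v: "Suc (d c1 v) = k"
        using tri[OF xc1 xc xv] tri[OF xu xc1 xv] c1 m c duc1 k_def by simp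
      have dc1x: "d c1 x = j"
        using tri[OF xc1 xc xE] tri[OF xu xc1 xE] c1 m c cu dcx dux duc1 by simp
      have nadj: "(a, c1) \<notin> G"
        using edge_cases[of a c1 v] Erel[OF xa xv] dav dc1v d_commute[of v a] d_commute[of v c1] by auto
      have dac1: "d a c1 = 2"
      proof -
        have "d a c1 \<le> 2" using tri[OF xa xu xc1] dua duc1 by simp
        moreover have "d a c1 \<noteq> 0" using d_eq_0[OF Erel[OF xa xc1]] naH c1H by auto
        moreover have "d a c1 \<noteq> 1" using relpow_d[OF Erel[OF xa xc1]] nadj by (auto simp: relpow_1)
        ultimately show ?thesis by linarith
      qed
      have k2: "k \<ge> 2" using c c_u c_v cu k_def by linarith
      show False
      proof (cases "k = 2")
        case True
        then have duc: "d u c = 1" "d c v = 1" using c c_u c_v cu k_def by linarith+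
        have dcx': "d c x = j" using c cu duc dcx by simp
        have dvx': "d v x = Suc j" using c cu duc dcx dcx' dvx by simp
        have "(u, a) \<in> E \<and> btw u a v \<and> btw v a x \<and> btw x a u"
          using Erel[OF xu xa] dua dav dax dvx' dux True d_commute[of v a] d_commute[of x a] d_commute[of x u]
          by (simp add: btw_def k_def)
        moreover have "(u, c) \<in> E \<and> btw u c v \<and> btw v c x \<and> btw x c u"
          using c(1) duc dcx' dvx' dux True cu d_commute[of x c] d_commute[of x u]
          by (simp add: btw_def k_def)
        ultimately have "a = c" using median_unique[OF Erel[OF xu xv] Erel[OF xu xE]] by blast
        then show False using naH cH by simp
      next
        case False
        obtain w where w: "(a, w) \<in> E" "d a w + d w c1 = d a c1" "d c1 w + d w v = d c1 v" "d v w + d w a = d v a"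
          using median_exists[OF Erel[OF xa xc1] Erel[OF xa xv]] .
        have xw: "(x, w) \<in> E" using E_trans[OF xa w(1)] .
        have eqs: "d c1 w = d w c1" "d v w = d w v" "d w a = d a w" "d v a = d a v" using d_commute by auto
        have ws: "d a w = 1" "d w c1 = 1" "Suc (Suc (d w v)) = k" using w eqs dac1 dav dc1v by linarith+
        have wH: "w \<in> hs x y"
          by (rule IH[OF _ c1H v xw]) (use w dc1v k_def in \<open>auto simp: btw_def\<close>)
        have duw: "d u w = 2" using tri[OF xu xa xw] tri[OF xu xw xv] dua ws k_def by simp
        have "a \<in> hs x y"
          by (rule IH[OF _ u wH xa]) (use duw False k2 k_def dua ws in \<open>auto simp: btw_def\<close>)
        then show False using naH by simp
      qed
    qed
    moreover have "btw a z v" using z n a dav by (simp add: btw_def k_def)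
    ultimately show ?thesis using IH[of a v] v zE dav k_def by simp
  qed (use u in simp)
qed

lemma hs_compl: "(x, y) \<in> G \<Longrightarrow> hs y x = E `` {x} - hs x y"
proof (rule set_eqI)
  fix z assume xy: "(x, y) \<in> G"
  show "z \<in> hs y x \<longleftrightarrow> z \<in> E `` {x} - hs x y"
  proof (cases "(x, z) \<in> E")
    case True
    then have "(y, z) \<in> E" using E_trans[OF E_sym[OF G_E[OF xy]]] by blast
    then show ?thesis using hs_iff(1)[OF G_sym[OF xy]] hs_iff(2)[OF xy True] True by simp
  next
    case False
    then have "(y, z) \<notin> E" using E_trans[OF G_E[OF xy]] by blast
    then show ?thesis using False by (auto simp: hs_def)
  qed
qed

text \<open>A vertex on which the two half-spaces disagree would have one end of
  \<open>(u, v)\<close> between itself and the other end; convexity of \<open>hs x y\<close> or of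
  its complement would then put both ends on the same side.\<close>

lemma hs_unique:
  assumes xy: "(x, y) \<in> G" and uv: "(u, v) \<in> G" "(x, u) \<in> E" "u \<notin> hs x y" "v \<in> hs x y"
  shows "hs u v = hs x y"
proof (rule set_eqI)
  fix z
  have xv: "(x, v) \<in> E" using hs_E[OF uv(4)] .
  show "z \<in> hs u v \<longleftrightarrow> z \<in> hs x y"
  proof (cases "(x, z) \<in> E")
    case True
    have uz: "(u, z) \<in> E" using E_trans[OF E_sym[OF uv(2)] True] .
    have du: "d v u = 1" "d u v = 1" using d_edge[OF uv(1)] d_commute by auto
    show ?thesis
    proof
      assume z: "z \<in> hs u v"
      show "z \<in> hs x y"
      proof (rule ccontr)
        assume "z \<notin> hs x y"
        then have "z \<in> hs y x" "u \<in> hs y x" using hs_compl[OF xy] True uv by auto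
        moreover have "btw z v u" using hs_iff(1)[OF uv(1) uz] z du by (simp add: btw_def)
        ultimately have "v \<in> hs y x"
          using hs_convex[OF G_sym[OF xy], of z u v] E_trans[OF E_sym[OF G_E[OF xy]] xv] by blast
        then show False using hs_compl[OF xy] uv(4) by auto
      qed
    next
      assume z: "z \<in> hs x y"
      show "z \<in> hs u v"
      proof (rule ccontr)
        assume "z \<notin> hs u v"
        then have "btw z u v" using hs_iff(2)[OF uv(1) uz] du by (simp add: btw_def)
        then show False using hs_convex[OF xy z uv(4) uv(2)] uv(3) by blast
      qed
    qed
  next
    case False
    then have "(u, z) \<notin> E" using E_trans[OF uv(2)] by blast
    then show ?thesis using False by (auto simp: hs_def)
  qed
qed

section \<open>Hyperplanes as classes of edges\<close>

definition sep :: "'a \<Rightarrow> 'a \<Rightarrow> 'a \<Rightarrow> 'a \<Rightarrow> bool" where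
  "sep x y u v \<longleftrightarrow> (u \<in> hs x y) \<noteq> (v \<in> hs x y)"

text \<open>The edges of the hyperplane of \<open>(x, y)\<close>, in both orientations.\<close>

definition Hyp :: "'a \<Rightarrow> 'a \<Rightarrow> ('a \<times> 'a) set" where
  "Hyp x y = {(u, v). (u, v) \<in> G \<and> (x, u) \<in> E \<and> sep x y u v}"

lemma sep_commute: "sep x y u v \<longleftrightarrow> sep x y v u"
  by (auto simp: sep_def)

lemma sep_trans: "sep x y u w \<Longrightarrow> sep x y u v \<or> sep x y v w"
  by (auto simp: sep_def)

lemma sep_swap: "(x, y) \<in> G \<Longrightarrow> (x, u) \<in> E \<Longrightarrow> (x, v) \<in> E \<Longrightarrow> sep y x u v \<longleftrightarrow> sep x y u v"
  by (auto simp: sep_def hs_compl)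

lemma Hyp_hs:
  assumes "(x, y) \<in> G" "(u, v) \<in> Hyp x y" shows "hs u v = hs x y \<or> hs v u = hs x y"
proof -
  have uv: "(u, v) \<in> G" "(x, u) \<in> E" "sep x y u v" using assms(2) by (auto simp: Hyp_def)
  have xv: "(x, v) \<in> E" using E_trans[OF uv(2) G_E[OF uv(1)]] .
  show ?thesis
    using hs_unique[OF assms(1) uv(1,2)] hs_unique[OF assms(1) G_sym[OF uv(1)] xv] uv(3) by (auto simp: sep_def)
qed

lemma hs_Hyp:
  assumes "(x, y) \<in> G" "(u, v) \<in> G" "hs u v = hs x y" shows "(u, v) \<in> Hyp x y"
  using hs_self[OF assms(2)] hs_E[of v x y] E_trans[OF _ E_sym[OF G_E[OF assms(2)]], of x] assms
  by (auto simp: Hyp_def sep_def)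

lemma Hyp_self: "(x, y) \<in> G \<Longrightarrow> (x, y) \<in> Hyp x y"
  by (rule hs_Hyp) auto

lemma Hyp_sym: "(u, v) \<in> Hyp x y \<Longrightarrow> (v, u) \<in> Hyp x y"
  using G_sym G_E E_trans by (auto simp: Hyp_def sep_def)

lemma Hyp_E: "(u, v) \<in> Hyp x y \<Longrightarrow> (x, u) \<in> E \<and> (x, v) \<in> E \<and> (u, v) \<in> G"
  using G_E E_trans by (auto simp: Hyp_def)

lemma Hyp_sep_eq:
  assumes "(x, y) \<in> G" "(u, v) \<in> Hyp x y" "(x, a) \<in> E" "(x, b) \<in> E"
  shows "sep u v a b \<longleftrightarrow> sep x y a b"
proof -
  have uv: "(u, v) \<in> G" "(x, u) \<in> E" "(x, v) \<in> E" using Hyp_E[OF assms(2)] by auto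
  have "(u, a) \<in> E" "(u, b) \<in> E" using E_trans[OF E_sym[OF uv(2)]] assms by auto
  then have "sep v u a b \<longleftrightarrow> sep u v a b" using sep_swap[OF uv(1)] by blast
  then show ?thesis using Hyp_hs[OF assms(1,2)] by (auto simp: sep_def)
qed

lemma Hyp_eq:
  assumes "(x, y) \<in> G" "(u, v) \<in> Hyp x y" shows "Hyp u v = Hyp x y"
proof -
  have uv: "(u, v) \<in> G" "(x, u) \<in> E" using Hyp_E[OF assms(2)] by auto
  have "(a, b) \<in> Hyp u v \<longleftrightarrow> (a, b) \<in> Hyp x y" for a b
  proof (cases "(a, b) \<in> G \<and> (x, a) \<in> E")
    case True
    then have "(x, b) \<in> E" "(u, a) \<in> E" using E_trans G_E E_sym[OF uv(2)] by blast+
    then show ?thesis using Hyp_sep_eq[OF assms, of a b] True by (simp add: Hyp_def)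
  next
    case False
    then show ?thesis using E_trans[OF uv(2)] by (auto simp: Hyp_def)
  qed
  then show ?thesis by auto
qed

lemma Hyp_commute: "(x, y) \<in> G \<Longrightarrow> (u, v) \<in> Hyp x y \<Longrightarrow> (x, y) \<in> Hyp u v"
  using Hyp_eq Hyp_self by blast

text \<open>\<open>v'\<close> is nearer to \<open>v\<close> than to its neighbour \<open>u\<close>,
  hence at distance 0 from \<open>v\<close>. So the edges of a hyperplane form a matching.\<close>

lemma hs_matching: "(u, v) \<in> G \<Longrightarrow> (u, v') \<in> G \<Longrightarrow> hs u v = hs u v' \<Longrightarrow> v = v'"
  using hs_self[of u v'] d_edge[of u v'] d_commute[of u v'] d_eq_0[of v' v] E_trans[OF E_sym[OF G_E]] G_E
  by (metis (no_types, lifting) hs_def less_one mem_Collect_eq)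

text \<open>At every step the distance from \<open>x\<close> rises and the distance to
  \<open>x'\<close> falls, so each edge lies in a hyperplane separating the two ends.\<close>

lemma geodesic:
  assumes "(x, x') \<in> E"
  obtains p where "p 0 = x" "p (d x x') = x'" "\<And>i. i < d x x' \<Longrightarrow> (p i, p (Suc i)) \<in> G"
    "\<And>i. i < d x x' \<Longrightarrow> sep (p i) (p (Suc i)) x x'"
    "\<And>i. i \<le> d x x' \<Longrightarrow> (x, p i) \<in> E \<and> d x (p i) = i \<and> btw x (p i) x'"
proof -
  define n where "n = d x x'"
  have "(x, x') \<in> G ^^ n" using relpow_d[OF assms] n_def by simp
  then obtain p where p: "p 0 = x" "p n = x'" "\<And>i. i < n \<Longrightarrow> (p i, p (Suc i)) \<in> G"
    unfolding relpow_fun_conv by blast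
  have xX: "x \<in> X" using E_X assms by blast
  have pre: "i \<le> n \<Longrightarrow> (x, p i) \<in> G ^^ i" for i
    unfolding relpow_fun_conv using p by (intro exI[of _ p]) auto
  have suf: "i \<le> n \<Longrightarrow> (p i, x') \<in> G ^^ (n - i)" for i
    unfolding relpow_fun_conv using p by (intro exI[of _ "\<lambda>j. p (i + j)"]) auto
  have E: "i \<le> n \<Longrightarrow> (x, p i) \<in> E" for i using relpow_E[OF pre xX] .
  have ds: "d x (p i) = i \<and> d (p i) x' = n - i" if "i \<le> n" for i
  proof -
    have "d x x' \<le> d x (p i) + d (p i) x'"
      using d_triangle[OF E[OF that] E_trans[OF E_sym[OF E[OF that]] assms]] .
    then show ?thesis using d_le[OF pre[OF that]] d_le[OF suf[OF that]] that n_def by linarith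
  qed
  have "sep (p i) (p (Suc i)) x x'" if "i < n" for i
  proof -
    have e: "(p i, p (Suc i)) \<in> G" using p that by blast
    have E': "(p i, x) \<in> E" "(p i, x') \<in> E" using E_sym[OF E[of i]] that E_trans[OF _ assms] by simp_all
    have "d x (p (Suc i)) = Suc (d x (p i))" using ds[of i] ds[of "Suc i"] that by simp
    moreover have "d x' (p i) = Suc (d x' (p (Suc i)))" using ds[of i] ds[of "Suc i"] that d_commute by simp
    ultimately show ?thesis using hs_iff(2)[OF e E'(1)] hs_iff(1)[OF e E'(2)] by (simp add: sep_def)
  qed
  then show ?thesis using that[of p] p E ds n_def by (simp add: btw_def)
qed

text \<open>The clauses are the four quadrants. Only the last one names the class, since membership
  in a half-space already places a point in its class.\<close>

definition cross :: "'a \<Rightarrow> 'a \<Rightarrow> 'a \<Rightarrow> 'a \<Rightarrow> bool" where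
  "cross x y u v \<longleftrightarrow> (\<exists>a. a \<in> hs x y \<and> a \<in> hs u v) \<and> (\<exists>a. a \<in> hs x y \<and> a \<notin> hs u v) \<and>
     (\<exists>a. a \<notin> hs x y \<and> a \<in> hs u v) \<and> (\<exists>a. (x, a) \<in> E \<and> a \<notin> hs x y \<and> a \<notin> hs u v)"

text \<open>Another edge of a hyperplane gives the same half-space or its complement, and
  complements merely permute the quadrants.\<close>

lemma cross_Hyp:
  assumes "(x, y) \<in> G" "(u, v) \<in> G" "(x, u) \<in> E" "(x', y') \<in> Hyp x y" "(u', v') \<in> Hyp u v" "cross x y u v"
  shows "cross x' y' u' v'"
proof -
  have e: "(x', y') \<in> G" "(x, x') \<in> E" "(u', v') \<in> G" "(u, u') \<in> E" using Hyp_E assms by blast+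
  have cl: "E `` {x'} = E `` {x}" "E `` {u'} = E `` {x}" "E `` {u} = E `` {x}"
    using E_class[OF e(2)] E_class[OF e(4)] E_class[OF assms(3)] by auto
  have "cross x y u' v'"
  proof (cases "hs u' v' = hs u v")
    case True then show ?thesis using assms by (simp add: cross_def)
  next
    case False
    then have "hs v' u' = hs u v" using Hyp_hs[OF assms(2,5)] by blast
    then have mem: "a \<in> hs u v \<longleftrightarrow> (x, a) \<in> E \<and> a \<notin> hs u' v'" for a using hs_compl[OF e(3)] cl by auto
    have "a \<in> hs u' v' \<Longrightarrow> (x, a) \<in> E" for a using hs_E[of a u' v'] cl by blast
    then show ?thesis using assms(6) hs_E[of _ x y] unfolding cross_def mem by blast
  qed
  moreover have "cross x' y' u' v'" if "cross x y u' v'"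
  proof (cases "hs x' y' = hs x y")
    case True then show ?thesis using that cl e(2) E_trans[OF E_sym[OF e(2)]] by (auto simp: cross_def)
  next
    case False
    then have "hs y' x' = hs x y" using Hyp_hs[OF assms(1,4)] by blast
    then have mem: "a \<in> hs x y \<longleftrightarrow> (x, a) \<in> E \<and> a \<notin> hs x' y'" for a using hs_compl[OF e(1)] cl by auto
    have "a \<in> hs x' y' \<Longrightarrow> (x, a) \<in> E" "a \<in> hs u' v' \<Longrightarrow> (x, a) \<in> E" "(x', a) \<in> E \<longleftrightarrow> (x, a) \<in> E" for a
      using hs_E[of a x' y'] hs_E[of a u' v'] cl by blast+
    then show ?thesis using that unfolding cross_def mem by blast
  qed
  ultimately show ?thesis by blast
qed

lemma cross_sym: "(x, u) \<in> E \<Longrightarrow> cross x y u v \<Longrightarrow> cross u v x y"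
  using E_trans E_sym unfolding cross_def by blast

text \<open>A geodesic from \<open>a\<close> to \<open>b\<close> stays in the convex set
  \<open>hs u v\<close> and has to cross the hyperplane of \<open>(x, y)\<close> somewhere.\<close>

lemma convex_crossing_edge:
  assumes xy: "(x, y) \<in> G" and uv: "(u, v) \<in> G" and ab: "a \<in> hs u v" "b \<in> hs u v" "sep x y a b" and xu: "(x, u) \<in> E"
  shows "\<exists>p q. (p, q) \<in> Hyp x y \<and> p \<in> hs u v"
proof -
  have E: "(u, a) \<in> E" "(u, b) \<in> E" using hs_E ab by blast+
  then have abE: "(a, b) \<in> E" using E_sym E_trans by blast
  obtain p where p: "p 0 = a" "p (d a b) = b" "\<And>i. i < d a b \<Longrightarrow> (p i, p (Suc i)) \<in> G"
    "\<And>i. i \<le> d a b \<Longrightarrow> (a, p i) \<in> E \<and> d a (p i) = i \<and> btw a (p i) b" using geodesic[OF abE] by metis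
  obtain i where i: "i < d a b" "sep x y (p i) (p (Suc i))"
    using path_crossing[of "\<lambda>z. z \<in> hs x y" p "d a b"] ab(3) p(1,2) by (auto simp: sep_def)
  have "(u, p i) \<in> E" using p(4)[of i] i(1) E_trans[OF E(1)] by simp
  then have "p i \<in> hs u v" using hs_convex[OF uv ab(1,2)] p(4)[of i] i(1) by simp
  moreover have "(p i, p (Suc i)) \<in> Hyp x y"
    using p(3)[OF i(1)] i(2) E_trans[OF xu \<open>(u, p i) \<in> E\<close>] by (simp add: Hyp_def)
  ultimately show ?thesis by blast
qed

text \<open>Reduces crossing to the separation of two endpoints of edges of one fixed hyperplane,
  which is what finiteness and diameter bounds can control.\<close>

lemma cross_edges:
  assumes xy: "(x, y) \<in> G" and uv: "(u, v) \<in> G" and xu: "(x, u) \<in> E" and cr: "cross x y u v"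
  shows "\<exists>p p' q q'. (p, p') \<in> Hyp x y \<and> (q, q') \<in> Hyp x y \<and> sep u v p q"
proof -
  obtain a b c e where pts: "a \<in> hs x y" "a \<in> hs u v" "b \<in> hs x y" "b \<notin> hs u v" "c \<notin> hs x y" "c \<in> hs u v"
    "(x, e) \<in> E" "e \<notin> hs x y" "e \<notin> hs u v" using cr unfolding cross_def by blast
  obtain p p' where p: "(p, p') \<in> Hyp x y" "p \<in> hs u v"
    using convex_crossing_edge[OF xy uv pts(2,6) _ xu] pts by (auto simp: sep_def)
  have compl: "hs v u = E `` {u} - hs u v" using hs_compl[OF uv] .
  have "b \<in> hs v u" "e \<in> hs v u" using pts compl hs_E[OF pts(3)] E_trans[OF E_sym[OF xu]] by auto
  then obtain q q' where q: "(q, q') \<in> Hyp x y" "q \<in> hs v u"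
    using convex_crossing_edge[OF xy G_sym[OF uv] _ _ _ E_trans[OF xu G_E[OF uv]], of b e] pts by (auto simp: sep_def)
  then have "q \<notin> hs u v" using compl by simp
  then show ?thesis using p q(1) by (auto simp: sep_def)
qed

section \<open>Comparison with the hyperplanes of the components\<close>

lemma hyperplane_mem:
  assumes "(x, y) \<in> G"
  shows "{(u, v). (u, v) \<in> Restr G (E `` {x}) \<and> u \<notin> hs x y \<and> v \<in> hs x y} \<in> hyperplanes (E `` {x}) (Restr G (E `` {x}))"
proof -
  let ?C = "E `` {x}"
  have sub: "hs x y \<subseteq> ?C" using hs_E by blast
  have "half_space ?C (Restr G ?C) (hs x y)"
    unfolding half_space_def convex_in_def
  proof (intro conjI ballI)
    fix a b assume ab: "a \<in> hs x y" "b \<in> hs x y"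
    then show "geod_interval ?C (Restr G ?C) a b \<subseteq> hs x y"
      using interval_iff[of a x _ b] hs_convex[OF assms ab] sub by blast
  next
    fix a b assume ab: "a \<in> ?C - hs x y" "b \<in> ?C - hs x y"
    have *: "z \<in> ?C - hs x y" if "z \<in> ?C" "btw a z b" for z
      using hs_convex[OF G_sym[OF assms], of a b z] ab that E_trans[OF E_sym[OF G_E[OF assms]]] unfolding hs_compl[OF assms] by blast
    show "geod_interval ?C (Restr G ?C) a b \<subseteq> ?C - hs x y"
      using interval_iff[of a x _ b] ab * by blast
  qed (use sub in auto)
  moreover have "hs x y \<noteq> {}" "hs x y \<noteq> ?C" using hs_self[OF assms] E_refl G_X[OF assms] by auto
  ultimately show ?thesis unfolding hyperplanes_def by blast
qed

lemma Hyp_decomp: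
  assumes "(x, y) \<in> G"
  defines "h \<equiv> {(u, v). (u, v) \<in> Restr G (E `` {x}) \<and> u \<notin> hs x y \<and> v \<in> hs x y}"
  shows "Hyp x y = h \<union> h\<inverse>"
  using hs_E G_sym G_E E_trans E_sym unfolding h_def Hyp_def sep_def by blast

lemma finite_Hyp:
  assumes "finite_hyperplanes X G" "(x, y) \<in> G" shows "finite (Hyp x y)"
  unfolding Hyp_decomp[OF assms(2)]
  using assms(1) hyperplane_mem[OF assms(2)] component[of x] G_X[OF assms(2)] unfolding finite_hyperplanes_def by auto

lemma bounded_Hyp:
  assumes "bounded_diameter_hyperplanes X G"
  shows "\<exists>R. \<forall>x y u v. (x, y) \<in> G \<longrightarrow> u \<in> Field (Hyp x y) \<longrightarrow> v \<in> Field (Hyp x y) \<longrightarrow> d u v \<le> R"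
proof -
  obtain R where R: "\<And>C h u v. C \<in> components_on X G \<Longrightarrow> h \<in> hyperplanes C (Restr G C) \<Longrightarrow> u \<in> Field h \<Longrightarrow> v \<in> Field h \<Longrightarrow>
      gdist (Restr G C) u v \<le> R" using assms unfolding bounded_diameter_hyperplanes_def by blast
  have "d u v \<le> nat \<lfloor>R\<rfloor>" if xy: "(x, y) \<in> G" "u \<in> Field (Hyp x y)" "v \<in> Field (Hyp x y)" for x y u v
  proof -
    have "u \<in> E `` {x}" using xy(2) Hyp_E[of _ _ x y] by (auto simp: Field_def)
    moreover have "Field (h \<union> h\<inverse>) = Field h" for h :: "('a \<times> 'a) set" by (auto simp: Field_def)
    ultimately have "gdist G u v \<le> R"
      using R[OF component hyperplane_mem[OF xy(1)], of u v] xy gdist_Restr[OF subset_refl] G_X[OF xy(1)]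
      unfolding Hyp_decomp[OF xy(1)] by metis
    then show ?thesis unfolding gdist_d by linarith
  qed
  then show ?thesis by blast
qed

end

subsection \<open>The spanning tree of a coloured median graph\<close>

text \<open>\<open>c\<close> colours hyperplanes through their edges, and the order of the reals,
  pulled back along \<open>e\<close>, selects representatives. Measurability is kept out: this part
  is combinatorial.\<close>

locale coloured_median_graphing = median_graphing +
  fixes c :: "'a \<Rightarrow> 'a \<Rightarrow> nat" and e :: "'a \<Rightarrow> real"
  assumes c_Hyp: "(x, y) \<in> G \<Longrightarrow> (u, v) \<in> Hyp x y \<Longrightarrow> c u v = c x y"
    and c_cross: "(x, y) \<in> G \<Longrightarrow> (u, v) \<in> G \<Longrightarrow> (x, u) \<in> E \<Longrightarrow> cross x y u v \<Longrightarrow> c x y \<noteq> c u v"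
    and fin: "(x, y) \<in> G \<Longrightarrow> finite (Hyp x y)"
    and inj_e: "inj_on e X"
begin

text \<open>This is \<open>n\<close>-equivalence of vertices.\<close>

definition below :: "nat \<Rightarrow> 'a \<Rightarrow> 'a \<Rightarrow> bool" where
  "below n x x' \<longleftrightarrow> (x, x') \<in> E \<and> (\<forall>u v. (u, v) \<in> G \<longrightarrow> (x, u) \<in> E \<longrightarrow> sep u v x x' \<longrightarrow> c u v < n)"

text \<open>Equality of half-spaces, rather than of hyperplanes, fixes the orientation, so that
  \<open>x\<close> and \<open>x'\<close> are on the same side.\<close>

definition equivalent :: "'a \<Rightarrow> 'a \<Rightarrow> 'a \<Rightarrow> 'a \<Rightarrow> bool" where
  "equivalent x y x' y' \<longleftrightarrow> (x', y') \<in> G \<and> hs x' y' = hs x y \<and> below (c x y) x x'"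

text \<open>Distinct edges of a hyperplane are disjoint, so comparing smaller endpoints
  selects exactly one edge from each class, independently of orientation.\<close>

definition T :: "('a \<times> 'a) set" where
  "T = {(x, y). (x, y) \<in> G \<and> (\<forall>x' y'. equivalent x y x' y' \<longrightarrow> min (e x) (e y) \<le> min (e x') (e y'))}"

lemma below_refl: "x \<in> X \<Longrightarrow> below n x x"
  by (simp add: below_def sep_def E_refl)

lemma below_sym: "below n x x' \<Longrightarrow> below n x' x"
  unfolding below_def using sep_commute E_sym E_trans by blast

lemma below_trans: "below n x y \<Longrightarrow> below n y z \<Longrightarrow> below n x z"
  unfolding below_def using sep_trans[of _ _ x z y] E_sym E_trans by blast

text \<open>A hyperplane separating \<open>y\<close> from \<open>y'\<close> is not that of the two
  edges, which has both on one side. So it separates the ends of neither edge and must separate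
  \<open>x\<close> from \<open>x'\<close>.\<close>

lemma below_transport:
  assumes xy: "(x, y) \<in> G" and xy': "(x', y') \<in> G" and hs: "hs x' y' = hs x y" and b: "below n x x'"
  shows "below n y y'"
  unfolding below_def
proof (intro conjI allI impI)
  have E: "(x, y) \<in> E" "(x, x') \<in> E" "(x, y') \<in> E"
    using G_E[OF xy] b E_trans[OF _ G_E[OF xy']] by (auto simp: below_def)
  show "(y, y') \<in> E" using E_trans[OF E_sym[OF E(1)] E(3)] .
  fix u v assume uv: "(u, v) \<in> G" "(y, u) \<in> E" "sep u v y y'"
  have xu: "(x, u) \<in> E" using E_trans[OF E(1) uv(2)] .
  show "c u v < n"
  proof (cases "(u, v) \<in> Hyp x y")
    case True
    then have "sep x y y y'" using Hyp_sep_eq[OF xy True E(1,3)] uv(3) by simp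
    then show ?thesis using hs_self[OF xy] hs_self[OF xy'] hs by (simp add: sep_def)
  next
    case False
    have "(x', y') \<in> Hyp x y" by (rule hs_Hyp[OF xy xy' hs])
    then have "Hyp x' y' = Hyp x y" by (rule Hyp_eq[OF xy])
    then have "(x, y) \<notin> Hyp u v" "(x', y') \<notin> Hyp u v" using Hyp_commute[OF uv(1)] False by blast+
    then have "\<not> sep u v x y" "\<not> sep u v x' y'"
      using xy xy' E_sym[OF xu] E_trans[OF E_sym[OF xu] E(2)] by (auto simp: Hyp_def)
    then have "sep u v x x'" using uv(3) by (auto simp: sep_def)
    then show ?thesis using b uv(1) xu by (simp add: below_def)
  qed
qed

lemma equivalent_c: "(x, y) \<in> G \<Longrightarrow> equivalent x y x' y' \<Longrightarrow> c x' y' = c x y"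
  using c_Hyp[of x y x' y'] hs_Hyp[of x y x' y'] by (simp add: equivalent_def)

lemma equivalent_refl: "(x, y) \<in> G \<Longrightarrow> equivalent x y x y"
  using G_X by (simp add: equivalent_def below_refl)

lemma equivalent_sym: "(x, y) \<in> G \<Longrightarrow> equivalent x y x' y' \<Longrightarrow> equivalent x' y' x y"
  using equivalent_c[of x y x' y'] by (simp add: equivalent_def below_sym)

lemma equivalent_trans:
  "(x, y) \<in> G \<Longrightarrow> equivalent x y x' y' \<Longrightarrow> equivalent x' y' x'' y'' \<Longrightarrow> equivalent x y x'' y''"
  using equivalent_c[of x y x' y'] by (auto simp: equivalent_def intro: below_trans)

lemma equivalent_swap:
  assumes "(x, y) \<in> G" "equivalent x y x' y'" shows "equivalent y x y' x'"
proof -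
  have xy': "(x', y') \<in> G" "hs x' y' = hs x y" "below (c x y) x x'" using assms by (auto simp: equivalent_def)
  have "E `` {x'} = E `` {x}" using E_class xy'(3) by (simp add: below_def)
  then have "hs y' x' = hs y x" using hs_compl[OF assms(1)] hs_compl[OF xy'(1)] xy'(2) by simp
  moreover have "c y x = c x y" using c_Hyp[OF assms(1) Hyp_sym[OF Hyp_self[OF assms(1)]]] .
  ultimately show ?thesis
    using below_transport[OF assms(1) xy'] G_sym[OF xy'(1)] by (simp add: equivalent_def)
qed

section \<open>One representative for each class of edges\<close>

lemma T_G: "T \<subseteq> G"
  by (auto simp: T_def)

lemma T_sym: "(x, y) \<in> T \<Longrightarrow> (y, x) \<in> T"
proof -
  assume xy: "(x, y) \<in> T"
  then have G: "(x, y) \<in> G" using T_G by blast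
  have "min (e y) (e x) \<le> min (e x') (e y')" if "equivalent y x x' y'" for x' y'
    using equivalent_swap[OF G_sym[OF G] that] xy by (auto simp: T_def min.commute)
  then show "(y, x) \<in> T" using G_sym[OF G] by (simp add: T_def)
qed

lemma T_exists:
  assumes "(x, y) \<in> G" shows "\<exists>x' y'. (x', y') \<in> T \<and> equivalent x y x' y'"
proof -
  define S where "S = {(x', y'). equivalent x y x' y'}"
  define key where "key = (\<lambda>(x, y). min (e x) (e y))"
  have "S \<subseteq> Hyp x y" using hs_Hyp[OF assms] by (auto simp: S_def equivalent_def)
  then have "finite S" using fin[OF assms] finite_subset by blast
  moreover have "S \<noteq> {}" using equivalent_refl[OF assms] by (auto simp: S_def)
  ultimately have "Min (key ` S) \<in> key ` S" "\<forall>p\<in>S. Min (key ` S) \<le> key p" by auto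
  then obtain x' y' where p: "(x', y') \<in> S" "\<And>p. p \<in> S \<Longrightarrow> key (x', y') \<le> key p" by auto
  then have eq: "equivalent x y x' y'" by (simp add: S_def)
  have "min (e x') (e y') \<le> min (e x'') (e y'')" if "equivalent x' y' x'' y''" for x'' y''
    using p(2)[of "(x'', y'')"] equivalent_trans[OF assms eq that] by (simp add: S_def key_def)
  moreover have "(x', y') \<in> G" using eq by (simp add: equivalent_def)
  ultimately have "(x', y') \<in> T" unfolding T_def mem_Collect_eq split_conv by blast
  with eq show ?thesis by blast
qed

text \<open>Equal minima give a common endpoint because \<open>e\<close> is injective. It is on the
  same side for both edges, and a hyperplane is a matching, so the edges agree.\<close>

lemma T_unique:
  assumes "(x, y) \<in> T" "(x', y') \<in> T" "equivalent x y x' y'" shows "x = x' \<and> y = y'"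
proof -
  have G: "(x, y) \<in> G" "(x', y') \<in> G" using assms T_G by auto
  have hs: "hs x' y' = hs x y" using assms(3) by (simp add: equivalent_def)
  have swap: "hs y x = hs y' x'" using equivalent_swap[OF G(1) assms(3)] by (simp add: equivalent_def)
  have "min (e x) (e y) = min (e x') (e y')"
    using assms equivalent_sym[OF G(1) assms(3)] by (intro antisym) (auto simp: T_def)
  then have "e x = e x' \<or> e x = e y' \<or> e y = e x' \<or> e y = e y'" by (auto simp: min_def split: if_splits)
  then have "x = x' \<or> x = y' \<or> y = x' \<or> y = y'" using inj_e G_X[OF G(1)] G_X[OF G(2)] by (auto dest: inj_onD)
  moreover have "x \<noteq> y'" "y \<noteq> x'" using hs_self[OF G(1)] hs_self[OF G(2)] hs by auto
  moreover have "y = y'" if "x = x'" using hs_matching[OF G(1)] G(2) hs that by simp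
  moreover have "x = x'" if "y = y'" using hs_matching[OF G_sym[OF G(1)]] G_sym[OF G(2)] swap that by simp
  ultimately show ?thesis by blast
qed

text \<open>The edges of a geodesic lie in hyperplanes separating its ends, so their colours are
  less than \<open>n\<close>. The relation \<open>Q\<close> is left open: it will be reachability in
  \<open>T\<close> and also reachability by short \<open>T\<close>-walks.\<close>

lemma below_path:
  assumes "below n x x'" and Q: "\<And>u v. (u, v) \<in> G \<Longrightarrow> c u v < n \<Longrightarrow> (u, v) \<in> Q"
  shows "(x, x') \<in> Q ^^ d x x'"
proof -
  have E: "(x, x') \<in> E" using assms by (simp add: below_def)
  obtain p where p: "p 0 = x" "p (d x x') = x'" "\<And>i. i < d x x' \<Longrightarrow> (p i, p (Suc i)) \<in> G"
    "\<And>i. i < d x x' \<Longrightarrow> sep (p i) (p (Suc i)) x x'" "\<And>i. i \<le> d x x' \<Longrightarrow> (x, p i) \<in> E \<and> d x (p i) = i \<and> btw x (p i) x'"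
    using geodesic[OF E] by metis
  have "(p i, p (Suc i)) \<in> Q" if "i < d x x'" for i
    using Q[OF p(3)[OF that]] assms(1) p(3,4)[OF that] p(5)[of i] that by (simp add: below_def)
  then show ?thesis unfolding relpow_fun_conv using p(1,2) by (intro exI[of _ p]) auto
qed

lemma G_rtrancl_T:
  assumes "(x, y) \<in> G" shows "(x, y) \<in> T\<^sup>*"
  using assms
proof (induction "c x y" arbitrary: x y rule: less_induct)
  case less
  note xy = less.prems
  obtain x' y' where T: "(x', y') \<in> T" and eq: "equivalent x y x' y'" using T_exists[OF xy] by blast
  have Q: "(u, v) \<in> T\<^sup>*" if "(u, v) \<in> G" "c u v < c x y" for u v using less.hyps that by blast
  have bx: "below (c x y) x x'" using eq by (simp add: equivalent_def)
  have "below (c y x) y y'" using equivalent_swap[OF xy eq] by (simp add: equivalent_def)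
  then have yb: "below (c x y) y' y" using c_Hyp[OF xy Hyp_sym[OF Hyp_self[OF xy]]] below_sym by simp
  have "(x, x') \<in> T\<^sup>*" "(y', y) \<in> T\<^sup>*"
    using relpow_imp_rtrancl[OF below_path[OF bx Q]] relpow_imp_rtrancl[OF below_path[OF yb Q]] by simp_all
  then show ?case using T by (meson rtrancl.rtrancl_into_rtrancl rtrancl_trans)
qed

lemma relpow_bounded:
  fixes R :: "('b \<times> 'b) set"
  assumes "(x, y) \<in> {(x, y). \<exists>i\<le>L. (x, y) \<in> R ^^ i} ^^ m" shows "\<exists>i\<le>L * m. (x, y) \<in> R ^^ i"
  using assms
proof (induction m arbitrary: y)
  case (Suc m)
  then obtain z where z: "(x, z) \<in> {(x, y). \<exists>i\<le>L. (x, y) \<in> R ^^ i} ^^ m" "(z, y) \<in> {(x, y). \<exists>i\<le>L. (x, y) \<in> R ^^ i}"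
    by (meson relpow_Suc_E)
  then obtain i j where "i \<le> L * m" "(x, z) \<in> R ^^ i" "j \<le> L" "(z, y) \<in> R ^^ j" using Suc.IH by blast
  then have "(x, y) \<in> R ^^ (i + j)" "i + j \<le> L * Suc m" by (auto simp: relpow_add)
  then show ?case by blast
qed simp

lemma T_bounded:
  assumes R: "\<And>x y u v. (x, y) \<in> G \<Longrightarrow> u \<in> Field (Hyp x y) \<Longrightarrow> v \<in> Field (Hyp x y) \<Longrightarrow> d u v \<le> R"
  shows "\<exists>L. \<forall>x y. (x, y) \<in> G \<longrightarrow> c x y < n \<longrightarrow> (\<exists>i\<le>L. (x, y) \<in> T ^^ i)"
proof (induction n)
  case (Suc n)
  then obtain L where L: "\<And>x y. (x, y) \<in> G \<Longrightarrow> c x y < n \<Longrightarrow> \<exists>i\<le>L. (x, y) \<in> T ^^ i" by blast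
  have short: "\<exists>i\<le>L * R. (z, z') \<in> T ^^ i" if "below n z z'" "d z z' \<le> R" for z z'
  proof -
    have "(z, z') \<in> {(x, y). \<exists>i\<le>L. (x, y) \<in> T ^^ i} ^^ d z z'"
    proof (rule below_path[OF that(1)])
      fix u v assume "(u, v) \<in> G" "c u v < n"
      then show "(u, v) \<in> {(x, y). \<exists>i\<le>L. (x, y) \<in> T ^^ i}" using L[of u v] by simp
    qed
    from relpow_bounded[OF this] obtain i where "i \<le> L * d z z'" "(z, z') \<in> T ^^ i" by blast
    moreover have "L * d z z' \<le> L * R" using that(2) by simp
    ultimately show ?thesis by (meson le_trans)
  qed
  \<comment> \<open>Two detours of at most \<open>R\<close> edges, each edge costing at most
    \<open>L\<close>, plus the representative itself; the summand \<open>L\<close> covers the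
    smaller colours.\<close>
  have "\<exists>i\<le>L + 2 * (L * R) + 1. (x, y) \<in> T ^^ i" if xy: "(x, y) \<in> G" and c: "c x y < Suc n" for x y
  proof (cases "c x y < n")
    case True
    then show ?thesis using L[OF xy True] by (meson le_add1 le_trans)
  next
    case False
    then have n: "c x y = n" using c by simp
    obtain x' y' where T: "(x', y') \<in> T" and eq: "equivalent x y x' y'" using T_exists[OF xy] by blast
    have bx: "below n x x'" using eq n by (simp add: equivalent_def)
    have "below (c y x) y y'" using equivalent_swap[OF xy eq] by (simp add: equivalent_def)
    then have yb: "below n y' y" using c_Hyp[OF xy Hyp_sym[OF Hyp_self[OF xy]]] below_sym n by simp
    have "(x', y') \<in> Hyp x y" using hs_Hyp[OF xy] eq by (simp add: equivalent_def)
    then have F: "x \<in> Field (Hyp x y)" "y \<in> Field (Hyp x y)" "x' \<in> Field (Hyp x y)" "y' \<in> Field (Hyp x y)"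
      using Hyp_self[OF xy] by (auto simp: Field_def)
    obtain i where i: "i \<le> L * R" "(x, x') \<in> T ^^ i" using short[OF bx R[OF xy F(1,3)]] by blast
    obtain j where j: "j \<le> L * R" "(y', y) \<in> T ^^ j" using short[OF yb R[OF xy F(4,2)]] by blast
    have "(x, y') \<in> T ^^ Suc i" using i(2) T by auto
    then have "(x, y) \<in> T ^^ (Suc i + j)" using j(2) unfolding relpow_add by blast
    moreover have "Suc i + j \<le> L + 2 * (L * R) + 1" using i(1) j(1) by simp
    ultimately show ?thesis by blast
  qed
  then show ?case by blast
qed simp

section \<open>Cycles and their maximal colour\<close>

lemma acyclic_T: "acyclic_graph T"
  unfolding acyclic_graph_def
proof
  assume "\<exists>xs. length xs \<ge> 3 \<and> distinct xs \<and> successively (\<lambda>x y. (x, y) \<in> T) xs \<and> (last xs, hd xs) \<in> T"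
  then obtain xs where xs: "length xs \<ge> 3" "distinct xs" "successively (\<lambda>x y. (x, y) \<in> T) xs" "(last xs, hd xs) \<in> T" by blast
  define m where "m = length xs"
  have m: "m \<ge> 3" using xs(1) m_def by simp
  \<comment> \<open>Reading indices modulo \<open>m\<close> lets arcs of the cycle wrap
    around.\<close>
  define w where "w i = xs ! (i mod m)" for i
  have w_inj: "w i = w j \<longleftrightarrow> i mod m = j mod m" for i j
    unfolding w_def using nth_eq_iff_index_eq[OF xs(2), of "i mod m" "j mod m", folded m_def] m by simp
  have wT: "(w i, w (Suc i)) \<in> T" for i
  proof (cases "Suc (i mod m) < m")
    case True
    then have "Suc i mod m = Suc (i mod m)" using mod_Suc[of i m] by simp
    then show ?thesis using xs(3) True unfolding successively_conv_nth w_def m_def by simp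
  next
    case False
    have "i mod m < m" using m by simp
    then have *: "Suc (i mod m) = m" using False by linarith
    then have "i mod m = m - 1" "Suc i mod m = 0" using mod_Suc[of i m] by (linarith, simp)
    moreover have "xs \<noteq> []" using xs(1) by auto
    ultimately show ?thesis using xs(4) by (simp add: w_def last_conv_nth hd_conv_nth m_def)
  qed
  then have wG: "(w i, w (Suc i)) \<in> G" for i using T_G by blast
  have wE: "(w i, w (i + k)) \<in> E" for i k
  proof (induction k)
    case 0 then show ?case using E_refl G_X[OF wG[of i]] by simp
  next
    case (Suc k) then show ?case using E_trans[OF _ G_E[OF wG[of "i + k"]]] by simp
  qed
  define n where "n = Max ((\<lambda>i. c (w i) (w (Suc i))) ` {..<m})"
  have cn: "c (w i) (w (Suc i)) \<le> n" for i
  proof -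
    have "w i = w (i mod m)" "w (Suc i) = w (Suc (i mod m))" by (simp_all add: w_inj mod_Suc_eq)
    moreover have "c (w (i mod m)) (w (Suc (i mod m))) \<le> n"
      unfolding n_def using m by (intro Max_ge) auto
    ultimately show ?thesis by simp
  qed
  have "n \<in> (\<lambda>i. c (w i) (w (Suc i))) ` {..<m}"
    unfolding n_def using m by (intro Max_in) (auto simp: lessThan_empty_iff)
  then obtain i0 where i0: "c (w i0) (w (Suc i0)) = n" by auto
  \<comment> \<open>\<delta> is the length of an arc from an edge of maximal colour to another edge
    of its hyperplane; the arc to study is a shortest one.\<close>
  define P where "P \<delta> \<longleftrightarrow> 0 < \<delta> \<and> \<delta> < m \<and>
    (\<exists>i. c (w i) (w (Suc i)) = n \<and> (w (i + \<delta>), w (Suc (i + \<delta>))) \<in> Hyp (w i) (w (Suc i)))" for \<delta>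
  \<comment> \<open>The hyperplane of edge \<open>i0\<close> separates its ends, and the other
    \<open>m - 1\<close> edges also join them, so one of these crosses it again.\<close>
  have "\<exists>\<delta>. P \<delta>"
  proof -
    have "w (Suc i0 + (m - 1)) = w i0" using m by (simp add: w_inj)
    then have "(w (Suc i0 + 0) \<in> hs (w i0) (w (Suc i0))) \<noteq> (w (Suc i0 + (m - 1)) \<in> hs (w i0) (w (Suc i0)))"
      using hs_self[OF wG[of i0]] by simp
    then have "\<exists>k<m - 1. (w (Suc i0 + k) \<in> hs (w i0) (w (Suc i0))) \<noteq> (w (Suc i0 + Suc k) \<in> hs (w i0) (w (Suc i0)))"
      by (rule path_crossing[of "\<lambda>z. z \<in> hs (w i0) (w (Suc i0))" "\<lambda>k. w (Suc i0 + k)"])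
    then obtain k where k: "k < m - 1" "sep (w i0) (w (Suc i0)) (w (Suc i0 + k)) (w (Suc i0 + Suc k))"
      unfolding sep_def by blast
    then have "(w (i0 + Suc k), w (Suc (i0 + Suc k))) \<in> Hyp (w i0) (w (Suc i0))"
      using wG wE[of i0 "Suc k"] by (simp add: Hyp_def)
    then have "P (Suc k)" using k(1) i0 by (auto simp: P_def)
    then show ?thesis by blast
  qed
  define \<delta> where "\<delta> = (LEAST \<delta>. P \<delta>)"
  have "P \<delta>" unfolding \<delta>_def using \<open>\<exists>\<delta>. P \<delta>\<close> by (rule LeastI_ex)
  have least: "\<not> P k" if "k < \<delta>" for k using that not_less_Least unfolding \<delta>_def by blast
  obtain i where \<delta>: "0 < \<delta>" "\<delta> < m" and ci: "c (w i) (w (Suc i)) = n"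
    and H: "(w (i + \<delta>), w (Suc (i + \<delta>))) \<in> Hyp (w i) (w (Suc i))"
    using \<open>P \<delta>\<close> unfolding P_def by blast
  define x y a b where "x = w i" and "y = w (Suc i)" and "a = w (i + \<delta>)" and "b = w (Suc (i + \<delta>))"
  have xy: "(x, y) \<in> G" "(x, y) \<in> T" and ab: "(a, b) \<in> G" "(a, b) \<in> T" using wG wT by (auto simp: x_def y_def a_def b_def)
  have Hab: "(a, b) \<in> Hyp x y" using H by (simp add: a_def b_def x_def y_def)
  have E: "(x, y) \<in> E" "(x, a) \<in> E" "(x, b) \<in> E"
    using G_E[OF xy(1)] Hyp_E[OF Hab] by auto
  have between: "(w (i + k), w (Suc (i + k))) \<notin> Hyp x y" if "0 < k" "k < \<delta>" for k
    using least[OF that(2)] that \<delta> ci by (auto simp: P_def x_def y_def)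
  have inner: "\<exists>k. 0 < k \<and> k < \<delta> \<and> sep u v (w (i + k)) (w (Suc (i + k)))" if "sep u v y a" for u v
  proof -
    have "(w (Suc i + 0) \<in> hs u v) \<noteq> (w (Suc i + (\<delta> - 1)) \<in> hs u v)"
      using that \<delta>(1) by (simp add: sep_def y_def a_def)
    then have "\<exists>k<\<delta> - 1. (w (Suc i + k) \<in> hs u v) \<noteq> (w (Suc i + Suc k) \<in> hs u v)"
      by (rule path_crossing[of "\<lambda>z. z \<in> hs u v" "\<lambda>k. w (Suc i + k)"])
    then obtain k where "k < \<delta> - 1" "sep u v (w (Suc i + k)) (w (Suc i + Suc k))" unfolding sep_def by blast
    then show ?thesis by (intro exI[of _ "Suc k"]) auto
  qed
  \<comment> \<open>No edge strictly between lies in the hyperplane, so \<open>y\<close> and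
    \<open>a\<close> are on one side and the second edge is traversed in the opposite direction, as
    \<open>hs b a = hs x y\<close> records.\<close>
  have "\<not> sep x y y a"
  proof
    assume "sep x y y a"
    then obtain k where k: "0 < k" "k < \<delta>" "sep x y (w (i + k)) (w (Suc (i + k)))" using inner by blast
    then have "(w (i + k), w (Suc (i + k))) \<in> Hyp x y" using wG wE[of i k] by (simp add: Hyp_def x_def)
    then show False using between k by blast
  qed
  then have aH: "a \<in> hs x y" using hs_self[OF xy(1)] by (simp add: sep_def)
  then have bH: "b \<notin> hs x y" using Hab by (simp add: Hyp_def sep_def)
  have hs: "hs b a = hs x y" by (rule hs_unique[OF xy(1) G_sym[OF ab(1)] E(3) bH aH])
  \<comment> \<open>A hyperplane separating \<open>y\<close> from \<open>a\<close> contains an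
    intermediate edge, so it differs from that of \<open>(x, y)\<close> and separates neither
    \<open>x\<close> from \<open>y\<close> nor \<open>a\<close> from \<open>b\<close>. The four
    points then occupy the four quadrants: the hyperplanes cross, and its colour is not
    \<open>n\<close>.\<close>
  have "below n y a"
    unfolding below_def
  proof (intro conjI allI impI)
    show "(y, a) \<in> E" using E_trans[OF E_sym[OF E(1)] E(2)] .
    fix u v assume uv: "(u, v) \<in> G" "(y, u) \<in> E" "sep u v y a"
    obtain k where k: "0 < k" "k < \<delta>" "sep u v (w (i + k)) (w (Suc (i + k)))" using inner[OF uv(3)] by blast
    define p q where "p = w (i + k)" and "q = w (Suc (i + k))"
    have pq: "(p, q) \<in> G" using wG by (simp add: p_def q_def)
    have xp: "(x, p) \<in> E" using wE[of i k] by (simp add: x_def p_def)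
    have xu: "(x, u) \<in> E" using E_trans[OF E(1) uv(2)] .
    have pqH: "(p, q) \<in> Hyp u v" using k(3) pq E_trans[OF E_sym[OF xu] xp] by (simp add: Hyp_def p_def q_def)
    have cpq: "c u v = c p q" using c_Hyp[OF uv(1) pqH] by simp
    have sep: "sep p q y a"
      using Hyp_sep_eq[OF uv(1) pqH] uv(3) E_sym[OF uv(2)] E_trans[OF E_sym[OF xu] E(2)] by blast
    have npq: "(p, q) \<notin> Hyp x y" using between[OF k(1,2)] by (simp add: p_def q_def)
    have "\<not> sep p q x y"
    proof
      assume "sep p q x y"
      then have "(x, y) \<in> Hyp p q" using xy(1) E_sym[OF xp] by (simp add: Hyp_def)
      then show False using Hyp_commute[OF pq] npq by blast
    qed
    moreover have "\<not> sep p q a b"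
    proof
      assume "sep p q a b"
      then have "(a, b) \<in> Hyp p q" using ab(1) E_trans[OF E_sym[OF xp] E(2)] by (simp add: Hyp_def)
      then have "(p, q) \<in> Hyp a b" by (rule Hyp_commute[OF pq])
      then show False using Hyp_eq[OF xy(1) Hab] npq by blast
    qed
    ultimately have "cross x y p q"
      using sep hs_self[OF xy(1)] aH bH E E_refl[of x] G_X[OF xy(1)] unfolding cross_def sep_def by (cases "y \<in> hs p q") blast+
    then have "c x y \<noteq> c p q" by (rule c_cross[OF xy(1) pq xp])
    moreover have "c p q \<le> n" using cn by (simp add: p_def q_def)
    ultimately show "c u v < n" using cpq ci by (simp add: x_def y_def)
  qed
  moreover have "hs y x = hs a b"
    using hs_compl[OF xy(1)] hs_compl[OF G_sym[OF ab(1)]] hs E_class[OF E(3)] by simp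
  ultimately have "below n x b"
    using below_transport[OF G_sym[OF xy(1)] ab(1)] by simp
  then have "equivalent x y b a" using G_sym[OF ab(1)] hs ci by (simp add: equivalent_def x_def y_def)
  \<comment> \<open>The two edges coincide with opposite orientations: \<open>y = a\<close> forces
    \<delta> to be 1, and then \<open>x = b\<close> makes \<open>m\<close> divide 2.\<close>
  then have eq: "x = b" "y = a" using T_unique[OF xy(2) T_sym[OF ab(2)]] by auto
  have "Suc i mod m = (i + \<delta>) mod m" using eq(2) w_inj by (simp add: y_def a_def)
  then have "\<delta> = 1"
  proof -
    have "m dvd (i + \<delta>) - Suc i" using \<open>Suc i mod m = (i + \<delta>) mod m\<close> mod_eq_dvd_iff_nat[of "Suc i" "i + \<delta>" m] \<delta> by simp
    then have "m dvd \<delta> - 1" by simp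
    then show ?thesis using \<delta> by (auto dest: dvd_imp_le)
  qed
  then have "i mod m = Suc (Suc i) mod m" using eq(1) w_inj by (simp add: x_def b_def)
  then have "m dvd 2" using mod_eq_dvd_iff_nat[of i "Suc (Suc i)" m] by simp
  then show False using m by (auto dest: dvd_imp_le)
qed

end

subsection \<open>Borel colourings of hyperplanes\<close>

context median_graphing
begin

section \<open>Hyperplanes crossing a given one\<close>

definition crossing :: "'a \<Rightarrow> 'a \<Rightarrow> ('a \<times> 'a) set" where
  "crossing x y = {(u, v). (u, v) \<in> G \<and> (x, u) \<in> E \<and> cross x y u v}"

lemma crossing_Hyp:
  assumes "(x, y) \<in> G" "(x', y') \<in> Hyp x y" shows "crossing x' y' = crossing x y"
proof -
  have sub: "crossing x y \<subseteq> crossing x' y'" if xy: "(x, y) \<in> G" "(x', y') \<in> Hyp x y" for x y x' y'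
  proof clarify
    fix u v assume "(u, v) \<in> crossing x y"
    then have uv: "(u, v) \<in> G" "(x, u) \<in> E" "cross x y u v" by (auto simp: crossing_def)
    have "(x', u) \<in> E" using Hyp_E[OF xy(2)] E_trans[OF E_sym uv(2)] by blast
    then show "(u, v) \<in> crossing x' y'"
      using cross_Hyp[OF xy(1) uv(1,2) xy(2) Hyp_self[OF uv(1)] uv(3)] uv(1) by (simp add: crossing_def)
  qed
  show ?thesis using sub[OF assms] sub[OF _ Hyp_commute[OF assms]] Hyp_E[OF assms(2)] by blast
qed

lemma crossing_closed:
  assumes "(x, y) \<in> G" "(u, v) \<in> crossing x y" "(u', v') \<in> Hyp u v" shows "(u', v') \<in> crossing x y"
proof -
  have uv: "(u, v) \<in> G" "(x, u) \<in> E" "cross x y u v" using assms(2) by (auto simp: crossing_def)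
  have "(u, u') \<in> E" "(u', v') \<in> G" using Hyp_E[OF assms(3)] by auto
  then show ?thesis
    using cross_Hyp[OF assms(1) uv(1,2) Hyp_self[OF assms(1)] assms(3) uv(3)] E_trans[OF uv(2)] by (simp add: crossing_def)
qed

lemma crossing_sym: "(x, y) \<in> G \<Longrightarrow> (u, v) \<in> crossing x y \<Longrightarrow> (x, y) \<in> crossing u v"
  using cross_sym E_sym by (auto simp: crossing_def)

lemma not_crossing_self: "(x, y) \<notin> crossing x y"
  by (auto simp: crossing_def cross_def)

text \<open>The order of the quantifiers matters: one geodesic, with finitely many edges, meets
  every hyperplane separating \<open>p\<close> from \<open>q\<close>.\<close>

lemma separating_path:
  assumes "(p, q) \<in> E"
  shows "\<exists>f. \<forall>u v. sep u v p q \<longrightarrow> (\<exists>i<d p q. (f i, f (Suc i)) \<in> G \<and> (p, f i) \<in> E \<and> d p (f i) = i \<and> sep u v (f i) (f (Suc i)))"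
proof -
  obtain f where f: "f 0 = p" "f (d p q) = q" "\<And>i. i < d p q \<Longrightarrow> (f i, f (Suc i)) \<in> G"
    "\<And>i. i \<le> d p q \<Longrightarrow> (p, f i) \<in> E \<and> d p (f i) = i \<and> btw p (f i) q" using geodesic[OF assms] by metis
  have "\<exists>i<d p q. (f i, f (Suc i)) \<in> G \<and> (p, f i) \<in> E \<and> d p (f i) = i \<and> sep u v (f i) (f (Suc i))" if "sep u v p q" for u v
  proof -
    have "(f 0 \<in> hs u v) \<noteq> (f (d p q) \<in> hs u v)" using that f(1,2) by (simp add: sep_def)
    then have "\<exists>i<d p q. (f i \<in> hs u v) \<noteq> (f (Suc i) \<in> hs u v)"
      by (rule path_crossing[of "\<lambda>z. z \<in> hs u v"])
    then show ?thesis using f(3,4) by (auto simp: sep_def)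
  qed
  then show ?thesis by blast
qed

lemma crossing_separates:
  assumes "(x, y) \<in> G" "(u, v) \<in> crossing x y"
  shows "\<exists>p\<in>Field (Hyp x y). \<exists>q\<in>Field (Hyp x y). sep u v p q"
  using cross_edges[of x y u v] assms unfolding crossing_def Field_def by blast

lemma Field_Hyp_E: "p \<in> Field (Hyp x y) \<Longrightarrow> (x, p) \<in> E"
  using Hyp_E by (auto simp: Field_def)

lemma sep_Hyp:
  assumes "(u, v) \<in> G" "(r, s) \<in> G" "(u, r) \<in> E" "sep u v r s" shows "(u, v) \<in> Hyp r s"
  using Hyp_commute[OF assms(1), of r s] assms(2-4) by (simp add: Hyp_def)

text \<open>A crossing hyperplane separates two points of the finite set
  \<open>Field (Hyp x y)\<close>, hence contains an edge of a geodesic chosen between them. These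
  geodesics have finitely many edges, each in a finite hyperplane.\<close>

lemma finite_crossing:
  assumes fin: "\<And>x y. (x, y) \<in> G \<Longrightarrow> finite (Hyp x y)" and xy: "(x, y) \<in> G"
  shows "finite (crossing x y)"
proof -
  let ?F = "Field (Hyp x y)"
  have "\<exists>f. \<forall>u v. sep u v p q \<longrightarrow> (\<exists>i<d p q. (f i, f (Suc i)) \<in> G \<and> (p, f i) \<in> E \<and> d p (f i) = i \<and> sep u v (f i) (f (Suc i)))"
    if "p \<in> ?F" "q \<in> ?F" for p q
    using separating_path[OF E_trans[OF E_sym[OF Field_Hyp_E[OF that(1)]] Field_Hyp_E[OF that(2)]]] .
  then obtain f where f: "\<And>p q u v. p \<in> ?F \<Longrightarrow> q \<in> ?F \<Longrightarrow> sep u v p q \<Longrightarrow>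
      \<exists>i<d p q. (f p q i, f p q (Suc i)) \<in> G \<and> (p, f p q i) \<in> E \<and> d p (f p q i) = i \<and> sep u v (f p q i) (f p q (Suc i))"
    by metis
  let ?B = "\<Union>p\<in>?F. \<Union>q\<in>?F. \<Union>i\<in>{i. i < d p q \<and> (f p q i, f p q (Suc i)) \<in> G}. Hyp (f p q i) (f p q (Suc i))"
  have "crossing x y \<subseteq> ?B"
  proof clarify
    fix u v assume uv: "(u, v) \<in> crossing x y"
    then obtain p q where pq: "p \<in> ?F" "q \<in> ?F" "sep u v p q" using crossing_separates[OF xy] by blast
    obtain i where i: "i < d p q" "(f p q i, f p q (Suc i)) \<in> G" "(p, f p q i) \<in> E" "sep u v (f p q i) (f p q (Suc i))"
      using f[OF pq] by blast
    have "(u, f p q i) \<in> E"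
      using uv E_trans[OF E_sym E_trans[OF Field_Hyp_E[OF pq(1)] i(3)]] by (simp add: crossing_def)
    then have "(u, v) \<in> Hyp (f p q i) (f p q (Suc i))" using sep_Hyp i uv by (simp add: crossing_def)
    then show "(u, v) \<in> ?B" using pq i by blast
  qed
  moreover have "finite ?B" using fin fin[OF xy] by (intro finite_UN_I finite_Field) auto
  ultimately show ?thesis using finite_subset by blast
qed

text \<open>The three summands are \<open>R\<close> within the hyperplane of \<open>(x, y)\<close>,
  at most \<open>R\<close> along the geodesic from \<open>p\<close> to \<open>r\<close>, and
  \<open>R\<close> within the hyperplane of \<open>(r, s)\<close>.\<close>

lemma crossing_near:
  assumes R: "\<And>x y u v. (x, y) \<in> G \<Longrightarrow> u \<in> Field (Hyp x y) \<Longrightarrow> v \<in> Field (Hyp x y) \<Longrightarrow> d u v \<le> R"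
    and xy: "(x, y) \<in> G" and uv: "(u, v) \<in> crossing x y"
  shows "d x u \<le> 3 * R \<and> d x v \<le> 3 * R"
proof -
  obtain p q where pq: "p \<in> Field (Hyp x y)" "q \<in> Field (Hyp x y)" "sep u v p q" using crossing_separates[OF xy uv] by blast
  have xp: "(x, p) \<in> E" and pq': "(p, q) \<in> E" using Field_Hyp_E[OF pq(1)] Field_Hyp_E[OF pq(2)] E_sym E_trans by blast+
  obtain r s where r: "d p r < d p q" "(r, s) \<in> G" "(p, r) \<in> E" "sep u v r s"
    using separating_path[OF pq'] pq(3) by metis
  have G: "(u, v) \<in> G" "(x, u) \<in> E" using uv by (auto simp: crossing_def)
  have xr: "(x, r) \<in> E" using E_trans[OF xp r(3)] .
  have "(u, v) \<in> Hyp r s" using sep_Hyp[OF G(1) r(2) E_trans[OF E_sym[OF G(2)] xr] r(4)] .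
  then have F: "u \<in> Field (Hyp r s)" "v \<in> Field (Hyp r s)" "r \<in> Field (Hyp r s)" "x \<in> Field (Hyp x y)"
    using Hyp_self[OF r(2)] Hyp_self[OF xy] by (auto simp: Field_def)
  have "d x r \<le> d x p + d p r" using d_triangle[OF xp r(3)] .
  also have "\<dots> \<le> 2 * R" using R[OF xy F(4) pq(1)] R[OF xy pq(1,2)] r(1) by simp
  finally have xr': "d x r \<le> 2 * R" .
  have "d x u \<le> d x r + d r u" "d x v \<le> d x r + d r v"
    using d_triangle[OF xr E_trans[OF E_sym[OF xr] G(2)]] d_triangle[OF xr E_trans[OF E_sym[OF xr] E_trans[OF G(2) G_E[OF G(1)]]]] .
  then show ?thesis using xr' R[OF r(2) F(3,1)] R[OF r(2) F(3,2)] by simp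
qed

lemma card_ball:
  assumes "bounded_degree X G"
  shows "\<exists>B. \<forall>x\<in>X. finite {z. (x, z) \<in> E \<and> d x z \<le> n} \<and> card {z. (x, z) \<in> E \<and> d x z \<le> n} \<le> B"
proof (induction n)
  case 0
  have "{z. (x, z) \<in> E \<and> d x z \<le> 0} \<subseteq> {x}" for x using d_eq_0 by auto
  then have "finite {z. (x, z) \<in> E \<and> d x z \<le> 0} \<and> card {z. (x, z) \<in> E \<and> d x z \<le> 0} \<le> 1" for x
    using finite_subset[of _ "{x}"] card_mono[of "{x}" "{z. (x, z) \<in> E \<and> d x z \<le> 0}"] by auto
  then show ?case by blast
next
  case (Suc n)
  then obtain B where B: "\<And>x. x \<in> X \<Longrightarrow> finite {z. (x, z) \<in> E \<and> d x z \<le> n} \<and> card {z. (x, z) \<in> E \<and> d x z \<le> n} \<le> B" by blast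
  obtain D where D: "\<And>x. x \<in> X \<Longrightarrow> finite (G `` {x}) \<and> card (G `` {x}) \<le> D" using assms unfolding bounded_degree_def by blast
  have "finite {z. (x, z) \<in> E \<and> d x z \<le> Suc n} \<and> card {z. (x, z) \<in> E \<and> d x z \<le> Suc n} \<le> B + B * D" if x: "x \<in> X" for x
  proof -
    define S where "S = {z. (x, z) \<in> E \<and> d x z \<le> n}"
    have S: "finite S" "card S \<le> B" "S \<subseteq> X" using B[OF x] E_X by (auto simp: S_def)
    have "{z. (x, z) \<in> E \<and> d x z \<le> Suc n} \<subseteq> S \<union> (\<Union>w\<in>S. G `` {w})"
    proof
      fix z assume "z \<in> {z. (x, z) \<in> E \<and> d x z \<le> Suc n}"
      then have z: "(x, z) \<in> E" "d x z \<le> Suc n" by auto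
      show "z \<in> S \<union> (\<Union>w\<in>S. G `` {w})"
      proof (cases "d x z \<le> n")
        case True then show ?thesis using z by (simp add: S_def)
      next
        case False
        then have "d z x = Suc n" using z d_commute by simp
        then obtain w where "(z, w) \<in> G" "d w x = n" using d_step[OF E_sym[OF z(1)]] by blast
        then have "w \<in> S" "(w, z) \<in> G" using E_trans[OF z(1) G_E] G_sym d_commute[of w x] by (auto simp: S_def)
        then show ?thesis by blast
      qed
    qed
    moreover have "finite (S \<union> (\<Union>w\<in>S. G `` {w}))" using S D by auto
    moreover have "card (S \<union> (\<Union>w\<in>S. G `` {w})) \<le> B + B * D"
    proof -
      have "card (\<Union>w\<in>S. G `` {w}) \<le> (\<Sum>w\<in>S. card (G `` {w}))" by (rule card_UN_le[OF S(1)])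
      also have "\<dots> \<le> card S * D" using sum_bounded_above[of S "\<lambda>w. card (G `` {w})" D] D S(3) by auto
      also have "\<dots> \<le> B * D" using S(2) by simp
      finally show ?thesis using S(2) card_Un_le[of S "\<Union>w\<in>S. G `` {w}"] by linarith
    qed
    ultimately show ?thesis using card_mono finite_subset by (meson le_trans)
  qed
  then show ?case by blast
qed

end

text \<open>Finite intersections of coordinate tests and their complements form a countable family,
  and one factor for each point of \<open>F\<close> suffices. The indices \<open>m\<close> will be
  the colours of \<open>countable_colouring\<close>.\<close>

lemma (in coded_space) separating_sets:
  "\<exists>A. (\<forall>m. A m \<in> sets (M \<Otimes>\<^sub>M M)) \<and>
     (\<forall>p F. p \<in> space M \<times> space M \<longrightarrow> finite F \<longrightarrow> F \<subseteq> space M \<times> space M \<longrightarrow> p \<notin> F \<longrightarrow> (\<exists>m::nat. p \<in> A m \<and> A m \<inter> F = {}))"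
proof -
  define B where "B q = {p \<in> space (M \<Otimes>\<^sub>M M). (if fst q then fst p \<in> V (snd (snd q)) else snd p \<in> V (snd (snd q))) = fst (snd q)}"
    for q :: "bool \<times> bool \<times> nat"
  have B: "B q \<in> sets (M \<Otimes>\<^sub>M M)" for q
    unfolding B_def by (cases "fst q"; cases "fst (snd q)") (simp_all, measurable)
  define A where "A m = {p \<in> space (M \<Otimes>\<^sub>M M). \<forall>q\<in>set (from_nat m). p \<in> B q}" for m
  have "A m \<in> sets (M \<Otimes>\<^sub>M M)" for m
    unfolding A_def using B by measurable
  moreover have "\<exists>m. p \<in> A m \<and> A m \<inter> F = {}"
    if p: "p \<in> space M \<times> space M" and F: "finite F" "F \<subseteq> space M \<times> space M" "p \<notin> F" for p F
  proof -
    have "\<exists>q. p \<in> B q \<and> f \<notin> B q" if f: "f \<in> F" for f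
    proof -
      have fs: "f \<in> space M \<times> space M" "p \<noteq> f" using f F by auto
      then have "\<exists>j. (fst p \<in> V j) \<noteq> (fst f \<in> V j) \<or> (snd p \<in> V j) \<noteq> (snd f \<in> V j)"
        using sep p unfolding separating_def by (auto simp: prod_eq_iff mem_Times_iff)
      then obtain j where "(fst p \<in> V j) \<noteq> (fst f \<in> V j) \<or> (snd p \<in> V j) \<noteq> (snd f \<in> V j)" by blast
      then have "p \<in> B (True, fst p \<in> V j, j) \<and> f \<notin> B (True, fst p \<in> V j, j) \<or>
          p \<in> B (False, snd p \<in> V j, j) \<and> f \<notin> B (False, snd p \<in> V j, j)"
        using p by (auto simp: B_def space_pair_measure)
      then show ?thesis by blast
    qed
    then obtain q where q: "\<And>f. f \<in> F \<Longrightarrow> p \<in> B (q f) \<and> f \<notin> B (q f)" by metis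
    obtain qs where qs: "set qs = q ` F" using finite_list F(1) by (metis finite_imageI)
    have "p \<in> A (to_nat qs) \<and> A (to_nat qs) \<inter> F = {}"
      using q qs p by (auto simp: A_def space_pair_measure)
    then show ?thesis by blast
  qed
  ultimately show ?thesis by blast
qed

section \<open>Measurability of the combinatorial relations\<close>

locale borel_median = borel_coded M V + median_graphing "space M" G E
  for M :: "'a measure" and V :: "nat \<Rightarrow> 'a set" and G E +
  fixes g :: "nat \<Rightarrow> 'a \<Rightarrow> 'a"
  assumes g_meas: "g n \<in> M \<rightarrow>\<^sub>M M" and g_E: "x \<in> space M \<Longrightarrow> E `` {x} = range (\<lambda>n. g n x)"
    and G_sets: "G \<in> sets (M \<Otimes>\<^sub>M M)" and E_sets: "E \<in> sets (M \<Otimes>\<^sub>M M)"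
    and fin_Hyp: "(x, y) \<in> G \<Longrightarrow> finite (Hyp x y)"
begin

lemma g_class: "x \<in> space M \<Longrightarrow> (x, g n x) \<in> E"
  using g_E by blast

lemma E_g: "(x, y) \<in> E \<Longrightarrow> \<exists>n. y = g n x"
  using g_E[of x] E_X[of x y] by blast

lemma meas_g [measurable (raw)]: "f \<in> N \<rightarrow>\<^sub>M M \<Longrightarrow> (\<lambda>w. g n (f w)) \<in> N \<rightarrow>\<^sub>M M"
  using measurable_compose[OF _ g_meas] .

lemma meas_mem:
  assumes "R \<in> sets (M \<Otimes>\<^sub>M M)" "f \<in> N \<rightarrow>\<^sub>M M" "h \<in> N \<rightarrow>\<^sub>M M"
  shows "Measurable.pred N (\<lambda>w. (f w, h w) \<in> R)"
  using assms by measurable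

lemmas meas_G [measurable (raw)] = meas_mem[OF G_sets]
lemmas meas_E [measurable (raw)] = meas_mem[OF E_sets]

text \<open>The diagonal is Borel because the tests are countable and separating.\<close>

lemma meas_eq [measurable (raw)]:
  assumes f: "f \<in> N \<rightarrow>\<^sub>M M" and h: "h \<in> N \<rightarrow>\<^sub>M M"
  shows "Measurable.pred N (\<lambda>w. f w = h w)"
proof -
  have "f w = h w \<longleftrightarrow> (\<forall>j. f w \<in> V j \<longleftrightarrow> h w \<in> V j)" if "w \<in> space N" for w
    using sep measurable_space[OF f that] measurable_space[OF h that] unfolding separating_def by auto
  moreover have "Measurable.pred N (\<lambda>w. \<forall>j. f w \<in> V j \<longleftrightarrow> h w \<in> V j)" using f h by measurable
  ultimately show ?thesis by (simp cong: measurable_cong)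
qed

lemma meas_relpow:
  assumes f: "f \<in> N \<rightarrow>\<^sub>M M" and h: "h \<in> N \<rightarrow>\<^sub>M M"
  shows "Measurable.pred N (\<lambda>w. (f w, h w) \<in> G ^^ n)"
  using h
proof (induction n arbitrary: h)
  case 0
  then show ?case using f by simp
next
  case (Suc n)
  have "(f w, h w) \<in> G ^^ Suc n \<longleftrightarrow> (\<exists>k. (f w, g k (f w)) \<in> G ^^ n \<and> (g k (f w), h w) \<in> G)" if "w \<in> space N" for w
  proof
    assume "(f w, h w) \<in> G ^^ Suc n"
    then obtain z where z: "(f w, z) \<in> G ^^ n" "(z, h w) \<in> G" by (meson relpow_Suc_E)
    then show "\<exists>k. (f w, g k (f w)) \<in> G ^^ n \<and> (g k (f w), h w) \<in> G"
      using E_g[OF relpow_E[OF z(1) measurable_space[OF f that]]] by blast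
  qed auto
  moreover have "Measurable.pred N (\<lambda>w. \<exists>k. (f w, g k (f w)) \<in> G ^^ n \<and> (g k (f w), h w) \<in> G)"
    using Suc f by measurable
  ultimately show ?case by (simp cong: measurable_cong)
qed

lemma meas_d [measurable (raw)]:
  assumes "f \<in> N \<rightarrow>\<^sub>M M" "h \<in> N \<rightarrow>\<^sub>M M"
  shows "(\<lambda>w. d (f w) (h w)) \<in> N \<rightarrow>\<^sub>M count_space UNIV"
  unfolding d_def by (rule measurable_Least) (use meas_relpow[OF assms] in simp)

lemma meas_hs [measurable (raw)]:
  assumes [measurable]: "a \<in> N \<rightarrow>\<^sub>M M" "b \<in> N \<rightarrow>\<^sub>M M" "f \<in> N \<rightarrow>\<^sub>M M"
  shows "Measurable.pred N (\<lambda>w. f w \<in> hs (a w) (b w))"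
proof -
  have [measurable]: "(\<lambda>w. d (f w) (a w)) \<in> borel_measurable N" "(\<lambda>w. d (f w) (b w)) \<in> borel_measurable N"
    by (rule measurable_compose[OF meas_d]; simp)+
  show ?thesis unfolding hs_def mem_Collect_eq by measurable
qed

lemma meas_sep [measurable (raw)]:
  assumes [measurable]: "a \<in> N \<rightarrow>\<^sub>M M" "b \<in> N \<rightarrow>\<^sub>M M" "f \<in> N \<rightarrow>\<^sub>M M" "h \<in> N \<rightarrow>\<^sub>M M"
  shows "Measurable.pred N (\<lambda>w. sep (a w) (b w) (f w) (h w))"
  unfolding sep_def by measurable

lemma meas_Hyp [measurable (raw)]:
  assumes [measurable]: "a \<in> N \<rightarrow>\<^sub>M M" "b \<in> N \<rightarrow>\<^sub>M M" "f \<in> N \<rightarrow>\<^sub>M M" "h \<in> N \<rightarrow>\<^sub>M M"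
  shows "Measurable.pred N (\<lambda>w. (f w, h w) \<in> Hyp (a w) (b w))"
  unfolding Hyp_def mem_Collect_eq split_conv by measurable

lemma ex_class:
  assumes "x \<in> space M" "\<And>a. Q a \<Longrightarrow> (x, a) \<in> E" shows "(\<exists>a. Q a) \<longleftrightarrow> (\<exists>n. Q (g n x))"
proof
  assume "\<exists>a. Q a"
  then obtain a where "Q a" by blast
  moreover obtain n where "a = g n x" using E_g[OF assms(2)[OF calculation]] by blast
  ultimately show "\<exists>n. Q (g n x)" by blast
qed blast

lemma meas_crossing [measurable (raw)]:
  assumes [measurable]: "a \<in> N \<rightarrow>\<^sub>M M" "b \<in> N \<rightarrow>\<^sub>M M" "f \<in> N \<rightarrow>\<^sub>M M" "h \<in> N \<rightarrow>\<^sub>M M"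
  shows "Measurable.pred N (\<lambda>w. (f w, h w) \<in> crossing (a w) (b w))"
proof -
  have "(u, v) \<in> crossing x y \<longleftrightarrow> (u, v) \<in> G \<and> (x, u) \<in> E \<and> (\<exists>n. g n x \<in> hs x y \<and> g n x \<in> hs u v) \<and>
      (\<exists>n. g n x \<in> hs x y \<and> g n x \<notin> hs u v) \<and> (\<exists>n. g n x \<notin> hs x y \<and> g n x \<in> hs u v) \<and>
      (\<exists>n. g n x \<notin> hs x y \<and> g n x \<notin> hs u v)" for x y u v
  proof (cases "(u, v) \<in> G \<and> (x, u) \<in> E")
    case True
    have *: "z \<in> hs x y \<Longrightarrow> (x, z) \<in> E" "z \<in> hs u v \<Longrightarrow> (x, z) \<in> E" for z
      using hs_E[of z x y] hs_E[of z u v] E_trans[of x u z] True by blast+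
    have x: "x \<in> space M" using E_X True by blast
    have 1: "(\<exists>a. a \<in> hs x y \<and> a \<in> hs u v) \<longleftrightarrow> (\<exists>n. g n x \<in> hs x y \<and> g n x \<in> hs u v)"
      by (rule ex_class[OF x]) (use * in blast)
    have 2: "(\<exists>a. a \<in> hs x y \<and> a \<notin> hs u v) \<longleftrightarrow> (\<exists>n. g n x \<in> hs x y \<and> g n x \<notin> hs u v)"
      by (rule ex_class[OF x]) (use * in blast)
    have 3: "(\<exists>a. a \<notin> hs x y \<and> a \<in> hs u v) \<longleftrightarrow> (\<exists>n. g n x \<notin> hs x y \<and> g n x \<in> hs u v)"
      by (rule ex_class[OF x]) (use * in blast)
    have 4: "(\<exists>a. (x, a) \<in> E \<and> a \<notin> hs x y \<and> a \<notin> hs u v) \<longleftrightarrow>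
        (\<exists>n. (x, g n x) \<in> E \<and> g n x \<notin> hs x y \<and> g n x \<notin> hs u v)"
      by (rule ex_class[OF x]) blast
    show ?thesis unfolding crossing_def cross_def mem_Collect_eq split_conv 1 2 3 4
      using True g_class[OF x] by simp
  qed (auto simp: crossing_def)
  then have "(\<lambda>w. (f w, h w) \<in> crossing (a w) (b w)) = (\<lambda>w. (f w, h w) \<in> G \<and> (a w, f w) \<in> E \<and>
      (\<exists>n. g n (a w) \<in> hs (a w) (b w) \<and> g n (a w) \<in> hs (f w) (h w)) \<and>
      (\<exists>n. g n (a w) \<in> hs (a w) (b w) \<and> g n (a w) \<notin> hs (f w) (h w)) \<and>
      (\<exists>n. g n (a w) \<notin> hs (a w) (b w) \<and> g n (a w) \<in> hs (f w) (h w)) \<and>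
      (\<exists>n. g n (a w) \<notin> hs (a w) (b w) \<and> g n (a w) \<notin> hs (f w) (h w)))" by simp
  moreover have "Measurable.pred N \<dots>" by measurable
  ultimately show ?thesis by simp
qed

lemma all_pairs:
  assumes "x \<in> space M" "\<And>u v. P u v \<Longrightarrow> (x, u) \<in> E \<and> (u, v) \<in> E"
  shows "(\<exists>u v. P u v) \<longleftrightarrow> (\<exists>i j. P (g i x) (g j x))"
proof
  assume "\<exists>u v. P u v"
  then obtain u v where uv: "P u v" by blast
  then have "(x, u) \<in> E" "(x, v) \<in> E" using assms(2) E_trans by blast+
  then obtain i j where "u = g i x" "v = g j x" using E_g by blast
  then show "\<exists>i j. P (g i x) (g j x)" using uv by blast
qed blast

text \<open>A proper colouring of the crossing graph of hyperplanes, written as a function of edges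
  so that measurability makes sense in the square of \<open>M\<close>.\<close>

definition proper :: "('a \<Rightarrow> 'a \<Rightarrow> nat) \<Rightarrow> bool" where
  "proper c \<longleftrightarrow> (\<lambda>p. c (fst p) (snd p)) \<in> M \<Otimes>\<^sub>M M \<rightarrow>\<^sub>M count_space UNIV \<and>
    (\<forall>x y u v. (x, y) \<in> G \<longrightarrow> (u, v) \<in> Hyp x y \<longrightarrow> c u v = c x y) \<and>
    (\<forall>x y u v. (x, y) \<in> G \<longrightarrow> (u, v) \<in> crossing x y \<longrightarrow> c u v \<noteq> c x y)"

lemma proper_meas:
  assumes "proper c" "f \<in> N \<rightarrow>\<^sub>M M" "h \<in> N \<rightarrow>\<^sub>M M" shows "(\<lambda>w. c (f w) (h w)) \<in> N \<rightarrow>\<^sub>M count_space UNIV"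
proof -
  have "(\<lambda>w. (f w, h w)) \<in> N \<rightarrow>\<^sub>M M \<Otimes>\<^sub>M M" using assms(2,3) by measurable
  from measurable_compose[OF this, of "\<lambda>p. c (fst p) (snd p)"] show ?thesis using assms(1) by (simp add: proper_def)
qed

text \<open>A hyperplane receives the least \<open>m\<close> such that \<open>A m\<close> contains one of its
  edges but no edge of a hyperplane crossing it.\<close>

theorem countable_colouring: "\<exists>c. proper c"
proof -
  obtain A where A: "\<And>m::nat. A m \<in> sets (M \<Otimes>\<^sub>M M)"
    "\<And>p F. p \<in> space M \<times> space M \<Longrightarrow> finite F \<Longrightarrow> F \<subseteq> space M \<times> space M \<Longrightarrow> p \<notin> F \<Longrightarrow> \<exists>m. p \<in> A m \<and> A m \<inter> F = {}"
    using separating_sets by metis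
  note [measurable (raw)] = meas_mem[OF A(1)]
  define Q where "Q m x y \<longleftrightarrow> (\<exists>u v. (u, v) \<in> Hyp x y \<and> (u, v) \<in> A m) \<and> \<not> (\<exists>u v. (u, v) \<in> crossing x y \<and> (u, v) \<in> A m)" for m x y
  define c where "c x y = (LEAST m. Q m x y)" for x y
  have Q_g: "Q m x y \<longleftrightarrow> (\<exists>i j. (g i x, g j x) \<in> Hyp x y \<and> (g i x, g j x) \<in> A m) \<and>
      \<not> (\<exists>i j. (g i x, g j x) \<in> crossing x y \<and> (g i x, g j x) \<in> A m)" if "x \<in> space M" for m x y
  proof -
    have 1: "(\<exists>u v. (u, v) \<in> Hyp x y \<and> (u, v) \<in> A m) \<longleftrightarrow> (\<exists>i j. (g i x, g j x) \<in> Hyp x y \<and> (g i x, g j x) \<in> A m)"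
      by (rule all_pairs[OF that]) (use Hyp_E G_E in blast)
    have 2: "(\<exists>u v. (u, v) \<in> crossing x y \<and> (u, v) \<in> A m) \<longleftrightarrow> (\<exists>i j. (g i x, g j x) \<in> crossing x y \<and> (g i x, g j x) \<in> A m)"
      by (rule all_pairs[OF that]) (use G_E in \<open>auto simp: crossing_def\<close>)
    show ?thesis unfolding Q_def 1 2 ..
  qed
  have meas: "(\<lambda>p. c (fst p) (snd p)) \<in> M \<Otimes>\<^sub>M M \<rightarrow>\<^sub>M count_space UNIV"
    unfolding c_def
  proof (rule measurable_Least)
    fix m
    have "Measurable.pred (M \<Otimes>\<^sub>M M) (\<lambda>p. (\<exists>i j. (g i (fst p), g j (fst p)) \<in> Hyp (fst p) (snd p) \<and> (g i (fst p), g j (fst p)) \<in> A m) \<and>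
      \<not> (\<exists>i j. (g i (fst p), g j (fst p)) \<in> crossing (fst p) (snd p) \<and> (g i (fst p), g j (fst p)) \<in> A m))"
      by measurable
    moreover have "Q m (fst p) (snd p) \<longleftrightarrow> (\<exists>i j. (g i (fst p), g j (fst p)) \<in> Hyp (fst p) (snd p) \<and> (g i (fst p), g j (fst p)) \<in> A m) \<and>
      \<not> (\<exists>i j. (g i (fst p), g j (fst p)) \<in> crossing (fst p) (snd p) \<and> (g i (fst p), g j (fst p)) \<in> A m)"
      if "p \<in> space (M \<Otimes>\<^sub>M M)" for p
      by (rule Q_g) (use that in \<open>auto simp: space_pair_measure\<close>)
    ultimately show "Measurable.pred (M \<Otimes>\<^sub>M M) (\<lambda>p. Q m (fst p) (snd p))"
      by (simp cong: measurable_cong)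
  qed
  have Q_c: "Q (c x y) x y" if xy: "(x, y) \<in> G" for x y
  proof -
    have "\<exists>m. (x, y) \<in> A m \<and> A m \<inter> crossing x y = {}"
    proof (rule A(2))
      show "finite (crossing x y)" by (rule finite_crossing[OF fin_Hyp xy])
      show "crossing x y \<subseteq> space M \<times> space M" using G_X by (auto simp: crossing_def)
    qed (use G_X[OF xy] not_crossing_self in auto)
    then obtain m where "(x, y) \<in> A m" "A m \<inter> crossing x y = {}" by blast
    then have "Q m x y" unfolding Q_def using Hyp_self[OF xy] by blast
    then show ?thesis unfolding c_def by (rule LeastI)
  qed
  have "c u v = c x y" if "(x, y) \<in> G" "(u, v) \<in> Hyp x y" for x y u v
    using Hyp_eq[OF that] crossing_Hyp[OF that] by (simp add: c_def Q_def)
  \<comment> \<open>If the colours agreed, the hyperplane of \<open>(u, v)\<close> would have an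
    edge in \<open>A (c x y)\<close>; but it crosses that of \<open>(x, y)\<close>, and
    \<open>Q\<close> forbids this.\<close>
  moreover have "c u v \<noteq> c x y" if "(x, y) \<in> G" "(u, v) \<in> crossing x y" for x y u v
  proof
    assume eq: "c u v = c x y"
    have uv: "(u, v) \<in> G" using that by (simp add: crossing_def)
    then obtain a b where ab: "(a, b) \<in> Hyp u v" "(a, b) \<in> A (c x y)" using Q_c[OF uv] eq unfolding Q_def by auto
    then have "(a, b) \<in> crossing x y" using crossing_closed that by blast
    then show False using Q_c[OF that(1)] ab(2) unfolding Q_def by blast
  qed
  ultimately show ?thesis using meas unfolding proper_def by blast
qed

text \<open>Greedy recolouring: the colour classes of a countable colouring are processed in order.\<close>

theorem bounded_colouring:
  assumes bound: "\<And>x y. (x, y) \<in> G \<Longrightarrow> card (crossing x y) \<le> B"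
  shows "\<exists>c. proper c \<and> (\<forall>x y. (x, y) \<in> G \<longrightarrow> c x y \<le> B)"
proof -
  obtain c where c: "proper c" using countable_colouring by blast
  note [measurable (raw)] = proper_meas[OF c]
  define step where "step = (\<lambda>(n::nat) (h :: 'a \<Rightarrow> 'a \<Rightarrow> nat) x y.
    if c x y = n then LEAST m. \<not> (\<exists>u v. (u, v) \<in> crossing x y \<and> c u v < n \<and> h u v = m) else h x y)"
  define h where "h = rec_nat (\<lambda>x y. 0) step"
  have h_Suc: "h (Suc n) x y = (if c x y = n then LEAST m. \<not> (\<exists>u v. (u, v) \<in> crossing x y \<and> c u v < n \<and> h n u v = m) else h n x y)" for n x y
    by (simp add: h_def step_def)
  have stable: "h (n + k) x y = h n x y" if "c x y < n" for n k x y
    by (induction k) (use that in \<open>simp_all add: h_Suc\<close>)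
  \<comment> \<open>Stage \<open>c x y\<close> is the only one that recolours \<open>(x, y)\<close>;
    \<open>K\<close> reads the value just afterwards.\<close>
  define K where "K x y = h (Suc (c x y)) x y" for x y
  have hK: "h n x y = K x y" if "c x y < n" for n x y
    using stable[of x y "Suc (c x y)" "n - Suc (c x y)"] that by (simp add: K_def)
  have meas_h: "(\<lambda>p. h n (fst p) (snd p)) \<in> M \<Otimes>\<^sub>M M \<rightarrow>\<^sub>M count_space UNIV" for n
  proof (induction n)
    case 0 then show ?case by (simp add: h_def)
  next
    case (Suc n)
    have [measurable (raw)]: "(\<lambda>w. h n (a w) (b w)) \<in> N \<rightarrow>\<^sub>M count_space UNIV" if "a \<in> N \<rightarrow>\<^sub>M M" "b \<in> N \<rightarrow>\<^sub>M M" for a b and N :: "'d measure"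
      using measurable_compose[OF measurable_Pair[OF that] Suc.IH] by simp
    have ex: "(\<exists>u v. (u, v) \<in> crossing x y \<and> c u v < n \<and> h n u v = m) \<longleftrightarrow>
        (\<exists>i j. (g i x, g j x) \<in> crossing x y \<and> c (g i x) (g j x) < n \<and> h n (g i x) (g j x) = m)" if "x \<in> space M" for x y m
      by (rule all_pairs[OF that]) (use G_E in \<open>auto simp: crossing_def\<close>)
    have "(\<lambda>p. if c (fst p) (snd p) = n then LEAST m. \<not> (\<exists>i j. (g i (fst p), g j (fst p)) \<in> crossing (fst p) (snd p) \<and>
        c (g i (fst p)) (g j (fst p)) < n \<and> h n (g i (fst p)) (g j (fst p)) = m) else h n (fst p) (snd p))
      \<in> M \<Otimes>\<^sub>M M \<rightarrow>\<^sub>M count_space UNIV" by measurable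
    moreover have "h (Suc n) (fst p) (snd p) = (if c (fst p) (snd p) = n then LEAST m. \<not> (\<exists>i j. (g i (fst p), g j (fst p)) \<in> crossing (fst p) (snd p) \<and>
        c (g i (fst p)) (g j (fst p)) < n \<and> h n (g i (fst p)) (g j (fst p)) = m) else h n (fst p) (snd p))"
      if "p \<in> space (M \<Otimes>\<^sub>M M)" for p
    proof -
      have p: "fst p \<in> space M" using that by (auto simp: space_pair_measure)
      show ?thesis unfolding h_Suc ex[OF p] by (rule refl)
    qed
    ultimately show ?case by (simp cong: measurable_cong)
  qed
  have [measurable]: "(\<lambda>p. K (fst p) (snd p)) \<in> M \<Otimes>\<^sub>M M \<rightarrow>\<^sub>M count_space UNIV"
    unfolding K_def
    by (rule measurable_compose_countable'[where f = "\<lambda>n p. h (Suc n) (fst p) (snd p)" and I = UNIV])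
      (use meas_h in measurable)
  \<comment> \<open>The greedy recursion: the least value not taken by a crossing hyperplane with a
    smaller old colour.\<close>
  have K: "K x y = (LEAST m. m \<notin> (\<lambda>(u, v). K u v) ` {(u, v) \<in> crossing x y. c u v < c x y})" for x y
  proof -
    have "(\<exists>u v. (u, v) \<in> crossing x y \<and> c u v < c x y \<and> h (c x y) u v = m) \<longleftrightarrow>
        m \<in> (\<lambda>(u, v). K u v) ` {(u, v) \<in> crossing x y. c u v < c x y}" for m
      using hK by force
    then show ?thesis unfolding K_def[of x y] h_Suc by simp
  qed
  have K_least: "K x y \<notin> (\<lambda>(u, v). K u v) ` {(u, v) \<in> crossing x y. c u v < c x y} \<and> K x y \<le> B" if xy: "(x, y) \<in> G" for x y
  proof -
    let ?S = "(\<lambda>(u, v). K u v) ` {(u, v) \<in> crossing x y. c u v < c x y}"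
    have sub: "{(u, v) \<in> crossing x y. c u v < c x y} \<subseteq> crossing x y" by auto
    have "finite (crossing x y)" by (rule finite_crossing[OF fin_Hyp xy])
    then have fin: "finite {(u, v) \<in> crossing x y. c u v < c x y}" "card {(u, v) \<in> crossing x y. c u v < c x y} \<le> B"
      using finite_subset[OF sub] le_trans[OF card_mono[OF _ sub] bound[OF xy]] by blast+
    then have S: "finite ?S" "card ?S \<le> B" using le_trans[OF card_image_le[OF fin(1)]] by blast+
    \<comment> \<open>Pigeonhole: \<open>{..B}\<close> has \<open>B + 1\<close> elements and at most
      \<open>B\<close> values are taken.\<close>
    have "\<not> {..B} \<subseteq> ?S" using card_mono[OF S(1), of "{..B}"] S(2) by auto
    then obtain m where m: "m \<le> B" "m \<notin> ?S" by auto
    show ?thesis unfolding K[of x y] using LeastI[of "\<lambda>m. m \<notin> ?S", OF m(2)] Least_le[of "\<lambda>m. m \<notin> ?S", OF m(2)] m(1) by simp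
  qed
  have inv: "c u v = c x y" if "(x, y) \<in> G" "(u, v) \<in> Hyp x y" for x y u v
    using c that unfolding proper_def by blast
  have "K u v = K x y" if "(x, y) \<in> G" "(u, v) \<in> Hyp x y" for x y u v
    unfolding K[of u v] K[of x y] crossing_Hyp[OF that] inv[OF that] ..
  moreover have "K u v \<noteq> K x y" if "(x, y) \<in> G" "(u, v) \<in> crossing x y" for x y u v
  proof -
    have uv: "(u, v) \<in> G" using that by (simp add: crossing_def)
    have "c u v \<noteq> c x y" using c that unfolding proper_def by blast
    then consider "c u v < c x y" | "c x y < c u v" by linarith
    then show ?thesis
    proof cases
      case 1
      then have "K u v \<in> (\<lambda>(u, v). K u v) ` {(u, v) \<in> crossing x y. c u v < c x y}" using that by force
      then show ?thesis using K_least[OF that(1)] by metis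
    next
      case 2
      then have "K x y \<in> (\<lambda>(u, v). K u v) ` {(x, y) \<in> crossing u v. c x y < c u v}" using crossing_sym[OF that] by force
      then show ?thesis using K_least[OF uv] by metis
    qed
  qed
  ultimately have "proper K" unfolding proper_def using \<open>(\<lambda>p. K (fst p) (snd p)) \<in> M \<Otimes>\<^sub>M M \<rightarrow>\<^sub>M count_space UNIV\<close> by blast
  then show ?thesis using K_least by blast
qed

end

subsection \<open>Borel treeings of median graphings\<close>

text \<open>The tests are read as digits 0 and 1 in base 3. After a first difference at
  \<open>j\<close> the tails contribute at most half of \<open>(1 / 3) ^ j\<close>, so that digit
  decides the order; in base 2 a tail could make up for it.\<close>

lemma (in coded_space) real_code: "\<exists>e :: 'a \<Rightarrow> real. e \<in> borel_measurable M \<and> inj_on e (space M)"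
proof -
  define f where "f x j = indicator (V j) x * (1 / 3 :: real) ^ j" for x :: 'a and j :: nat
  define e where "e x = (\<Sum>j. f x j)" for x
  have f01: "0 \<le> f x j" "f x j \<le> (1 / 3) ^ j" for x j by (auto simp: f_def indicator_def)
  have geo: "summable (\<lambda>j. (1 / 3 :: real) ^ j)" by (intro summable_geometric) simp
  have sm: "summable (f x)" for x
    by (rule summable_comparison_test'[OF geo, of 0]) (use f01 in simp)
  have "e \<in> borel_measurable M" unfolding e_def f_def by measurable
  moreover have lt: "e x < e y" if j: "x \<notin> V j" "y \<in> V j" "\<And>i. i < j \<Longrightarrow> x \<in> V i \<longleftrightarrow> y \<in> V i" for x y j
  proof -
    have split: "e z = (\<Sum>i<Suc j. f z i) + (\<Sum>i. f z (i + Suc j))" for z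
      unfolding e_def using suminf_split_initial_segment[OF sm, of z "Suc j"] by simp
    have "(\<Sum>i. f x (i + Suc j)) \<le> (\<Sum>i. (1 / 3) ^ (i + Suc j))"
      using sm geo f01 by (intro suminf_le) (simp_all only: summable_iff_shift)
    also have "\<dots> = (\<Sum>i. (1 / 3) ^ i) * (1 / 3) ^ Suc j"
      unfolding power_add by (rule suminf_mult2[OF geo, symmetric])
    also have "\<dots> = (1 / 3) ^ j / 2" by (simp add: suminf_geometric)
    finally have "(\<Sum>i. f x (i + Suc j)) < (1 / 3) ^ j" by (rule order_le_less_trans) simp
    moreover have "0 \<le> (\<Sum>i. f y (i + Suc j))"
      using sm f01 by (intro suminf_nonneg) (simp_all only: summable_iff_shift)
    moreover have "(\<Sum>i<j. f x i) = (\<Sum>i<j. f y i)" using j(3) by (intro sum.cong) (auto simp: f_def indicator_def)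
    moreover have "f x j = 0" "f y j = (1 / 3) ^ j" using j by (auto simp: f_def)
    ultimately show ?thesis unfolding split[of x] split[of y] by simp
  qed
  moreover have "inj_on e (space M)"
  proof (rule inj_onI, rule ccontr)
    fix x y assume xy: "x \<in> space M" "y \<in> space M" "e x = e y" "x \<noteq> y"
    then have ex: "\<exists>j. (x \<in> V j) \<noteq> (y \<in> V j)" using sep unfolding separating_def by blast
    define j where "j = (LEAST j. (x \<in> V j) \<noteq> (y \<in> V j))"
    have j: "(x \<in> V j) \<noteq> (y \<in> V j)" "\<And>i. i < j \<Longrightarrow> x \<in> V i \<longleftrightarrow> y \<in> V i"
      unfolding j_def using LeastI_ex[OF ex] not_less_Least[of _ "\<lambda>j. (x \<in> V j) \<noteq> (y \<in> V j)"] by blast+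
    then show False using lt[of x j y] lt[of y j x] xy(3) by (cases "x \<in> V j") auto
  qed
  ultimately show ?thesis by blast
qed

lemma relpow_mono_subset:
  fixes R S :: "('b \<times> 'b) set"
  assumes "R \<subseteq> S" shows "R ^^ n \<subseteq> S ^^ n"
  by (induction n) (use assms in \<open>simp_all add: relcomp_mono\<close>)

locale borel_coloured = borel_median M V G E g + coloured_median_graphing "space M" G E c e
  for M :: "'a measure" and V G E g c e +
  assumes c_proper: "proper c" and e_meas [measurable]: "e \<in> borel_measurable M"
begin

section \<open>Measurability of the tree\<close>

lemma meas_below:
  assumes [measurable]: "k \<in> N \<rightarrow>\<^sub>M count_space UNIV" "f \<in> N \<rightarrow>\<^sub>M M" "h \<in> N \<rightarrow>\<^sub>M M"
  shows "Measurable.pred N (\<lambda>w. below (k w) (f w) (h w))"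
proof -
  have [measurable (raw)]: "(\<lambda>w. c (a w) (b w)) \<in> borel_measurable N" if "a \<in> N \<rightarrow>\<^sub>M M" "b \<in> N \<rightarrow>\<^sub>M M" for a b
    by (rule measurable_compose[OF proper_meas[OF c_proper that]]) simp
  have [measurable]: "k \<in> borel_measurable N" by (rule measurable_compose[of k N "count_space UNIV" "\<lambda>x. x"]) simp_all
  have "below n x x' \<longleftrightarrow> (x, x') \<in> E \<and>
      \<not> (\<exists>i j. (g i x, g j x) \<in> G \<and> sep (g i x) (g j x) x x' \<and> n \<le> c (g i x) (g j x))" if x: "x \<in> space M" for n x x'
  proof -
    have "(\<exists>u v. (u, v) \<in> G \<and> (x, u) \<in> E \<and> sep u v x x' \<and> n \<le> c u v) \<longleftrightarrow>
        (\<exists>i j. (g i x, g j x) \<in> G \<and> (x, g i x) \<in> E \<and> sep (g i x) (g j x) x x' \<and> n \<le> c (g i x) (g j x))"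
      by (rule all_pairs[OF x]) (use G_E in blast)
    moreover have "below n x x' \<longleftrightarrow> (x, x') \<in> E \<and> \<not> (\<exists>u v. (u, v) \<in> G \<and> (x, u) \<in> E \<and> sep u v x x' \<and> n \<le> c u v)"
      unfolding below_def not_less[symmetric] by blast
    ultimately show ?thesis using g_class[OF x] by simp
  qed
  then have "below (k w) (f w) (h w) \<longleftrightarrow> (f w, h w) \<in> E \<and>
      \<not> (\<exists>i j. (g i (f w), g j (f w)) \<in> G \<and> sep (g i (f w)) (g j (f w)) (f w) (h w) \<and> k w \<le> c (g i (f w)) (g j (f w)))"
    if "w \<in> space N" for w
    using measurable_space[OF assms(2) that] by blast
  moreover have "Measurable.pred N (\<lambda>w. (f w, h w) \<in> E \<and>
      \<not> (\<exists>i j. (g i (f w), g j (f w)) \<in> G \<and> sep (g i (f w)) (g j (f w)) (f w) (h w) \<and> k w \<le> c (g i (f w)) (g j (f w))))"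
    by measurable
  ultimately show ?thesis by (simp cong: measurable_cong)
qed

text \<open>Half-spaces are subsets of a class, so their equality can be tested along the
  enumeration \<open>g\<close>.\<close>

lemma meas_equivalent:
  assumes [measurable]: "a \<in> N \<rightarrow>\<^sub>M M" "b \<in> N \<rightarrow>\<^sub>M M" "f \<in> N \<rightarrow>\<^sub>M M" "h \<in> N \<rightarrow>\<^sub>M M"
  shows "Measurable.pred N (\<lambda>w. equivalent (a w) (b w) (f w) (h w))"
proof -
  have "equivalent x y x' y' \<longleftrightarrow> (x', y') \<in> G \<and> (\<forall>k. g k x \<in> hs x' y' \<longleftrightarrow> g k x \<in> hs x y) \<and> below (c x y) x x'" for x y x' y'
  proof (cases "(x, x') \<in> E")
    case True
    have "hs x' y' = hs x y" if *: "\<And>k. g k x \<in> hs x' y' \<longleftrightarrow> g k x \<in> hs x y"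
    proof (rule set_eqI)
      fix z show "z \<in> hs x' y' \<longleftrightarrow> z \<in> hs x y"
      proof (cases "(x, z) \<in> E")
        case True then show ?thesis using E_g[OF True] * by blast
      next
        case False then show ?thesis using hs_E[of z x' y'] hs_E[of z x y] E_trans[OF \<open>(x, x') \<in> E\<close>] by blast
      qed
    qed
    then show ?thesis unfolding equivalent_def by auto
  qed (auto simp: equivalent_def below_def)
  moreover have [measurable]: "Measurable.pred N (\<lambda>w. below (c (a w) (b w)) (a w) (f w))"
    by (rule meas_below[OF proper_meas[OF c_proper assms(1,2)] assms(1,3)])
  have "Measurable.pred N (\<lambda>w. (f w, h w) \<in> G \<and> (\<forall>k. g k (a w) \<in> hs (f w) (h w) \<longleftrightarrow> g k (a w) \<in> hs (a w) (b w)) \<and>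
      below (c (a w) (b w)) (a w) (f w))"
    by measurable
  ultimately show ?thesis by simp
qed

lemma T_sets: "T \<in> sets (M \<Otimes>\<^sub>M M)"
proof -
  have "T = {p \<in> space (M \<Otimes>\<^sub>M M). (fst p, snd p) \<in> G \<and> \<not> (\<exists>i j. equivalent (fst p) (snd p) (g i (fst p)) (g j (fst p)) \<and>
      min (e (g i (fst p))) (e (g j (fst p))) < min (e (fst p)) (e (snd p)))}" (is "_ = ?S")
  proof -
    have "(x, y) \<in> T \<longleftrightarrow> (x, y) \<in> ?S" for x y
    proof (cases "(x, y) \<in> G")
      case True
      then have x: "x \<in> space M" "y \<in> space M" using G_X by auto
      have "(\<exists>x' y'. equivalent x y x' y' \<and> min (e x') (e y') < min (e x) (e y)) \<longleftrightarrow>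
          (\<exists>i j. equivalent x y (g i x) (g j x) \<and> min (e (g i x)) (e (g j x)) < min (e x) (e y))"
        by (rule all_pairs[OF x(1)]) (use G_E in \<open>auto simp: equivalent_def below_def\<close>)
      moreover have "(x, y) \<in> T \<longleftrightarrow> \<not> (\<exists>x' y'. equivalent x y x' y' \<and> min (e x') (e y') < min (e x) (e y))"
        using True unfolding T_def mem_Collect_eq split_conv not_le[symmetric] by blast
      ultimately show ?thesis using x True by (simp add: space_pair_measure)
    qed (auto simp: T_def)
    then show ?thesis by auto
  qed
  also have "\<dots> \<in> sets (M \<Otimes>\<^sub>M M)"
  proof -
    have [measurable]: "Measurable.pred (M \<Otimes>\<^sub>M M) (\<lambda>p. equivalent (fst p) (snd p) (g i (fst p)) (g j (fst p)))" for i j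
      by (rule meas_equivalent) measurable
    show ?thesis by measurable
  qed
  finally show ?thesis .
qed

lemma rtrancl_T: "T\<^sup>* = G\<^sup>*"
  using G_rtrancl_T T_G by (intro rtrancl_subset[symmetric]) auto

lemma borel_treeing_T: "borel_treeing M E T"
  unfolding borel_treeing_def borel_graphing_def borel_graph_def graph_on_def
  using T_G G_X G_irrefl T_sym T_sets acyclic_T rtrancl_T E_eq
  by (auto simp: connectedness_def sym_def irrefl_def)

section \<open>Comparison of the two path metrics\<close>

lemma gdist_T_ge:
  assumes "(x, y) \<in> E" shows "gdist G x y \<le> gdist T x y"
proof -
  have "(x, y) \<in> T\<^sup>*" using assms rtrancl_T by (simp add: E_eq connectedness_def)
  then have "(x, y) \<in> T ^^ (LEAST n. (x, y) \<in> T ^^ n)" by (metis LeastI rtrancl_power)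
  then have "(x, y) \<in> G ^^ (LEAST n. (x, y) \<in> T ^^ n)" using relpow_mono_subset[OF T_G] by blast
  then show ?thesis unfolding gdist_d by (simp add: gdist_def d_le)
qed

lemma gdist_T_le:
  assumes L: "\<And>x y. (x, y) \<in> G \<Longrightarrow> \<exists>i\<le>L. (x, y) \<in> T ^^ i" and xy: "(x, y) \<in> E"
  shows "gdist T x y \<le> real L * gdist G x y"
proof -
  have "G \<subseteq> {(x, y). \<exists>i\<le>L. (x, y) \<in> T ^^ i}" using L by blast
  then have "(x, y) \<in> {(x, y). \<exists>i\<le>L. (x, y) \<in> T ^^ i} ^^ d x y" by (rule subsetD[OF relpow_mono_subset relpow_d[OF xy]])
  from relpow_bounded[OF this] obtain i where i: "i \<le> L * d x y" "(x, y) \<in> T ^^ i" by blast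
  then have "(LEAST n. (x, y) \<in> T ^^ n) \<le> i" by (intro Least_le)
  then have "(LEAST n. (x, y) \<in> T ^^ n) \<le> L * d x y" using i(1) by simp
  then show ?thesis unfolding gdist_d unfolding gdist_def by (simp flip: of_nat_mult)
qed

lemma quasi_isometry_T:
  assumes L: "\<And>x y. (x, y) \<in> G \<Longrightarrow> \<exists>i\<le>L. (x, y) \<in> T ^^ i" and C: "C \<in> space M // E"
  shows "quasi_isometry C (gdist (Restr T C)) C (gdist (Restr G C)) (\<lambda>x. x)"
proof -
  obtain z where z: "C = E `` {z}" using C by (auto simp: quotient_def)
  \<comment> \<open>The 1 comes from \<open>T \<subseteq> G\<close> and \<open>L\<close> from
    \<open>gdist_T_le\<close>; the maximum also serves as a nonnegative additive constant.\<close>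
  define K where "K = max 1 (real L)"
  have K: "1 \<le> K" "real L \<le> K" by (auto simp: K_def)
  have E: "(x, y) \<in> E" if "x \<in> C" "y \<in> C" for x y using that E_sym E_trans unfolding z by blast
  have T: "gdist (Restr T C) x y = gdist T x y" and G: "gdist (Restr G C) x y = gdist G x y" if "x \<in> C" for x y
    using gdist_Restr[OF T_G] gdist_Restr[OF subset_refl] that unfolding z by blast+
  have pos: "0 \<le> gdist H x y" for H :: "('a \<times> 'a) set" and x y by (simp add: gdist_def)
  have self: "gdist H x x = 0" for H :: "('a \<times> 'a) set" and x
    unfolding gdist_def by (simp add: Least_eq_0)
  have "gdist (Restr G C) x y \<le> K * gdist (Restr T C) x y + K" if "x \<in> C" "y \<in> C" for x y
    using gdist_T_ge[OF E[OF that]] mult_right_mono[OF K(1) pos[of T x y]] K(1) unfolding T[OF that(1)] G[OF that(1)] by linarith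
  moreover have "gdist (Restr T C) x y \<le> K * gdist (Restr G C) x y + K" if "x \<in> C" "y \<in> C" for x y
    using gdist_T_le[OF L E[OF that]] mult_right_mono[OF K(2) pos[of G x y]] K(1) unfolding T[OF that(1)] G[OF that(1)] by linarith
  ultimately show ?thesis
    unfolding quasi_isometry_def using K(1) self by (intro conjI bexI[of _ "\<lambda>x. x"] exI[of _ K]) auto
qed

end

theorem theorem3p5:
  fixes M :: "'a measure" and E G :: "('a \<times> 'a) set"
  assumes "standard_borel M"
    and "cber M E"
    and "borel_median_graphing M E G"
    and "finite_hyperplanes (space M) G"
  shows "(\<exists>T. T \<subseteq> G \<and> borel_treeing M E T) \<and>
    (bounded_degree (space M) G \<and> bounded_diameter_hyperplanes (space M) G \<longrightarrow>
      (\<exists>T. T \<subseteq> G \<and> borel_treeing M E T \<and>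
        (\<forall>C\<in>space M // E.
          quasi_isometry C (gdist (Restr T C)) C (gdist (Restr G C)) (\<lambda>x. x))))"
proof -
  obtain V where "borel_coded M V" using standard_borel_coded[OF assms(1)] by blast
  then interpret borel_coded M V .
  interpret median_graphing "space M" G E
    using assms(3) by unfold_locales (auto simp: borel_median_graphing_def borel_graphing_def borel_graph_def)
  obtain g where g: "\<And>n::nat. g n \<in> M \<rightarrow>\<^sub>M M" "\<And>x. x \<in> space M \<Longrightarrow> E `` {x} = range (\<lambda>n. g n x)"
    using cber_enumeration[OF assms(2)] by blast
  interpret borel_median M V G E g
    using g assms(2,3) finite_Hyp[OF assms(4)]
    by unfold_locales (auto simp: borel_median_graphing_def borel_graphing_def borel_graph_def cber_def)
  obtain e :: "'a \<Rightarrow> real" where e: "e \<in> borel_measurable M" "inj_on e (space M)" using real_code by blast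
  have coloured: "borel_coloured M V G E g c e" if "proper c" for c
  proof unfold_locales
    show "c u v = c x y" if "(x, y) \<in> G" "(u, v) \<in> Hyp x y" for x y u v
      using \<open>proper c\<close> that unfolding proper_def by blast
    show "c x y \<noteq> c u v" if "(x, y) \<in> G" "(u, v) \<in> G" "(x, u) \<in> E" "cross x y u v" for x y u v
    proof -
      have "(u, v) \<in> crossing x y" using that by (simp add: crossing_def)
      then show ?thesis using \<open>proper c\<close> that(1) unfolding proper_def by metis
    qed
  qed (use fin_Hyp e \<open>proper c\<close> in auto)
  show ?thesis
  proof (intro conjI impI)
    obtain c where "proper c" using countable_colouring by blast
    then interpret borel_coloured M V G E g c e by (rule coloured)
    show "\<exists>T. T \<subseteq> G \<and> borel_treeing M E T" using T_G borel_treeing_T by blast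
  next
    assume bd: "bounded_degree (space M) G \<and> bounded_diameter_hyperplanes (space M) G"
    obtain R where R: "\<And>x y u v. (x, y) \<in> G \<Longrightarrow> u \<in> Field (Hyp x y) \<Longrightarrow> v \<in> Field (Hyp x y) \<Longrightarrow> d u v \<le> R"
      using bounded_Hyp bd by blast
    obtain B where B: "\<And>x. x \<in> space M \<Longrightarrow> finite {z. (x, z) \<in> E \<and> d x z \<le> 3 * R} \<and> card {z. (x, z) \<in> E \<and> d x z \<le> 3 * R} \<le> B"
      using card_ball[of "3 * R"] bd by blast
    \<comment> \<open>A crossing edge has both ends in the ball of radius \<open>3 * R\<close> about
      \<open>x\<close>, which leaves at most \<open>B * B\<close> pairs.\<close>
    have "card (crossing x y) \<le> B * B" if xy: "(x, y) \<in> G" for x y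
    proof -
      let ?S = "{z. (x, z) \<in> E \<and> d x z \<le> 3 * R}"
      have "d x u \<le> 3 * R \<and> d x v \<le> 3 * R" if "(u, v) \<in> crossing x y" for u v
        by (rule crossing_near[OF _ xy that]) (rule R)
      then have "crossing x y \<subseteq> ?S \<times> ?S"
        using E_trans[OF _ G_E] by (auto simp: crossing_def)
      moreover have S: "finite ?S" "card ?S \<le> B" using B G_X[OF xy] by auto
      ultimately have "card (crossing x y) \<le> card ?S * card ?S"
        using card_mono[of "?S \<times> ?S" "crossing x y"] by (simp add: card_cartesian_product)
      also have "\<dots> \<le> B * B" using S(2) by (intro mult_le_mono)
      finally show ?thesis .
    qed
    then obtain c where c: "proper c" "\<And>x y. (x, y) \<in> G \<Longrightarrow> c x y \<le> B * B" using bounded_colouring by metis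
    interpret borel_coloured M V G E g c e using c(1) by (rule coloured)
    \<comment> \<open>\<open>T_bounded\<close> takes a strict bound on the colours, hence the
      \<open>Suc\<close>.\<close>
    have "\<exists>L. \<forall>x y. (x, y) \<in> G \<longrightarrow> c x y < Suc (B * B) \<longrightarrow> (\<exists>i\<le>L. (x, y) \<in> T ^^ i)"
      by (rule T_bounded) (rule R)
    then obtain L where "\<And>x y. (x, y) \<in> G \<Longrightarrow> c x y < Suc (B * B) \<Longrightarrow> \<exists>i\<le>L. (x, y) \<in> T ^^ i"
      by blast
    then have "\<exists>i\<le>L. (x, y) \<in> T ^^ i" if "(x, y) \<in> G" for x y using c(2) that by (simp add: less_Suc_eq_le)
    then show "\<exists>T. T \<subseteq> G \<and> borel_treeing M E T \<and>
        (\<forall>C\<in>space M // E. quasi_isometry C (gdist (Restr T C)) C (gdist (Restr G C)) (\<lambda>x. x))"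
      using T_G borel_treeing_T quasi_isometry_T by blast
  qed
qed

end
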